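(* Let $(M,\omega)$ be a Hamiltonian $G$-space and assume $H^1(\mathfrak g,\mathbb R)=0$ (so that each $G$-invariant star product has a unique quantum moment map, if it has one). Let $*$ and $*'$ be $G$-invariant star products on $N[[\lambda]]$ and let $\Phi_*$ and $\Phi_{*'}$ be the corresponding quantum moment maps. If $T$ is a $G$-equivalence between $*$ and $*'$, then $\Phi_{*'}=T\Phi_*$.
   Context: $G$ is a Lie group with finite-dimensional Lie algebra $\mathfrak g$; a Hamiltonian $G$-space is a symplectic manifold with a Hamiltonian $G$-action admitting a moment map. $N=C^\infty(M)$ (complex valued), with Poisson bracket $\{\cdot,\cdot\}$. $G$ acts on $N[[\lambda]]$ by $(gu)(x)=u(g^{-1}x)$, and $u\mapsto Xu$ ($X\in\mathfrak g$) is the infinitesimal action. A star product is an associative $\mathbb C[[\lambda]]$-bilinear product on $N[[\lambda]]$ of the form $f*g=\sum_{n\ge0}(\lambda/2)^nC_n(f,g)$ with $C_0(f,g)=fg$, $C_1(f,g)-C_1(g,f)=2\{f,g\}$, $C_k(1,f)=C_k(f,1)=0$ for $k\ge1$, and each $C_k$ a bidifferential operator. It is $G$-invariant if $g(u*v)=gu*gv$ for all $u,v\in N[[\lambda]]$, $g\in G$. A $G$-equivalence between $G$-invariant star products $*$ and $*'$ is a formal series $T=\mathrm{Id}+\sum_{n\ge1}\lambda^nT_n$ of differential operators annihilating constants, commuting with the $G$-action, with $f*'g=T(T^{-1}f*T^{-1}g)$. $\mathfrak g_\lambda$ is $\mathfrak g[[\lambda]]$ with $\lambda$-linear bracket $[\xi,\eta]_\lambda=\lambda[\xi,\eta]$,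 and $\mathfrak U(\mathfrak g_\lambda)$ is its universal enveloping algebra over $\mathbb C[[\lambda]]$. A quantum moment map of a $G$-invariant star product $*$ is a homomorphism of associative $\mathbb C[[\lambda]]$-algebras $\Phi_*:\mathfrak U(\mathfrak g_\lambda)\to(N[[\lambda]],* )$ with $[\Phi_*(X),u]_*=\lambda Xu$ for all $X\in\mathfrak g$, $u\in N[[\lambda]]$, where $[a,b]_*=a*b-b*a$. *)

theory Defs
  imports
    "HOL-Analysis.Analysis"
    "HOL-Algebra.QuotRing"
    "HOL-Algebra.Module"
    "HOL-Algebra.Group_Action"
    "HOL-Library.Function_Algebras"
    "HOL-Computational_Algebra.Formal_Power_Series"
begin

section \<open>Smooth manifolds\<close>

text \<open>The model space of a manifold is a finite-dimensional real normed space; the class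
  \<open>euclidean_space\<close> is not used because it excludes dimension 0.\<close>

fun dir_derivs :: "'e::real_normed_vector list \<Rightarrow> ('e \<Rightarrow> 'b::real_normed_vector) \<Rightarrow> 'e \<Rightarrow> 'b" where
  "dir_derivs [] f = f"
| "dir_derivs (v # vs) f = (\<lambda>x. frechet_derivative (dir_derivs vs f) (at x) v)"

text \<open>Used for open \<open>S\<close> only: all iterated directional derivatives exist and are
  differentiable, which in finite dimension means that \<open>f\<close> is of class $C^\infty$ on \<open>S\<close>.\<close>

definition smooth_on :: "'e::real_normed_vector set \<Rightarrow> ('e \<Rightarrow> 'b::real_normed_vector) \<Rightarrow> bool" where
  "smooth_on S f \<longleftrightarrow> (\<forall>vs. \<forall>x\<in>S. dir_derivs vs f differentiable (at x))"

text \<open>A chart is a pair of its domain and its coordinate map; the values of the coordinate map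
  outside the domain are irrelevant.\<close>

type_synonym ('m, 'e) chart = "'m set \<times> ('m \<Rightarrow> 'e)"

definition smooth_atlas ::
  "('m::{t2_space,second_countable_topology}, 'e::real_normed_vector) chart set \<Rightarrow> bool" where
  "smooth_atlas A \<longleftrightarrow>
     (\<exists>B::'e set. finite B \<and> span B = UNIV) \<and>
     (\<Union>(U, \<phi>)\<in>A. U) = UNIV \<and>
     (\<forall>(U, \<phi>)\<in>A. open U \<and> open (\<phi> ` U) \<and> (\<exists>\<psi>. homeomorphism U (\<phi> ` U) \<phi> \<psi>)) \<and>
     (\<forall>(U, \<phi>)\<in>A. \<forall>(V, \<psi>)\<in>A. smooth_on (\<phi> ` (U \<inter> V)) (\<psi> \<circ> inv_into U \<phi>))"

definition smooth_fun ::
  "('m, 'e::real_normed_vector) chart set \<Rightarrow> ('m \<Rightarrow> 'b::real_normed_vector) \<Rightarrow> bool" where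
  "smooth_fun A f \<longleftrightarrow> (\<forall>(U, \<phi>)\<in>A. smooth_on (\<phi> ` U) (f \<circ> inv_into U \<phi>))"

definition smooth_map ::
  "('m::topological_space, 'e::real_normed_vector) chart set \<Rightarrow>
   ('n::topological_space, 'd::real_normed_vector) chart set \<Rightarrow> ('m \<Rightarrow> 'n) \<Rightarrow> bool" where
  "smooth_map A B f \<longleftrightarrow> continuous_on UNIV f \<and>
     (\<forall>(U, \<phi>)\<in>A. \<forall>(V, \<psi>)\<in>B. smooth_on (\<phi> ` (U \<inter> f -` V)) (\<psi> \<circ> f \<circ> inv_into U \<phi>))"

definition prod_atlas ::
  "('m, 'e) chart set \<Rightarrow> ('n, 'd) chart set \<Rightarrow> ('m \<times> 'n, 'e \<times> 'd) chart set" where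
  "prod_atlas A B = {(U \<times> V, map_prod \<phi> \<psi>) | U \<phi> V \<psi>. (U, \<phi>) \<in> A \<and> (V, \<psi>) \<in> B}"

section \<open>Tangent vectors and vector fields\<close>

type_synonym 'm cfun = "'m \<Rightarrow> complex"

text \<open>A real tangent vector is identified with the directional derivative it defines on complex
  valued smooth functions. By convention it is 0 on functions that are not smooth, so that equality
  of functionals is equality of tangent vectors.\<close>

definition tangent_space ::
  "('m, 'e::real_normed_vector) chart set \<Rightarrow> 'm \<Rightarrow> ('m cfun \<Rightarrow> complex) set" where
  "tangent_space A p =
     {(\<lambda>f. if smooth_fun A f then frechet_derivative (f \<circ> inv_into U \<phi>) (at (\<phi> p)) a else 0)
       | U \<phi> a. (U, \<phi>) \<in> A \<and> p \<in> U}"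

definition at_point :: "('m cfun \<Rightarrow> 'm cfun) \<Rightarrow> 'm \<Rightarrow> 'm cfun \<Rightarrow> complex" where
  "at_point X p = (\<lambda>f. X f p)"

definition vector_fields ::
  "('m, 'e::real_normed_vector) chart set \<Rightarrow> ('m cfun \<Rightarrow> 'm cfun) set" where
  "vector_fields A =
     {X. (\<forall>p. at_point X p \<in> tangent_space A p) \<and> (\<forall>f. smooth_fun A f \<longrightarrow> smooth_fun A (X f))}"

definition vf_bracket ::
  "('m cfun \<Rightarrow> 'm cfun) \<Rightarrow> ('m cfun \<Rightarrow> 'm cfun) \<Rightarrow> 'm cfun \<Rightarrow> 'm cfun" where
  "vf_bracket X Y = (\<lambda>f. X (Y f) - Y (X f))"

definition vf_scale :: "real \<Rightarrow> ('m cfun \<Rightarrow> 'm cfun) \<Rightarrow> 'm cfun \<Rightarrow> 'm cfun" where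
  "vf_scale c X = (\<lambda>f x. of_real c * X f x)"

section \<open>Lie groups and their Lie algebras\<close>

definition lie_group ::
  "'g::{t2_space,second_countable_topology} monoid \<Rightarrow> ('g, 'd::real_normed_vector) chart set \<Rightarrow> bool" where
  "lie_group G AG \<longleftrightarrow> group G \<and> carrier G = UNIV \<and> smooth_atlas AG \<and>
     smooth_map (prod_atlas AG AG) AG (\<lambda>(x, y). x \<otimes>\<^bsub>G\<^esub> y) \<and>
     smooth_map AG AG (\<lambda>x. inv\<^bsub>G\<^esub> x)"

text \<open>The Lie algebra consists of the left-invariant real vector fields, with \<open>vf_bracket\<close>,
  pointwise addition and \<open>vf_scale\<close>.\<close>

definition lie_algebra ::
  "'g monoid \<Rightarrow> ('g, 'd::real_normed_vector) chart set \<Rightarrow> ('g cfun \<Rightarrow> 'g cfun) set" where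
  "lie_algebra G AG =
     {X \<in> vector_fields AG. \<forall>g f. X (\<lambda>x. f (g \<otimes>\<^bsub>G\<^esub> x)) = (\<lambda>x. X f (g \<otimes>\<^bsub>G\<^esub> x))}"

text \<open>$H^1(\mathfrak g,\mathbb R)$ is cocycles modulo coboundaries in the Chevalley-Eilenberg complex
  of the trivial module: $(d\alpha)(X,Y) = -\alpha([X,Y])$ for 1-cochains, and
  $(dc)(X) = X \cdot c = 0$ for 0-cochains.\<close>

definition linear_form :: "('g cfun \<Rightarrow> 'g cfun) set \<Rightarrow> (('g cfun \<Rightarrow> 'g cfun) \<Rightarrow> real) \<Rightarrow> bool" where
  "linear_form L \<alpha> \<longleftrightarrow> (\<forall>X\<in>L. \<forall>Y\<in>L. \<alpha> (X + Y) = \<alpha> X + \<alpha> Y) \<and>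
     (\<forall>c. \<forall>X\<in>L. \<alpha> (vf_scale c X) = c * \<alpha> X)"

definition cocycles1 :: "('g cfun \<Rightarrow> 'g cfun) set \<Rightarrow> (('g cfun \<Rightarrow> 'g cfun) \<Rightarrow> real) set" where
  "cocycles1 L = {\<alpha>. linear_form L \<alpha> \<and> (\<forall>X\<in>L. \<forall>Y\<in>L. - \<alpha> (vf_bracket X Y) = 0)}"

definition coboundaries1 :: "('g cfun \<Rightarrow> 'g cfun) set \<Rightarrow> (('g cfun \<Rightarrow> 'g cfun) \<Rightarrow> real) set" where
  "coboundaries1 L = {\<alpha>. \<forall>X\<in>L. \<alpha> X = 0}"

definition H1_vanishes :: "('g cfun \<Rightarrow> 'g cfun) set \<Rightarrow> bool" where
  "H1_vanishes L \<longleftrightarrow> cocycles1 L \<subseteq> coboundaries1 L"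

section \<open>Hamiltonian spaces\<close>

definition symplectic_form ::
  "('m, 'e::real_normed_vector) chart set \<Rightarrow>
   ('m \<Rightarrow> ('m cfun \<Rightarrow> complex) \<Rightarrow> ('m cfun \<Rightarrow> complex) \<Rightarrow> real) \<Rightarrow> bool" where
  "symplectic_form A \<omega> \<longleftrightarrow>
     (\<forall>p. \<forall>u\<in>tangent_space A p. \<forall>v\<in>tangent_space A p. \<forall>w\<in>tangent_space A p.
        \<omega> p (u + v) w = \<omega> p u w + \<omega> p v w) \<and>
     (\<forall>p c. \<forall>v\<in>tangent_space A p. \<forall>w\<in>tangent_space A p.
        \<omega> p (\<lambda>f. of_real c * v f) w = c * \<omega> p v w) \<and>
     (\<forall>p. \<forall>v\<in>tangent_space A p. \<forall>w\<in>tangent_space A p. \<omega> p v w = - \<omega> p w v) \<and>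
     (\<forall>p. \<forall>v\<in>tangent_space A p. (\<forall>w\<in>tangent_space A p. \<omega> p v w = 0) \<longrightarrow> v = 0) \<and>
     (let \<Omega> = (\<lambda>X Y p. complex_of_real (\<omega> p (at_point X p) (at_point Y p))) in
       (\<forall>X\<in>vector_fields A. \<forall>Y\<in>vector_fields A. smooth_fun A (\<Omega> X Y)) \<and>
       (\<forall>X\<in>vector_fields A. \<forall>Y\<in>vector_fields A. \<forall>Z\<in>vector_fields A.
          X (\<Omega> Y Z) - Y (\<Omega> X Z) + Z (\<Omega> X Y)
          - \<Omega> (vf_bracket X Y) Z + \<Omega> (vf_bracket X Z) Y - \<Omega> (vf_bracket Y Z) X = 0))"

text \<open>Conventions: $\omega(X_h,\cdot) = dh$ and $\{f,h\} = \omega(X_f,X_h) = df(X_h)$ for real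
  functions, extended complex bilinearly; thus $\{q,p\} = 1$ for $\omega = dq \wedge dp$.\<close>

definition ham_vector ::
  "('m, 'e::real_normed_vector) chart set \<Rightarrow>
   ('m \<Rightarrow> ('m cfun \<Rightarrow> complex) \<Rightarrow> ('m cfun \<Rightarrow> complex) \<Rightarrow> real) \<Rightarrow> ('m \<Rightarrow> real) \<Rightarrow> 'm \<Rightarrow>
   'm cfun \<Rightarrow> complex" where
  "ham_vector A \<omega> h p = (THE v. v \<in> tangent_space A p \<and>
     (\<forall>w\<in>tangent_space A p. complex_of_real (\<omega> p v w) = w (\<lambda>x. complex_of_real (h x))))"

definition poisson ::
  "('m, 'e::real_normed_vector) chart set \<Rightarrow>
   ('m \<Rightarrow> ('m cfun \<Rightarrow> complex) \<Rightarrow> ('m cfun \<Rightarrow> complex) \<Rightarrow> real) \<Rightarrow>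
   'm cfun \<Rightarrow> 'm cfun \<Rightarrow> 'm cfun" where
  "poisson A \<omega> f h = (\<lambda>p. ham_vector A \<omega> (\<lambda>x. Re (h x)) p f + \<i> * ham_vector A \<omega> (\<lambda>x. Im (h x)) p f)"

text \<open>\<open>inf_action G act X u\<close> is $Xu$, the differential at the identity, in the direction $X$, of
  $g \mapsto gu$ with $(gu)(p) = u(g^{-1}p)$; that is, $(Xu)(p) = \frac{d}{dt}|_{t=0}\, u(\exp(-tX)p)$.\<close>

definition inf_action ::
  "'g monoid \<Rightarrow> ('g \<Rightarrow> 'm \<Rightarrow> 'm) \<Rightarrow> ('g cfun \<Rightarrow> 'g cfun) \<Rightarrow> 'm cfun \<Rightarrow> 'm cfun" where
  "inf_action G act X u = (\<lambda>p. X (\<lambda>g. u (act (inv\<^bsub>G\<^esub> g) p)) \<one>\<^bsub>G\<^esub>)"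

text \<open>\<open>J p\<close> is the value at \<open>p\<close> of the moment map $M \to \mathfrak g^*$; equivariance is required
  in its infinitesimal form, that is, the comoment map is a Lie algebra homomorphism.\<close>

definition moment_map ::
  "'g monoid \<Rightarrow> ('g, 'd::real_normed_vector) chart set \<Rightarrow> ('m, 'e::real_normed_vector) chart set \<Rightarrow>
   ('m \<Rightarrow> ('m cfun \<Rightarrow> complex) \<Rightarrow> ('m cfun \<Rightarrow> complex) \<Rightarrow> real) \<Rightarrow> ('g \<Rightarrow> 'm \<Rightarrow> 'm) \<Rightarrow>
   ('m \<Rightarrow> ('g cfun \<Rightarrow> 'g cfun) \<Rightarrow> real) \<Rightarrow> bool" where
  "moment_map G AG AM \<omega> act J \<longleftrightarrow>
     (\<forall>p. linear_form (lie_algebra G AG) (J p)) \<and>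
     (let j = (\<lambda>X p. complex_of_real (J p X)) in
       (\<forall>X\<in>lie_algebra G AG. smooth_fun AM (j X) \<and>
          (\<forall>u. smooth_fun AM u \<longrightarrow> poisson AM \<omega> (j X) u = inf_action G act X u)) \<and>
       (\<forall>X\<in>lie_algebra G AG. \<forall>Y\<in>lie_algebra G AG.
          j (vf_bracket X Y) = poisson AM \<omega> (j X) (j Y)))"

definition hamiltonian_space ::
  "'g::{t2_space,second_countable_topology} monoid \<Rightarrow> ('g, 'd::real_normed_vector) chart set \<Rightarrow>
   ('m::{t2_space,second_countable_topology}, 'e::real_normed_vector) chart set \<Rightarrow>
   ('m \<Rightarrow> ('m cfun \<Rightarrow> complex) \<Rightarrow> ('m cfun \<Rightarrow> complex) \<Rightarrow> real) \<Rightarrow> ('g \<Rightarrow> 'm \<Rightarrow> 'm) \<Rightarrow> bool" where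
  "hamiltonian_space G AG AM \<omega> act \<longleftrightarrow>
     smooth_atlas AM \<and> symplectic_form AM \<omega> \<and>
     group_action G UNIV act \<and>
     smooth_map (prod_atlas AG AM) AM (\<lambda>(g, p). act g p) \<and>
     (\<forall>g p. \<forall>v\<in>tangent_space AM p. \<forall>w\<in>tangent_space AM p.
        \<omega> (act g p) (\<lambda>f. v (f \<circ> act g)) (\<lambda>f. w (f \<circ> act g)) = \<omega> p v w) \<and>
     (\<exists>J. moment_map G AG AM \<omega> act J)"

section \<open>Formal functions and star products\<close>

definition formal_funs ::
  "('m, 'e::real_normed_vector) chart set \<Rightarrow> 'm cfun fps set" where
  "formal_funs A = {u. \<forall>n. smooth_fun A (fps_nth u n)}"

definition formal_scale :: "complex fps \<Rightarrow> 'm cfun fps \<Rightarrow> 'm cfun fps" where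
  "formal_scale c u = Abs_fps (\<lambda>n x. \<Sum>i\<le>n. fps_nth c i * fps_nth u (n - i) x)"

definition group_translate :: "'g monoid \<Rightarrow> ('g \<Rightarrow> 'm \<Rightarrow> 'm) \<Rightarrow> 'g \<Rightarrow> 'm cfun fps \<Rightarrow> 'm cfun fps" where
  "group_translate G act g u = Abs_fps (\<lambda>n p. fps_nth u n (act (inv\<^bsub>G\<^esub> g) p))"

definition formal_inf_action ::
  "'g monoid \<Rightarrow> ('g \<Rightarrow> 'm \<Rightarrow> 'm) \<Rightarrow> ('g cfun \<Rightarrow> 'g cfun) \<Rightarrow> 'm cfun fps \<Rightarrow> 'm cfun fps" where
  "formal_inf_action G act X u = Abs_fps (\<lambda>n. inf_action G act X (fps_nth u n))"

text \<open>A differential operator is, in every chart, a finite sum of smooth coefficients times iterated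
  derivatives along constant vectors; expanding these in a basis of the model space gives the usual
  form $\sum_{|\alpha| \le k} a_\alpha \partial^\alpha$.\<close>

definition differential_operator ::
  "('m, 'e::real_normed_vector) chart set \<Rightarrow> ('m cfun \<Rightarrow> 'm cfun) \<Rightarrow> bool" where
  "differential_operator A D \<longleftrightarrow> (\<exists>k. \<forall>(U, \<phi>)\<in>A. \<exists>I a. finite I \<and>
     (\<forall>vs\<in>I. length vs \<le> k \<and> smooth_on (\<phi> ` U) (a vs :: 'e \<Rightarrow> complex)) \<and>
     (\<forall>u. smooth_fun A u \<longrightarrow> (\<forall>y\<in>\<phi> ` U.
        D u (inv_into U \<phi> y) = (\<Sum>vs\<in>I. a vs y * dir_derivs vs (u \<circ> inv_into U \<phi>) y))))"

definition bidifferential_operator ::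
  "('m, 'e::real_normed_vector) chart set \<Rightarrow> ('m cfun \<Rightarrow> 'm cfun \<Rightarrow> 'm cfun) \<Rightarrow> bool" where
  "bidifferential_operator A B \<longleftrightarrow> (\<exists>k. \<forall>(U, \<phi>)\<in>A. \<exists>I a. finite I \<and>
     (\<forall>(vs, ws)\<in>I. length vs \<le> k \<and> length ws \<le> k \<and>
        smooth_on (\<phi> ` U) (a vs ws :: 'e \<Rightarrow> complex)) \<and>
     (\<forall>u v. smooth_fun A u \<longrightarrow> smooth_fun A v \<longrightarrow> (\<forall>y\<in>\<phi> ` U.
        B u v (inv_into U \<phi> y) =
          (\<Sum>(vs, ws)\<in>I. a vs ws y * dir_derivs vs (u \<circ> inv_into U \<phi>) y
                                  * dir_derivs ws (v \<circ> inv_into U \<phi>) y))))"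

text \<open>The formula $f * g = \sum_k (\lambda/2)^k C_k(f,g)$ is read for formal series $f, g$ by
  extending each $C_k$ coefficientwise.\<close>

definition star_product ::
  "('m, 'e::real_normed_vector) chart set \<Rightarrow>
   ('m \<Rightarrow> ('m cfun \<Rightarrow> complex) \<Rightarrow> ('m cfun \<Rightarrow> complex) \<Rightarrow> real) \<Rightarrow>
   ('m cfun fps \<Rightarrow> 'm cfun fps \<Rightarrow> 'm cfun fps) \<Rightarrow> bool" where
  "star_product A \<omega> star \<longleftrightarrow>
     (\<forall>u\<in>formal_funs A. \<forall>v\<in>formal_funs A. star u v \<in> formal_funs A) \<and>
     (\<forall>u\<in>formal_funs A. \<forall>v\<in>formal_funs A. \<forall>w\<in>formal_funs A.
        star (star u v) w = star u (star v w)) \<and>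
     (\<forall>u\<in>formal_funs A. \<forall>v\<in>formal_funs A. \<forall>w\<in>formal_funs A.
        star (u + v) w = star u w + star v w \<and> star w (u + v) = star w u + star w v) \<and>
     (\<forall>c. \<forall>u\<in>formal_funs A. \<forall>v\<in>formal_funs A.
        star (formal_scale c u) v = formal_scale c (star u v) \<and>
        star u (formal_scale c v) = formal_scale c (star u v)) \<and>
     (\<exists>C. (\<forall>k. bidifferential_operator A (C k)) \<and>
        (\<forall>u\<in>formal_funs A. \<forall>v\<in>formal_funs A. \<forall>n p.
           fps_nth (star u v) n p =
             (\<Sum>k\<le>n. \<Sum>i\<le>n - k. (1/2) ^ k * C k (fps_nth u i) (fps_nth v (n - k - i)) p)) \<and>
        (\<forall>f h. smooth_fun A f \<longrightarrow> smooth_fun A h \<longrightarrow>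
           C 0 f h = f * h \<and>
           (\<forall>p. C 1 f h p - C 1 h f p = 2 * poisson A \<omega> f h p)) \<and>
        (\<forall>k\<ge>1. \<forall>f. smooth_fun A f \<longrightarrow> C k 1 f = 0 \<and> C k f 1 = 0))"

definition invariant_star_product ::
  "'g monoid \<Rightarrow> ('m, 'e::real_normed_vector) chart set \<Rightarrow>
   ('m \<Rightarrow> ('m cfun \<Rightarrow> complex) \<Rightarrow> ('m cfun \<Rightarrow> complex) \<Rightarrow> real) \<Rightarrow> ('g \<Rightarrow> 'm \<Rightarrow> 'm) \<Rightarrow>
   ('m cfun fps \<Rightarrow> 'm cfun fps \<Rightarrow> 'm cfun fps) \<Rightarrow> bool" where
  "invariant_star_product G A \<omega> act star \<longleftrightarrow> star_product A \<omega> star \<and>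
     (\<forall>g. \<forall>u\<in>formal_funs A. \<forall>v\<in>formal_funs A.
        group_translate G act g (star u v) =
          star (group_translate G act g u) (group_translate G act g v))"

definition G_equivalence ::
  "'g monoid \<Rightarrow> ('m, 'e::real_normed_vector) chart set \<Rightarrow> ('g \<Rightarrow> 'm \<Rightarrow> 'm) \<Rightarrow>
   ('m cfun fps \<Rightarrow> 'm cfun fps \<Rightarrow> 'm cfun fps) \<Rightarrow> ('m cfun fps \<Rightarrow> 'm cfun fps \<Rightarrow> 'm cfun fps) \<Rightarrow>
   ('m cfun fps \<Rightarrow> 'm cfun fps) \<Rightarrow> bool" where
  "G_equivalence G A act star star' T \<longleftrightarrow>
     (\<exists>Ts. (\<forall>f. Ts 0 f = f) \<and>
        (\<forall>n\<ge>1. differential_operator A (Ts n) \<and> (\<forall>c. Ts n (\<lambda>_. c) = 0)) \<and>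
        (\<forall>u\<in>formal_funs A. \<forall>n p. fps_nth (T u) n p = (\<Sum>i\<le>n. Ts i (fps_nth u (n - i)) p))) \<and>
     (\<forall>g. \<forall>u\<in>formal_funs A. T (group_translate G act g u) = group_translate G act g (T u)) \<and>
     (\<forall>u\<in>formal_funs A. \<forall>v\<in>formal_funs A.
        star' u v = T (star (inv_into (formal_funs A) T u) (inv_into (formal_funs A) T v)))"

section \<open>The universal enveloping algebra\<close>

text \<open>Algebras over $\mathbb C[[\lambda]]$ are records of type \<open>(complex fps, 'a) module\<close>.
  The free algebra consists of the finitely supported functions on words over \<open>S\<close>, with
  concatenation of words extended bilinearly.\<close>

definition free_algebra :: "'x set \<Rightarrow> (complex fps, 'x list \<Rightarrow> complex fps) module" where
  "free_algebra S =
     \<lparr>carrier = {p. finite {w. p w \<noteq> 0} \<and> (\<forall>w. p w \<noteq> 0 \<longrightarrow> set w \<subseteq> S)},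
      mult = (\<lambda>p q w. \<Sum>i\<le>length w. p (take i w) * q (drop i w)),
      one = (\<lambda>w. if w = [] then 1 else 0),
      zero = (\<lambda>w. 0),
      add = (\<lambda>p q w. p w + q w),
      smult = (\<lambda>c p w. c * p w)\<rparr>"

definition gen :: "'x \<Rightarrow> 'x list \<Rightarrow> complex fps" where
  "gen x = (\<lambda>w. if w = [x] then 1 else 0)"

text \<open>$\mathfrak g_\lambda$: the series with coefficients in \<open>L\<close>, as a Lie algebra over
  $\mathbb R[[\lambda]]$ with bracket $[\xi,\eta]_\lambda = \lambda[\xi,\eta]$.\<close>

definition formal_lie :: "('g cfun \<Rightarrow> 'g cfun) set \<Rightarrow> ('g cfun \<Rightarrow> 'g cfun) fps set" where
  "formal_lie L = {\<xi>. \<forall>n. fps_nth \<xi> n \<in> L}"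

definition formal_lie_scale ::
  "real fps \<Rightarrow> ('g cfun \<Rightarrow> 'g cfun) fps \<Rightarrow> ('g cfun \<Rightarrow> 'g cfun) fps" where
  "formal_lie_scale r \<xi> = Abs_fps (\<lambda>n. \<Sum>i\<le>n. vf_scale (fps_nth r i) (fps_nth \<xi> (n - i)))"

definition formal_lie_bracket ::
  "('g cfun \<Rightarrow> 'g cfun) fps \<Rightarrow> ('g cfun \<Rightarrow> 'g cfun) fps \<Rightarrow> ('g cfun \<Rightarrow> 'g cfun) fps" where
  "formal_lie_bracket \<xi> \<eta> = Abs_fps (\<lambda>n. case n of 0 \<Rightarrow> 0
     | Suc m \<Rightarrow> \<Sum>i\<le>m. vf_bracket (fps_nth \<xi> i) (fps_nth \<eta> (m - i)))"

definition complexify :: "real fps \<Rightarrow> complex fps" where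
  "complexify r = Abs_fps (\<lambda>n. complex_of_real (fps_nth r n))"

text \<open>The ideal below imposes $\mathbb R[[\lambda]]$-linearity of the generators inside a free
  $\mathbb C[[\lambda]]$-algebra, so that the quotient is the enveloping algebra over
  $\mathbb C[[\lambda]]$ of $\mathfrak g_\lambda$ with scalars extended to $\mathbb C[[\lambda]]$.\<close>

definition uea_ideal ::
  "('g cfun \<Rightarrow> 'g cfun) set \<Rightarrow> (('g cfun \<Rightarrow> 'g cfun) fps list \<Rightarrow> complex fps) set" where
  "uea_ideal L = (let F = free_algebra (formal_lie L) in genideal F
     ({gen (\<xi> + \<eta>) - (gen \<xi> + gen \<eta>) | \<xi> \<eta>. \<xi> \<in> formal_lie L \<and> \<eta> \<in> formal_lie L} \<union>
      {gen (formal_lie_scale r \<xi>) - complexify r \<odot>\<^bsub>F\<^esub> gen \<xi> | r \<xi>. \<xi> \<in> formal_lie L} \<union>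
      {gen \<xi> \<otimes>\<^bsub>F\<^esub> gen \<eta> - gen \<eta> \<otimes>\<^bsub>F\<^esub> gen \<xi> - gen (formal_lie_bracket \<xi> \<eta>) | \<xi> \<eta>.
         \<xi> \<in> formal_lie L \<and> \<eta> \<in> formal_lie L}))"

definition uea ::
  "('g cfun \<Rightarrow> 'g cfun) set \<Rightarrow>
   (complex fps, (('g cfun \<Rightarrow> 'g cfun) fps list \<Rightarrow> complex fps) set) module" where
  "uea L = (let F = free_algebra (formal_lie L); I = uea_ideal L; Q = F Quot I in
     \<lparr>carrier = carrier Q, mult = mult Q, one = one Q, zero = zero Q, add = add Q,
      smult = (\<lambda>c P. \<Union>p\<in>P. I +>\<^bsub>F\<^esub> (c \<odot>\<^bsub>F\<^esub> p))\<rparr>)"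

definition uea_incl ::
  "('g cfun \<Rightarrow> 'g cfun) set \<Rightarrow> ('g cfun \<Rightarrow> 'g cfun) \<Rightarrow>
   (('g cfun \<Rightarrow> 'g cfun) fps list \<Rightarrow> complex fps) set" where
  "uea_incl L X = uea_ideal L +>\<^bsub>free_algebra (formal_lie L)\<^esub> gen (fps_const X)"

section \<open>Quantum moment maps\<close>

definition algebra_hom ::
  "(complex fps, 'a) module \<Rightarrow> (complex fps, 'b) module \<Rightarrow> ('a \<Rightarrow> 'b) set" where
  "algebra_hom A B = {h \<in> ring_hom A B. \<forall>c. \<forall>a\<in>carrier A. h (c \<odot>\<^bsub>A\<^esub> a) = c \<odot>\<^bsub>B\<^esub> h a}"

definition star_algebra ::
  "('m, 'e::real_normed_vector) chart set \<Rightarrow> ('m cfun fps \<Rightarrow> 'm cfun fps \<Rightarrow> 'm cfun fps) \<Rightarrow>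
   (complex fps, 'm cfun fps) module" where
  "star_algebra A star =
     \<lparr>carrier = formal_funs A, mult = star, one = 1, zero = 0, add = (+), smult = formal_scale\<rparr>"

definition quantum_moment_map ::
  "'g monoid \<Rightarrow> ('g, 'd::real_normed_vector) chart set \<Rightarrow> ('m, 'e::real_normed_vector) chart set \<Rightarrow>
   ('g \<Rightarrow> 'm \<Rightarrow> 'm) \<Rightarrow> ('m cfun fps \<Rightarrow> 'm cfun fps \<Rightarrow> 'm cfun fps) \<Rightarrow>
   ((('g cfun \<Rightarrow> 'g cfun) fps list \<Rightarrow> complex fps) set \<Rightarrow> 'm cfun fps) \<Rightarrow> bool" where
  "quantum_moment_map G AG AM act star \<Phi> \<longleftrightarrow>
     \<Phi> \<in> algebra_hom (uea (lie_algebra G AG)) (star_algebra AM star) \<and>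
     (\<forall>X\<in>lie_algebra G AG. \<forall>u\<in>formal_funs AM.
        (let x = \<Phi> (uea_incl (lie_algebra G AG) X) in
          star x u - star u x = formal_scale fps_X (formal_inf_action G act X u)))"

end

theory Submission
  imports Defs
begin

text \<open>The transported map \<open>T \<circ> \<Phi>\<close> is a quantum moment map of \<open>star'\<close>: \<open>T\<close> is an isomorphism of the star
  algebras over $\mathbb C[[\lambda]]$, and it commutes with the infinitesimal action because its coefficients are
  $G$-invariant differential operators, which may be interchanged with the derivative in the group
  parameter (symmetry of mixed derivatives). It remains to see that quantum moment maps are unique.
  Two of them satisfy
  $[\Phi X, \Phi Y] = \lambda\, X(\Phi Y) = [\Psi X, \Phi Y] = -\lambda\, Y(\Psi X) = [\Psi X, \Psi Y]$, so their
  difference vanishes on brackets; at each point of $M$ and each order in $\lambda$ its real and imaginary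
  parts are 1-cocycles, hence 0 as $H^1(\mathfrak g,\mathbb R) = 0$. Writing a series
  $\xi \in \mathfrak g[[\lambda]]$ as $\xi_0 + \lambda\xi'$ then gives agreement on all generators, order by
  order in $\lambda$.\<close>

section \<open>Smooth functions on finite-dimensional normed spaces\<close>

text \<open>Two obstacles shape the development. The model spaces are merely normed spaces with a
  finite spanning set, so bounded coordinates, the chain rule and the calculus of smooth maps are
  all derived from that set. Moreover, the relations that define \<open>uea\<close> are harmless
  only if sums, multiples and brackets of elements of the Lie algebra stay in it; this closure is
  read off from the existence of a quantum moment map, since otherwise the quotient is a single
  point and has no unital map to a nonzero algebra. The passage from equal commutators to equal
  values on brackets rests on the bracket of \<g>\<lambda> carrying a factor \<lambda>: both quantum
  moment maps send it to \<lambda> times their value on the ordinary bracket, and multiplication by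
  \<lambda> is injective on formal functions.\<close>

text \<open>The bound makes each coordinate of a Cauchy sequence Cauchy; the coordinatewise limits
  are the coordinates of a limit in the span.\<close>

lemma bounded_coefficients_imp_complete_span:
  fixes B :: "'a::real_normed_vector set"
  assumes fin: "finite B" and ind: "independent B"
    and K: "\<And>a b. b \<in> B \<Longrightarrow> \<bar>a b\<bar> \<le> K * norm (\<Sum>b\<in>B. a b *\<^sub>R b)"
  shows "complete (span B)"
proof (rule completeI)
  fix s :: "nat \<Rightarrow> 'a" assume s: "\<forall>n. s n \<in> span B" and C: "Cauchy s"
  define r where "r n = representation B (s n)" for n
  have sr: "s n = (\<Sum>b\<in>B. r n b *\<^sub>R b)" for n
    unfolding r_def using sum_representation_eq[OF ind _ fin subset_refl] s by metis
  have "convergent (\<lambda>n. r n b)" if b: "b \<in> B" for b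
  proof -
    have le: "\<bar>r m b - r n b\<bar> \<le> K * norm (s m - s n)" for m n
      using K[OF b, of "\<lambda>b. r m b - r n b"]
      by (simp add: sr[of m] sr[of n] sum_subtractf scaleR_diff_left)
    have "Cauchy (\<lambda>n. r n b)"
    proof (rule metric_CauchyI)
      fix e :: real assume e: "e > 0"
      \<comment> \<open>\<open>K\<close> carries no sign assumption;
        \<open>\<bar>K\<bar> + 1\<close> is positive and at least \<open>K\<close> in any
        case.\<close>
      have "e / (\<bar>K\<bar> + 1) > 0" using e by (simp add: add_nonneg_pos)
      from metric_CauchyD[OF C this] obtain M where
        M: "\<And>m n. m \<ge> M \<Longrightarrow> n \<ge> M \<Longrightarrow> dist (s m) (s n) < e / (\<bar>K\<bar> + 1)" by blast
      have "dist (r m b) (r n b) < e" if "m \<ge> M" "n \<ge> M" for m n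
      proof -
        have "dist (r m b) (r n b) \<le> K * norm (s m - s n)"
          using le by (simp add: dist_real_def)
        also have "\<dots> \<le> (\<bar>K\<bar> + 1) * norm (s m - s n)"
          by (intro mult_right_mono) auto
        also have "\<dots> < e" using M[OF that] by (simp add: dist_norm field_simps)
        finally show ?thesis .
      qed
      then show "\<exists>M. \<forall>m\<ge>M. \<forall>n\<ge>M. dist (r m b) (r n b) < e" by blast
    qed
    then show ?thesis by (rule Cauchy_convergent)
  qed
  then have "(\<lambda>n. r n b) \<longlonglongrightarrow> lim (\<lambda>n. r n b)" if "b \<in> B" for b
    using that convergent_LIMSEQ_iff by blast
  then have "(\<lambda>n. \<Sum>b\<in>B. r n b *\<^sub>R b) \<longlonglongrightarrow> (\<Sum>b\<in>B. lim (\<lambda>n. r n b) *\<^sub>R b)"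
    by (intro tendsto_sum tendsto_scaleR tendsto_const)
  then have "s \<longlonglongrightarrow> (\<Sum>b\<in>B. lim (\<lambda>n. r n b) *\<^sub>R b)" using sr by presburger
  moreover have "(\<Sum>b\<in>B. lim (\<lambda>n. r n b) *\<^sub>R b) \<in> span B"
    by (intro span_sum span_scale span_base)
  ultimately show "\<exists>l\<in>span B. s \<longlonglongrightarrow> l" by blast
qed

text \<open>Induction on the basis. The inductive bound makes the span of the old vectors complete,
  hence closed, so the new vector \<open>c\<close> has positive distance \<open>d\<close> from it.
  This distance bounds the coefficient of \<open>c\<close>, and the triangle inequality then bounds
  the others.\<close>

lemma coefficients_bounded:
  fixes B :: "'a::real_normed_vector set"
  assumes "finite B" "independent B"
  shows "\<exists>K\<ge>0. \<forall>a. \<forall>b\<in>B. \<bar>a b\<bar> \<le> K * norm (\<Sum>b\<in>B. a b *\<^sub>R b)"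
  using assms
proof (induction B rule: finite_induct)
  case empty
  show ?case by (intro exI[of _ 0]) auto
next
  case (insert c B)
  have ind: "independent B" and c: "c \<notin> span B"
    using insert.prems insert.hyps by (auto simp: independent_insert)
  obtain K where K0: "K \<ge> 0" and
    K: "\<And>a b. b \<in> B \<Longrightarrow> \<bar>a b\<bar> \<le> K * norm (\<Sum>b\<in>B. a b *\<^sub>R b)"
    using insert.IH[OF ind] by blast
  have cl: "closed (span B)"
    using bounded_coefficients_imp_complete_span[OF insert.hyps(1) ind K]
    by (rule complete_imp_closed)
  define d where "d = infdist c (span B)"
  have d: "d > 0"
    unfolding d_def using c cl by (intro infdist_pos_not_in_closed) (auto intro: span_zero)
  have td: "\<bar>t\<bar> \<le> norm (t *\<^sub>R c + x) / d" if x: "x \<in> span B" for t x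
  proof (cases "t = 0")
    case False
    \<comment> \<open>Division by \<open>t\<close> turns \<open>t *\<^sub>R c + x\<close> into the
      difference of \<open>c\<close> and a vector of \<open>span B\<close>, whose norm is at least
      \<open>d\<close>.\<close>
    have "d \<le> dist c (- (1/t) *\<^sub>R x)"
      unfolding d_def by (intro infdist_le span_scale x)
    also have "\<dots> = norm ((1/t) *\<^sub>R (t *\<^sub>R c + x))"
      using False by (simp add: dist_norm scaleR_add_right)
    also have "\<dots> = norm (t *\<^sub>R c + x) / \<bar>t\<bar>" by simp
    finally show ?thesis using d False by (simp add: field_simps)
  qed (use d in auto)
  \<comment> \<open>The first summand serves the coefficient of \<open>c\<close>. The second serves
    the others, because the part \<open>x\<close> in the old span has norm at most
    \<open>(1 + norm c / d) * N\<close>.\<close>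
  define K' where "K' = 1 / d + K * (1 + norm c / d)"
  have K'0: "K' \<ge> 0" "K' \<ge> 1/d" "K' \<ge> K * (1 + norm c / d)" unfolding K'_def using K0 d by auto
  have "\<bar>a b\<bar> \<le> K' * norm (\<Sum>b\<in>insert c B. a b *\<^sub>R b)" if b: "b \<in> insert c B" for a b
  proof -
    define x where "x = (\<Sum>b\<in>B. a b *\<^sub>R b)"
    define N where "N = norm (a c *\<^sub>R c + x)"
    have N: "norm (\<Sum>b\<in>insert c B. a b *\<^sub>R b) = N"
      unfolding N_def x_def using insert.hyps by simp
    have xs: "x \<in> span B" unfolding x_def by (intro span_sum span_scale span_base)
    have ac: "\<bar>a c\<bar> \<le> N / d" using td[OF xs] unfolding N_def .
    have N0: "N \<ge> 0" unfolding N_def by simp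
    show ?thesis
    proof (cases "b = c")
      case True
      have "N / d \<le> K' * N" using mult_right_mono[OF K'0(2) N0] by simp
      then show ?thesis using ac True N by simp
    next
      case False
      then have "\<bar>a b\<bar> \<le> K * norm x" using b K[of b a] unfolding x_def by blast
      also have "norm x \<le> norm (a c *\<^sub>R c + x) + norm (a c *\<^sub>R c)"
        using norm_triangle_ineq4[of "a c *\<^sub>R c + x" "a c *\<^sub>R c"] by simp
      also have "\<dots> \<le> N + N / d * norm c"
        using mult_right_mono[OF ac, of "norm c"] unfolding N_def by simp
      also have "K * (N + N / d * norm c) = K * (1 + norm c / d) * N" by (simp add: field_simps)
      also have "\<dots> \<le> K' * N" by (intro mult_right_mono K'0 N0)
      finally show ?thesis using N K0 by (simp add: mult_left_mono)
    qed
  qed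
  then show ?case using K'0 by blast
qed

text \<open>In a basis extracted from \<open>B\<close> the coordinates are bounded by a multiple of
  the norm, so the finitely many values of \<open>l\<close> on the basis bound
  \<open>l\<close>.\<close>

lemma linear_imp_bounded_linear_finite_span:
  fixes l :: "'a::real_normed_vector \<Rightarrow> 'b::real_normed_vector" and B :: "'a set"
  assumes fin: "finite B" and sp: "span B = UNIV" and l: "linear l"
  shows "bounded_linear l"
proof -
  obtain C where C: "C \<subseteq> B" "independent C" "span C = UNIV"
    using maximal_independent_subset[of B] sp span_mono span_span by (metis span_minimal subspace_span top.extremum_uniqueI)
  have finC: "finite C" using C fin finite_subset by blast
  obtain K where K: "\<And>a b. b \<in> C \<Longrightarrow> \<bar>a b\<bar> \<le> K * norm (\<Sum>b\<in>C. a b *\<^sub>R b)"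
    using coefficients_bounded[OF finC C(2)] by blast
  have rep: "(\<Sum>b\<in>C. representation C x b *\<^sub>R b) = x" for x
    using sum_representation_eq[OF C(2) _ finC subset_refl] C(3) by blast
  show ?thesis
  proof (rule bounded_linear_intro)
    fix x
    have "norm (l x) = norm (\<Sum>b\<in>C. representation C x b *\<^sub>R l b)"
      by (subst rep[of x, symmetric]) (simp add: linear_sum[OF l] linear_scale[OF l])
    also have "\<dots> \<le> (\<Sum>b\<in>C. \<bar>representation C x b\<bar> * norm (l b))"
      by (rule order_trans[OF norm_sum]) simp
    also have "\<dots> \<le> (\<Sum>b\<in>C. (K * norm x) * norm (l b))"
      by (intro sum_mono mult_right_mono) (use K[of _ "representation C x"] rep in auto)
    also have "\<dots> = norm x * (\<Sum>b\<in>C. K * norm (l b))"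
      by (simp add: sum_distrib_left mult_ac)
    finally show "norm (l x) \<le> norm x * (\<Sum>b\<in>C. K * norm (l b))" .
  qed (use l in \<open>auto simp: linear_add linear_scale\<close>)
qed

text \<open>This is the form in which finite dimension enters the chain rule: a derivative along a
  varying direction becomes a finite sum of derivatives along fixed vectors, with bounded linear
  coefficients.\<close>

lemma bounded_coordinates:
  fixes B :: "'a::real_normed_vector set"
  assumes fin: "finite B" and sp: "span B = UNIV"
  obtains C and k :: "'a \<Rightarrow> 'a \<Rightarrow> real"
  where "finite C" "\<And>b. bounded_linear (k b)" "\<And>x. x = (\<Sum>b\<in>C. k b x *\<^sub>R b)"
proof -
  obtain C where C: "C \<subseteq> B" "independent C" "span C = UNIV"
    using maximal_independent_subset[of B] sp span_mono span_span by (metis span_minimal subspace_span top.extremum_uniqueI)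
  have finC: "finite C" using C fin finite_subset by blast
  show ?thesis
  proof (rule that[of C "\<lambda>b x. representation C x b"])
    show "bounded_linear (\<lambda>x. representation C x b)" for b
      by (rule linear_imp_bounded_linear_finite_span[OF fin sp])
        (use C in \<open>auto intro!: linearI simp: representation_add representation_scale\<close>)
    show "x = (\<Sum>b\<in>C. representation C x b *\<^sub>R b)" for x
      using sum_representation_eq[OF C(2) _ finC subset_refl] C(3) by force
  qed (rule finC)
qed

text \<open>Supplies the spanning set for the model space of the product of group and
  manifold.\<close>

lemma finite_span_UNIV_Times:
  fixes B :: "'a::real_vector set" and C :: "'b::real_vector set"
  assumes "finite B" "span B = UNIV" "finite C" "span C = UNIV"
  shows "\<exists>D :: ('a \<times> 'b) set. finite D \<and> span D = UNIV"
proof -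
  let ?f = "\<lambda>x. (x, 0) :: 'a \<times> 'b" and ?g = "\<lambda>y. (0, y) :: 'a \<times> 'b"
  have f: "linear ?f" and g: "linear ?g" by (auto intro!: linearI)
  have "(x, y) \<in> span (?f ` B \<union> ?g ` C)" for x y
  proof -
    have "?f x \<in> span (?f ` B)" "?g y \<in> span (?g ` C)"
      using assms linear_span_image[OF f, of B] linear_span_image[OF g, of C] by auto
    then have "?f x + ?g y \<in> span (?f ` B \<union> ?g ` C)"
      by (meson Un_upper1 Un_upper2 span_add span_mono subsetD)
    then show ?thesis by simp
  qed
  then have "span (?f ` B \<union> ?g ` C) = UNIV" by auto
  then show ?thesis using assms by (meson finite_UnI finite_imageI)
qed

section \<open>Iterated directional derivatives and smoothness\<close>

lemma frechet_derivative_cong_open: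
  assumes "open S" "x \<in> S" "\<And>y. y \<in> S \<Longrightarrow> f y = g y"
  shows "frechet_derivative f (at x) = frechet_derivative g (at x)"
proof -
  have "(f has_derivative f') (at x) \<longleftrightarrow> (g has_derivative f') (at x)" for f'
    using assms has_derivative_transform_within_open[of f f' x UNIV S g]
      has_derivative_transform_within_open[of g f' x UNIV S f] by auto
  then show ?thesis unfolding frechet_derivative_def by simp
qed

lemma differentiable_cong_open:
  assumes "open S" "x \<in> S" "\<And>y. y \<in> S \<Longrightarrow> f y = g y"
  shows "f differentiable (at x) \<longleftrightarrow> g differentiable (at x)"
  unfolding differentiable_def
  using assms has_derivative_transform_within_open[of f _ x UNIV S g]
      has_derivative_transform_within_open[of g _ x UNIV S f] by auto

lemma dir_derivs_cong_open:
  assumes "open S" "x \<in> S" "\<And>y. y \<in> S \<Longrightarrow> f y = g y"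
  shows "dir_derivs vs f x = dir_derivs vs g x"
  using assms(2)
proof (induction vs arbitrary: x)
  case (Cons v vs)
  then have "frechet_derivative (dir_derivs vs f) (at x) = frechet_derivative (dir_derivs vs g) (at x)"
    by (intro frechet_derivative_cong_open[OF assms(1)])
  then show ?case by simp
qed (use assms in auto)

lemma dir_derivs_append: "dir_derivs (vs @ ws) f = dir_derivs vs (dir_derivs ws f)"
  by (induction vs) auto

text \<open>Smoothness of finite order makes induction possible: product and chain rule express a
  derivative through functions whose order is one less, whereas \<open>smooth_on\<close> has no
  parameter to induct on.\<close>

definition ksmooth_on ::
  "nat \<Rightarrow> 'e::real_normed_vector set \<Rightarrow> ('e \<Rightarrow> 'b::real_normed_vector) \<Rightarrow> bool" where
  "ksmooth_on k S f \<longleftrightarrow> (\<forall>vs. length vs \<le> k \<longrightarrow> (\<forall>x\<in>S. dir_derivs vs f differentiable (at x)))"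

lemma smooth_on_iff_ksmooth_on: "smooth_on S f \<longleftrightarrow> (\<forall>k. ksmooth_on k S f)"
  unfolding smooth_on_def ksmooth_on_def by blast

lemma ksmooth_on_0: "ksmooth_on 0 S f \<longleftrightarrow> (\<forall>x\<in>S. f differentiable (at x))"
  unfolding ksmooth_on_def by simp

text \<open>The last entry of the list is the direction differentiated first, so cutting a list at
  its end peels off the innermost derivative. This is the recursion behind the inductions on
  \<open>k\<close> below.\<close>

lemma ksmooth_on_Suc:
  "ksmooth_on (Suc k) S f \<longleftrightarrow> (\<forall>x\<in>S. f differentiable (at x)) \<and> (\<forall>v. ksmooth_on k S (dir_derivs [v] f))"
proof (intro iffI conjI allI)
  assume R: "(\<forall>x\<in>S. f differentiable (at x)) \<and> (\<forall>v. ksmooth_on k S (dir_derivs [v] f))"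
  show "ksmooth_on (Suc k) S f" unfolding ksmooth_on_def
  proof (intro allI impI)
    fix vs :: "'a list" assume "length vs \<le> Suc k"
    then show "\<forall>x\<in>S. dir_derivs vs f differentiable at x"
      using R by (cases vs rule: rev_cases) (auto simp: ksmooth_on_def dir_derivs_append simp del: dir_derivs.simps(2))
  qed
next
  assume L: "ksmooth_on (Suc k) S f"
  show "\<forall>x\<in>S. f differentiable (at x)" using L unfolding ksmooth_on_def by (metis dir_derivs.simps(1) le0 list.size(3))
  fix v
  show "ksmooth_on k S (dir_derivs [v] f)"
    using L unfolding ksmooth_on_def dir_derivs_append[symmetric] by simp
qed

lemma ksmooth_on_mono: "ksmooth_on k S f \<Longrightarrow> j \<le> k \<Longrightarrow> ksmooth_on j S f"
  unfolding ksmooth_on_def by simp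

lemma ksmooth_on_SucD: "ksmooth_on (Suc k) S f \<Longrightarrow> ksmooth_on k S f"
  by (erule ksmooth_on_mono) simp

lemma ksmooth_on_cong:
  assumes "open S" "\<And>x. x \<in> S \<Longrightarrow> f x = g x"
  shows "ksmooth_on k S f \<longleftrightarrow> ksmooth_on k S g"
  unfolding ksmooth_on_def
  by (intro all_cong ball_cong refl differentiable_cong_open[OF assms(1)] dir_derivs_cong_open[OF assms(1)] assms(2))

lemma smooth_on_cong:
  assumes "open S" "\<And>x. x \<in> S \<Longrightarrow> f x = g x"
  shows "smooth_on S f \<longleftrightarrow> smooth_on S g"
  unfolding smooth_on_iff_ksmooth_on using ksmooth_on_cong[OF assms] by simp

lemma smooth_on_Union: "(\<And>x. x \<in> S \<Longrightarrow> \<exists>T. x \<in> T \<and> smooth_on T f) \<Longrightarrow> smooth_on S f"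
  unfolding smooth_on_def by blast

lemma smooth_on_imp_differentiable: "smooth_on S f \<Longrightarrow> x \<in> S \<Longrightarrow> f differentiable (at x)"
  unfolding smooth_on_def by (metis dir_derivs.simps(1))

lemma smooth_on_dir_derivs: "smooth_on S f \<Longrightarrow> smooth_on S (dir_derivs vs f)"
  unfolding smooth_on_def dir_derivs_append[symmetric] by blast

lemma ksmooth_on_const: "ksmooth_on k S (\<lambda>x. c)"
proof (induction k arbitrary: c)
  case (Suc k)
  then show ?case by (simp add: ksmooth_on_Suc)
qed (simp add: ksmooth_on_0)

lemma ksmooth_on_bounded_linear:
  assumes l: "bounded_linear l" shows "ksmooth_on k S l"
proof -
  have "dir_derivs [v] l = (\<lambda>x. l v)" for v
    using frechet_derivative_at[OF bounded_linear_imp_has_derivative[OF l]] by force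
  then show ?thesis using bounded_linear_imp_differentiable[OF l]
    by (cases k) (simp_all add: ksmooth_on_0 ksmooth_on_Suc ksmooth_on_const del: dir_derivs.simps)
qed

lemma ksmooth_on_add:
  assumes "open S" "ksmooth_on k S f" "ksmooth_on k S g"
  shows "ksmooth_on k S (\<lambda>x. f x + g x)"
  using assms(2,3)
proof (induction k arbitrary: f g)
  case 0 then show ?case by (simp add: ksmooth_on_0)
next
  case (Suc k)
  have "dir_derivs [v] (\<lambda>x. f x + g x) x = dir_derivs [v] f x + dir_derivs [v] g x" if "x \<in> S" for v x
  proof -
    have "((\<lambda>x. f x + g x) has_derivative (\<lambda>h. frechet_derivative f (at x) h + frechet_derivative g (at x) h)) (at x)"
      using Suc.prems that by (intro has_derivative_add) (auto simp: ksmooth_on_Suc frechet_derivative_works[symmetric])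
    from fun_cong[OF frechet_derivative_at[OF this], of v] show ?thesis by simp
  qed
  then have "ksmooth_on k S (dir_derivs [v] (\<lambda>x. f x + g x))" for v
    using Suc.IH[of "dir_derivs [v] f" "dir_derivs [v] g"] Suc.prems
    by (subst ksmooth_on_cong[OF assms(1)]) (auto simp: ksmooth_on_Suc simp del: dir_derivs.simps)
  then show ?case using Suc.prems by (auto simp: ksmooth_on_Suc simp del: dir_derivs.simps)
qed

lemma ksmooth_on_sum:
  assumes "open S" "\<And>i. i \<in> I \<Longrightarrow> ksmooth_on k S (f i)"
  shows "ksmooth_on k S (\<lambda>x. \<Sum>i\<in>I. f i x)"
  using assms(2)
  by (induction I rule: infinite_finite_induct) (auto intro!: ksmooth_on_const ksmooth_on_add[OF assms(1)])

text \<open>By the product rule the derivative is a sum of two terms of the same bilinear shape,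
  with one factor differentiated; hence the induction lets both functions vary.\<close>

lemma ksmooth_on_bilinear:
  assumes "bounded_bilinear p" "open S" "ksmooth_on k S f" "ksmooth_on k S g"
  shows "ksmooth_on k S (\<lambda>x. p (f x) (g x))"
  using assms(3,4)
proof (induction k arbitrary: f g)
  case 0 then show ?case using bounded_bilinear.FDERIV[OF assms(1)] unfolding ksmooth_on_0 differentiable_def by blast
next
  case (Suc k)
  have d: "((\<lambda>x. p (f x) (g x)) has_derivative
     (\<lambda>h. p (f x) (frechet_derivative g (at x) h) + p (frechet_derivative f (at x) h) (g x))) (at x)" if "x \<in> S" for x
    using Suc.prems that
    by (intro bounded_bilinear.FDERIV[OF assms(1)]) (auto simp: ksmooth_on_Suc frechet_derivative_works[symmetric])
  have "ksmooth_on k S (dir_derivs [v] (\<lambda>x. p (f x) (g x)))" for v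
  proof -
    have "ksmooth_on k S (\<lambda>x. p (f x) (dir_derivs [v] g x) + p (dir_derivs [v] f x) (g x))"
      using Suc.prems Suc.prems[THEN ksmooth_on_SucD]
      by (intro ksmooth_on_add assms Suc.IH) (simp_all add: ksmooth_on_Suc del: dir_derivs.simps)
    moreover have "dir_derivs [v] (\<lambda>x. p (f x) (g x)) x = p (f x) (dir_derivs [v] g x) + p (dir_derivs [v] f x) (g x)"
      if "x \<in> S" for x
      using fun_cong[OF frechet_derivative_at[OF d[OF that]], of v] by simp
    ultimately show ?thesis by (subst ksmooth_on_cong[OF assms(2)]) auto
  qed
  then show ?case using d unfolding ksmooth_on_Suc differentiable_def by blast
qed

lemma ksmooth_on_bounded_linear_compose:
  assumes "bounded_linear l" "open S" "ksmooth_on k S h"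
  shows "ksmooth_on k S (\<lambda>x. l (h x))"
  using assms(3)
proof (induction k arbitrary: h)
  case 0 then show ?case unfolding ksmooth_on_0 differentiable_def
    using bounded_linear.has_derivative[OF assms(1)] by blast
next
  case (Suc k)
  have d: "((\<lambda>x. l (h x)) has_derivative (\<lambda>z. l (frechet_derivative h (at x) z))) (at x)" if "x \<in> S" for x
    using Suc.prems that
    by (intro bounded_linear.has_derivative[OF assms(1)]) (auto simp: ksmooth_on_Suc frechet_derivative_works[symmetric])
  have "ksmooth_on k S (dir_derivs [v] (\<lambda>x. l (h x)))" for v
  proof -
    have "dir_derivs [v] (\<lambda>x. l (h x)) x = l (dir_derivs [v] h x)" if "x \<in> S" for x
      using fun_cong[OF frechet_derivative_at[OF d[OF that]], of v] by simp
    then show ?thesis using Suc.prems Suc.IH[of "dir_derivs [v] h"]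
      by (subst ksmooth_on_cong[OF assms(2)]) (auto simp: ksmooth_on_Suc simp del: dir_derivs.simps)
  qed
  then show ?case using d unfolding ksmooth_on_Suc differentiable_def by blast
qed

text \<open>The derivative of \<open>g\<close> at \<open>f x\<close> is taken in the direction of
  the derivative of \<open>f\<close>, which varies with \<open>x\<close>, while
  \<open>dir_derivs\<close> knows only fixed directions. Expanding that direction in bounded
  coordinates gives a finite sum of products, and the induction hypothesis applies to the
  derivatives of \<open>g\<close> with \<open>f\<close> unchanged.\<close>

lemma ksmooth_on_compose:
  fixes f :: "'a::real_normed_vector \<Rightarrow> 'b::real_normed_vector" and g :: "'b \<Rightarrow> 'c::real_normed_vector"
    and B :: "'b set"
  assumes B: "finite B" "span B = UNIV"
    and "open S" "open T" "f ` S \<subseteq> T" "ksmooth_on k S f" "ksmooth_on k T g"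
  shows "ksmooth_on k S (\<lambda>x. g (f x))"
  using assms(5-)
proof (induction k arbitrary: g)
  case 0 then show ?case
    unfolding ksmooth_on_0 using differentiable_chain_at[of f _ g, unfolded comp_def] by blast
next
  case (Suc k)
  obtain C and c :: "'b \<Rightarrow> 'b \<Rightarrow> real" where C: "finite C" "\<And>b. bounded_linear (c b)" "\<And>x. x = (\<Sum>b\<in>C. c b x *\<^sub>R b)"
    using bounded_coordinates[OF B] by blast
  have d: "((\<lambda>x. g (f x)) has_derivative (\<lambda>h. frechet_derivative g (at (f x)) (frechet_derivative f (at x) h))) (at x)"
    if "x \<in> S" for x
    using Suc.prems that
    by (intro has_derivative_compose[of f _ x UNIV g]) (auto simp: ksmooth_on_Suc frechet_derivative_works[symmetric])
  have "ksmooth_on k S (dir_derivs [v] (\<lambda>x. g (f x)))" for v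
  proof -
    have *: "dir_derivs [v] (\<lambda>x. g (f x)) x = (\<Sum>b\<in>C. c b (dir_derivs [v] f x) *\<^sub>R dir_derivs [b] g (f x))"
      if x: "x \<in> S" for x
    proof -
      have lin: "linear (frechet_derivative g (at (f x)))"
        using Suc.prems x by (intro linear_frechet_derivative) (auto simp: ksmooth_on_Suc)
      have "dir_derivs [v] (\<lambda>x. g (f x)) x = frechet_derivative g (at (f x)) (dir_derivs [v] f x)"
        using fun_cong[OF frechet_derivative_at[OF d[OF x]], of v] by simp
      also have "\<dots> = frechet_derivative g (at (f x)) (\<Sum>b\<in>C. c b (dir_derivs [v] f x) *\<^sub>R b)"
        using C(3)[of "dir_derivs [v] f x"] by simp
      finally show ?thesis by (simp add: linear_sum[OF lin] linear_scale[OF lin])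
    qed
    have cd: "ksmooth_on k S (\<lambda>x. c b (dir_derivs [v] f x))" for b
      using Suc.prems by (intro ksmooth_on_bounded_linear_compose[OF C(2) assms(3)]) (auto simp: ksmooth_on_Suc simp del: dir_derivs.simps)
    have "ksmooth_on k S (\<lambda>x. \<Sum>b\<in>C. c b (dir_derivs [v] f x) *\<^sub>R dir_derivs [b] g (f x))"
      by (intro ksmooth_on_sum assms ksmooth_on_bilinear[OF bounded_bilinear_scaleR] Suc.IH cd)
        (use Suc.prems Suc.prems(2)[THEN ksmooth_on_SucD] in \<open>simp_all add: ksmooth_on_Suc del: dir_derivs.simps\<close>)
    then show ?thesis using * by (subst ksmooth_on_cong[OF assms(3)]) auto
  qed
  then show ?case using d unfolding ksmooth_on_Suc differentiable_def by blast
qed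

lemma ksmooth_on_Pair:
  assumes "open S" "ksmooth_on k S f" "ksmooth_on k S g"
  shows "ksmooth_on k S (\<lambda>x. (f x, g x))"
  using assms(2,3)
proof (induction k arbitrary: f g)
  case 0 then show ?case unfolding ksmooth_on_0 differentiable_def using has_derivative_Pair by blast
next
  case (Suc k)
  have d: "((\<lambda>x. (f x, g x)) has_derivative
     (\<lambda>h. (frechet_derivative f (at x) h, frechet_derivative g (at x) h))) (at x)" if "x \<in> S" for x
    using Suc.prems that
    by (intro has_derivative_Pair) (auto simp: ksmooth_on_Suc frechet_derivative_works[symmetric])
  have "ksmooth_on k S (dir_derivs [v] (\<lambda>x. (f x, g x)))" for v
  proof -
    have "dir_derivs [v] (\<lambda>x. (f x, g x)) x = (dir_derivs [v] f x, dir_derivs [v] g x)" if "x \<in> S" for x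
      using fun_cong[OF frechet_derivative_at[OF d[OF that]], of v] by simp
    then show ?thesis using Suc.prems Suc.IH[of "dir_derivs [v] f" "dir_derivs [v] g"]
      by (subst ksmooth_on_cong[OF assms(1)]) (auto simp: ksmooth_on_Suc simp del: dir_derivs.simps)
  qed
  then show ?case using d unfolding ksmooth_on_Suc differentiable_def by blast
qed

lemma smooth_on_const: "smooth_on S (\<lambda>x. c)"
  by (simp add: smooth_on_iff_ksmooth_on ksmooth_on_const)

lemma smooth_on_bounded_linear: "bounded_linear l \<Longrightarrow> smooth_on S l"
  by (simp add: smooth_on_iff_ksmooth_on ksmooth_on_bounded_linear)

lemma smooth_on_add:
  "open S \<Longrightarrow> smooth_on S f \<Longrightarrow> smooth_on S g \<Longrightarrow> smooth_on S (\<lambda>x. f x + g x)"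
  by (simp add: smooth_on_iff_ksmooth_on ksmooth_on_add)

lemma smooth_on_sum:
  "open S \<Longrightarrow> (\<And>i. i \<in> I \<Longrightarrow> smooth_on S (f i)) \<Longrightarrow> smooth_on S (\<lambda>x. \<Sum>i\<in>I. f i x)"
  by (simp add: smooth_on_iff_ksmooth_on ksmooth_on_sum)

lemma smooth_on_mult:
  fixes f g :: "'e::real_normed_vector \<Rightarrow> 'b::real_normed_algebra"
  shows "open S \<Longrightarrow> smooth_on S f \<Longrightarrow> smooth_on S g \<Longrightarrow> smooth_on S (\<lambda>x. f x * g x)"
  by (simp add: smooth_on_iff_ksmooth_on ksmooth_on_bilinear[OF bounded_bilinear_mult])

lemma smooth_on_Pair:
  "open S \<Longrightarrow> smooth_on S f \<Longrightarrow> smooth_on S g \<Longrightarrow> smooth_on S (\<lambda>x. (f x, g x))"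
  by (simp add: smooth_on_iff_ksmooth_on ksmooth_on_Pair)

lemma smooth_on_compose:
  fixes f :: "'a::real_normed_vector \<Rightarrow> 'b::real_normed_vector" and B :: "'b set"
  assumes "finite B" "span B = UNIV" "open S" "open T" "f ` S \<subseteq> T" "smooth_on S f" "smooth_on T g"
  shows "smooth_on S (\<lambda>x. g (f x))"
  using assms(6,7) by (auto simp: smooth_on_iff_ksmooth_on intro: ksmooth_on_compose[OF assms(1-5)])

lemma dir_derivs_add:
  assumes "open S" "smooth_on S f" "smooth_on S g" "x \<in> S"
  shows "dir_derivs vs (\<lambda>x. f x + g x) x = dir_derivs vs f x + dir_derivs vs g x"
  using assms(4)
proof (induction vs arbitrary: x)
  case (Cons v vs)
  have "frechet_derivative (dir_derivs vs (\<lambda>x. f x + g x)) (at x)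
      = frechet_derivative (\<lambda>x. dir_derivs vs f x + dir_derivs vs g x) (at x)"
    using Cons by (intro frechet_derivative_cong_open[OF assms(1)])
  also have "\<dots> = (\<lambda>h. frechet_derivative (dir_derivs vs f) (at x) h + frechet_derivative (dir_derivs vs g) (at x) h)"
    using assms Cons.prems
    by (intro frechet_derivative_at[symmetric] has_derivative_add)
      (auto simp: smooth_on_def frechet_derivative_works[symmetric])
  finally show ?case by simp
qed simp

lemma dir_derivs_mult_left:
  fixes f :: "'e::real_normed_vector \<Rightarrow> 'b::real_normed_algebra"
  assumes "open S" "smooth_on S f" "x \<in> S"
  shows "dir_derivs vs (\<lambda>x. c * f x) x = c * dir_derivs vs f x"
  using assms(3)
proof (induction vs arbitrary: x)
  case (Cons v vs)
  have "frechet_derivative (dir_derivs vs (\<lambda>x. c * f x)) (at x)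
      = frechet_derivative (\<lambda>x. c * dir_derivs vs f x) (at x)"
    using Cons by (intro frechet_derivative_cong_open[OF assms(1)])
  also have "\<dots> = (\<lambda>h. c * frechet_derivative (dir_derivs vs f) (at x) h)"
    using assms Cons.prems
    by (intro frechet_derivative_at[symmetric] has_derivative_mult_right)
      (auto simp: smooth_on_def frechet_derivative_works[symmetric])
  finally show ?case by simp
qed simp

text \<open>Both mixed derivatives are the limit of the second difference
  \<open>f (x + t v + t w) - f (x + t v) - f (x + t w) + f x\<close>, divided by $t^2$.\<close>

lemma second_difference_tendsto:
  fixes f :: "'e::real_normed_vector \<Rightarrow> 'b::real_normed_vector"
  assumes S: "open S" "x \<in> S" and f: "\<And>y. y \<in> S \<Longrightarrow> f differentiable (at y)"
    and D: "dir_derivs [v] f differentiable (at x)"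
  shows "((\<lambda>t. (f (x + t *\<^sub>R v + t *\<^sub>R w) - f (x + t *\<^sub>R v) - f (x + t *\<^sub>R w) + f x) /\<^sub>R t\<^sup>2)
    \<longlongrightarrow> dir_derivs [w, v] f x) (at_right 0)"
proof (rule tendstoI)
  fix e :: real assume e: "e > 0"
  define L where "L = frechet_derivative (dir_derivs [v] f) (at x)"
  have hL: "(dir_derivs [v] f has_derivative L) (at x)"
    unfolding L_def using D frechet_derivative_works by blast
  have linL: "linear L" using has_derivative_linear[OF hL] .
  define M where "M = 2 * norm v + norm w + 1"
  have M: "M > 0" unfolding M_def by (simp add: add_nonneg_pos)
  \<comment> \<open>Two first-order remainders of size at most \<open>e' * (t * M)\<close> will
    contribute, over an interval of length \<open>t\<close>; the factor 3 leaves two thirds of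
    \<open>e\<close> times the square of \<open>t\<close>, hence a strict inequality.\<close>
  define e' where "e' = e / (3 * M)"
  have e': "e' > 0" unfolding e'_def using e M by simp
  obtain d where d: "d > 0" and
    dL: "\<And>y. norm (y - x) < d \<Longrightarrow>
      norm (dir_derivs [v] f y - dir_derivs [v] f x - L (y - x)) \<le> e' * norm (y - x)"
    using has_derivative_at_alt[THEN iffD1, OF hL] e' by blast
  obtain r where r: "r > 0" "ball x r \<subseteq> S" using S open_contains_ball by blast
  \<comment> \<open>For \<open>t < q\<close> the whole parallelogram spanned by
    \<open>t *\<^sub>R v\<close> and \<open>t *\<^sub>R w\<close> at \<open>x\<close> lies in
    \<open>S\<close> and in the ball where the expansion \<open>dL\<close> holds.\<close>
  define q where "q = min d r / M"
  have q: "q > 0" unfolding q_def using d r M by simp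
  have "dist ((f (x + t *\<^sub>R v + t *\<^sub>R w) - f (x + t *\<^sub>R v) - f (x + t *\<^sub>R w) + f x) /\<^sub>R t\<^sup>2) (dir_derivs [w, v] f x) < e"
    if t: "0 < t" "t < q" for t
  proof -
    have small: "norm (s *\<^sub>R v + c *\<^sub>R w) \<le> t * M" "norm (s *\<^sub>R v + c *\<^sub>R w) < d" "norm (s *\<^sub>R v + c *\<^sub>R w) < r"
      if "0 \<le> s" "s \<le> t" "0 \<le> c" "c \<le> t" for s c
    proof -
      have "norm (s *\<^sub>R v + c *\<^sub>R w) \<le> s * norm v + c * norm w"
        using that by (intro norm_triangle_le) simp
      also have "\<dots> \<le> t * norm v + t * norm w"
        by (intro add_mono mult_right_mono that) auto
      also have "\<dots> \<le> t * M" unfolding M_def using t by (simp add: algebra_simps)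
      finally show a: "norm (s *\<^sub>R v + c *\<^sub>R w) \<le> t * M" .
      have "t * M < min d r" using t M unfolding q_def by (simp add: field_simps)
      with a show "norm (s *\<^sub>R v + c *\<^sub>R w) < d" "norm (s *\<^sub>R v + c *\<^sub>R w) < r" by auto
    qed
    \<comment> \<open>\<open>h s\<close> is the increment of \<open>f\<close> over
      \<open>t *\<^sub>R w\<close> at \<open>x + s *\<^sub>R v\<close>, minus its expected linear
      growth in \<open>s\<close>. Thus \<open>h t - h 0\<close> is the second difference minus its
      expected value, and the mean value inequality in \<open>s\<close> bounds it.\<close>
    define h where "h s = f (x + (s *\<^sub>R v + t *\<^sub>R w)) - f (x + (s *\<^sub>R v + 0 *\<^sub>R w)) - s *\<^sub>R t *\<^sub>R L w" for s
    have inS: "x + (s *\<^sub>R v + c *\<^sub>R w) \<in> S" if "0 \<le> s" "s \<le> t" "0 \<le> c" "c \<le> t" for s c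
      using small(3)[OF that] by (intro subsetD[OF r(2)]) (simp add: dist_commute[of x], simp add: dist_norm)
    have der: "((\<lambda>s. f (x + (s *\<^sub>R v + c *\<^sub>R w))) has_derivative
        (\<lambda>z. z *\<^sub>R dir_derivs [v] f (x + (s *\<^sub>R v + c *\<^sub>R w)))) (at s within {0..t})"
      if "0 \<le> s" "s \<le> t" "0 \<le> c" "c \<le> t" for s c
    proof -
      let ?y = "x + (s *\<^sub>R v + c *\<^sub>R w)"
      have fd: "(f has_derivative frechet_derivative f (at ?y)) (at ?y)"
        using f[OF inS[OF that]] frechet_derivative_works by blast
      have "((\<lambda>s. x + (s *\<^sub>R v + c *\<^sub>R w)) has_derivative (\<lambda>z. z *\<^sub>R v)) (at s within {0..t})"
        by (auto intro!: derivative_eq_intros)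
      from has_derivative_compose[OF this fd]
      show ?thesis using has_derivative_linear[OF fd] by (simp add: linear_scale)
    qed
    have dh: "(h has_derivative (\<lambda>z. z *\<^sub>R dir_derivs [v] f (x + (s *\<^sub>R v + t *\<^sub>R w))
        - z *\<^sub>R dir_derivs [v] f (x + (s *\<^sub>R v + 0 *\<^sub>R w)) - z *\<^sub>R t *\<^sub>R L w)) (at s within {0..t})"
      if "s \<in> {0..t}" for s
      unfolding h_def using that t
      by (intro has_derivative_diff der has_derivative_scaleR_left has_derivative_ident) auto
    have on: "onorm (\<lambda>z. z *\<^sub>R dir_derivs [v] f (x + (s *\<^sub>R v + t *\<^sub>R w))
        - z *\<^sub>R dir_derivs [v] f (x + (s *\<^sub>R v + 0 *\<^sub>R w)) - z *\<^sub>R t *\<^sub>R L w) \<le> 2 * (e' * (t * M))"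
      if s: "s \<in> {0..t}" for s
    proof (rule onorm_le)
      fix z :: real
      \<comment> \<open>The remainder of the first-order expansion of
        \<open>dir_derivs [v] f\<close> at \<open>x\<close>. The derivative of \<open>h\<close> is
        the difference of two such remainders, for \<open>c = t\<close> and \<open>c = 0\<close>,
        since the subtracted term is exactly \<open>L (t *\<^sub>R w)\<close>.\<close>
      let ?P = "\<lambda>c. dir_derivs [v] f (x + (s *\<^sub>R v + c *\<^sub>R w)) - dir_derivs [v] f x - L (s *\<^sub>R v + c *\<^sub>R w)"
      have P: "norm (?P c) \<le> e' * (t * M)" if "0 \<le> c" "c \<le> t" for c
      proof -
        have "norm (?P c) \<le> e' * norm (s *\<^sub>R v + c *\<^sub>R w)"
          using dL[of "x + (s *\<^sub>R v + c *\<^sub>R w)"] small(2)[of s c] s that by simp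
        also have "\<dots> \<le> e' * (t * M)"
          using small(1)[of s c] s that e' by (intro mult_left_mono) auto
        finally show ?thesis .
      qed
      have "norm (z *\<^sub>R dir_derivs [v] f (x + (s *\<^sub>R v + t *\<^sub>R w))
        - z *\<^sub>R dir_derivs [v] f (x + (s *\<^sub>R v + 0 *\<^sub>R w)) - z *\<^sub>R t *\<^sub>R L w) = norm (z *\<^sub>R (?P t - ?P 0))"
        by (simp add: linear_add[OF linL] linear_scale[OF linL] algebra_simps del: dir_derivs.simps)
      also have "\<dots> = \<bar>z\<bar> * norm (?P t - ?P 0)" by simp
      also have "\<dots> \<le> \<bar>z\<bar> * (e' * (t * M) + e' * (t * M))"
        using t by (intro mult_left_mono norm_triangle_le_diff add_mono P) auto
      finally show "norm (z *\<^sub>R dir_derivs [v] f (x + (s *\<^sub>R v + t *\<^sub>R w))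
        - z *\<^sub>R dir_derivs [v] f (x + (s *\<^sub>R v + 0 *\<^sub>R w)) - z *\<^sub>R t *\<^sub>R L w) \<le> 2 * (e' * (t * M)) * norm z"
        by (simp add: mult_ac)
    qed
    have "norm (h t - h 0) \<le> 2 * (e' * (t * M)) * norm (t - 0)"
      by (rule differentiable_bound[OF convex_real_interval(5) dh on]) (use t in auto)
    also have "\<dots> = t\<^sup>2 * (2 * e' * M)" using t by (simp add: power2_eq_square mult_ac)
    also have "\<dots> < t\<^sup>2 * e" unfolding e'_def using t e M by (simp add: field_simps)
    finally have hh: "norm (h t - h 0) < t\<^sup>2 * e" .
    have "(f (x + t *\<^sub>R v + t *\<^sub>R w) - f (x + t *\<^sub>R v) - f (x + t *\<^sub>R w) + f x) /\<^sub>R t\<^sup>2 - dir_derivs [w, v] f x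
       = (h t - h 0) /\<^sub>R t\<^sup>2"
      unfolding h_def L_def using t by (simp add: algebra_simps power2_eq_square)
    then have eq: "dist ((f (x + t *\<^sub>R v + t *\<^sub>R w) - f (x + t *\<^sub>R v) - f (x + t *\<^sub>R w) + f x) /\<^sub>R t\<^sup>2) (dir_derivs [w, v] f x)
       = norm (h t - h 0) / t\<^sup>2"
      unfolding dist_norm by (simp add: divide_inverse mult.commute)
    have "norm (h t - h 0) / t\<^sup>2 < e" using hh t by (simp add: pos_divide_less_eq mult.commute)
    then show ?thesis by (simp only: eq)
  qed
  then show "\<forall>\<^sub>F t in at_right 0. dist ((f (x + t *\<^sub>R v + t *\<^sub>R w) - f (x + t *\<^sub>R v) - f (x + t *\<^sub>R w) + f x) /\<^sub>R t\<^sup>2)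
      (dir_derivs [w, v] f x) < e"
    unfolding eventually_at_right_field using q by auto
qed

text \<open>The second difference is symmetric in \<open>v\<close> and \<open>w\<close>, so the two
  mixed derivatives are limits of one and the same function.\<close>

lemma dir_derivs_swap:
  assumes "open S" "x \<in> S" "smooth_on S f"
  shows "dir_derivs [v, w] f x = dir_derivs [w, v] f x"
proof -
  have *: "((\<lambda>t. (f (x + t *\<^sub>R v + t *\<^sub>R w) - f (x + t *\<^sub>R v) - f (x + t *\<^sub>R w) + f x) /\<^sub>R t\<^sup>2)
    \<longlongrightarrow> dir_derivs [w, v] f x) (at_right 0)" for v w
    using assms(2,3)
    by (intro second_difference_tendsto[OF assms(1,2)])
      (auto intro: smooth_on_imp_differentiable smooth_on_dir_derivs simp del: dir_derivs.simps)
  show ?thesis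
    by (rule tendsto_unique[OF _ *[of w v]]) (use *[of v w] in \<open>auto simp: algebra_simps\<close>)
qed

text \<open>Successive swaps carry the innermost derivative past all the others. In the application
  it is the derivative in the group parameter, and the others belong to a differential operator on
  the manifold.\<close>

lemma dir_derivs_rotate:
  assumes "open S" "smooth_on S f" "x \<in> S"
  shows "dir_derivs (vs @ [a]) f x = dir_derivs (a # vs) f x"
  using assms(3)
proof (induction vs arbitrary: x)
  case (Cons v vs)
  have "dir_derivs ((v # vs) @ [a]) f x = dir_derivs [v] (dir_derivs (vs @ [a]) f) x" by simp
  also have "\<dots> = dir_derivs [v] (dir_derivs (a # vs) f) x"
    using Cons by (intro dir_derivs_cong_open[OF assms(1)])
  also have "\<dots> = dir_derivs [v, a] (dir_derivs vs f) x" by simp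
  also have "\<dots> = dir_derivs [a, v] (dir_derivs vs f) x"
    by (intro dir_derivs_swap[OF assms(1) Cons.prems] smooth_on_dir_derivs assms(2))
  finally show ?case by simp
qed simp

section \<open>Smooth maps and differential operators on manifolds\<close>

text \<open>Writing partial derivatives as derivatives along vectors with one zero component puts
  derivatives in both variables into a single list on the product, where they can be
  permuted.\<close>

lemma dir_derivs_slice_left:
  assumes S: "open S" and F: "smooth_on S F" and xy: "(x, y) \<in> S"
  shows "dir_derivs vs (\<lambda>x. F (x, y)) x = dir_derivs (map (\<lambda>v. (v, 0)) vs) F (x, y)"
  using xy
proof (induction vs arbitrary: x)
  case (Cons v vs)
  let ?G = "dir_derivs (map (\<lambda>v. (v, 0)) vs) F"
  have op: "open ((\<lambda>x. (x, y)) -` S)"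
    by (intro open_vimage S continuous_intros)
  have "frechet_derivative (dir_derivs vs (\<lambda>x. F (x, y))) (at x) = frechet_derivative (\<lambda>x. ?G (x, y)) (at x)"
    using Cons by (intro frechet_derivative_cong_open[OF op]) auto
  also have "\<dots> = (\<lambda>h. frechet_derivative ?G (at (x, y)) (h, 0))"
  proof (intro frechet_derivative_at[symmetric] has_derivative_compose[of "\<lambda>x. (x, y)" _ x UNIV ?G])
    show "((\<lambda>x. (x, y)) has_derivative (\<lambda>h. (h, 0))) (at x)"
      by (auto intro!: derivative_eq_intros)
    show "(?G has_derivative frechet_derivative ?G (at (x, y))) (at (x, y))"
      using F Cons.prems by (simp add: smooth_on_def frechet_derivative_works[symmetric])
  qed
  finally show ?case by simp
qed simp

lemma dir_derivs_slice_right: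
  assumes S: "open S" and F: "smooth_on S F" and xy: "(x, y) \<in> S"
  shows "dir_derivs vs (\<lambda>y. F (x, y)) y = dir_derivs (map (\<lambda>v. (0, v)) vs) F (x, y)"
  using xy
proof (induction vs arbitrary: y)
  case (Cons v vs)
  let ?G = "dir_derivs (map (\<lambda>v. (0, v)) vs) F"
  have op: "open ((\<lambda>y. (x, y)) -` S)"
    by (intro open_vimage S continuous_intros)
  have "frechet_derivative (dir_derivs vs (\<lambda>y. F (x, y))) (at y) = frechet_derivative (\<lambda>y. ?G (x, y)) (at y)"
    using Cons by (intro frechet_derivative_cong_open[OF op]) auto
  also have "\<dots> = (\<lambda>h. frechet_derivative ?G (at (x, y)) (0, h))"
  proof (intro frechet_derivative_at[symmetric] has_derivative_compose[of "\<lambda>y. (x, y)" _ y UNIV ?G])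
    show "((\<lambda>y. (x, y)) has_derivative (\<lambda>h. (0, h))) (at y)"
      by (auto intro!: derivative_eq_intros)
    show "(?G has_derivative frechet_derivative ?G (at (x, y))) (at (x, y))"
      using F Cons.prems by (simp add: smooth_on_def frechet_derivative_works[symmetric])
  qed
  finally show ?case by simp
qed simp

lemma smooth_on_slice_left:
  assumes "open S" "smooth_on S F" "\<And>x. x \<in> R \<Longrightarrow> (x, y) \<in> S"
  shows "smooth_on R (\<lambda>x. F (x, y))"
  unfolding smooth_on_def
proof (intro allI ballI)
  fix vs x assume x: "x \<in> R"
  let ?G = "dir_derivs (map (\<lambda>v. (v, 0)) vs) F"
  have op: "open ((\<lambda>x. (x, y)) -` S)"
    by (intro open_vimage assms continuous_intros)
  have "(\<lambda>x. ?G (x, y)) differentiable (at x)"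
    using assms(2) assms(3)[OF x]
    by (intro differentiable_compose[of ?G "\<lambda>x. (x, y)"]
        differentiableI[OF has_derivative_Pair[OF has_derivative_ident has_derivative_const]]) (auto simp: smooth_on_def)
  then show "dir_derivs vs (\<lambda>x. F (x, y)) differentiable (at x)"
    using assms(3)[OF x]
    by (subst differentiable_cong_open[OF op]) (auto simp: dir_derivs_slice_left[OF assms(1,2)])
qed

lemma smooth_on_slice_right:
  assumes "open S" "smooth_on S F" "\<And>y. y \<in> R \<Longrightarrow> (x, y) \<in> S"
  shows "smooth_on R (\<lambda>y. F (x, y))"
  unfolding smooth_on_def
proof (intro allI ballI)
  fix vs y assume y: "y \<in> R"
  let ?G = "dir_derivs (map (\<lambda>v. (0, v)) vs) F"
  have op: "open ((\<lambda>y. (x, y)) -` S)"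
    by (intro open_vimage assms continuous_intros)
  have "(\<lambda>y. ?G (x, y)) differentiable (at y)"
    using assms(2) assms(3)[OF y]
    by (intro differentiable_compose[of ?G "\<lambda>y. (x, y)"]
        differentiableI[OF has_derivative_Pair[OF has_derivative_const has_derivative_ident]]) (auto simp: smooth_on_def)
  then show "dir_derivs vs (\<lambda>y. F (x, y)) differentiable (at y)"
    using assms(3)[OF y]
    by (subst differentiable_cong_open[OF op]) (auto simp: dir_derivs_slice_right[OF assms(1,2)])
qed

section \<open>Charts, products of atlases and smooth maps\<close>

text \<open>The inverse chart is fixed to be \<open>inv_into\<close>, the one in which smoothness is
  expressed. Leaving out the transition maps makes the notion pass to product atlases by topology
  alone.\<close>

definition topological_atlas ::
  "('m::topological_space, 'e::real_normed_vector) chart set \<Rightarrow> bool" where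
  "topological_atlas A \<longleftrightarrow> (\<Union>(U, \<phi>)\<in>A. U) = UNIV \<and>
     (\<forall>(U, \<phi>)\<in>A. open U \<and> open (\<phi> ` U) \<and> homeomorphism U (\<phi> ` U) \<phi> (inv_into U \<phi>))"

text \<open>As \<open>f\<close> is injective on \<open>U\<close>, any inverse on the image agrees
  there with \<open>inv_into U f\<close>.\<close>

lemma homeomorphism_inv_into:
  assumes "homeomorphism U V f g"
  shows "homeomorphism U V f (inv_into U f)"
proof -
  have im: "V = f ` U" and gf: "\<And>x. x \<in> U \<Longrightarrow> g (f x) = x" using assms by (auto simp: homeomorphism_def)
  have inj: "inj_on f U" using gf by (rule inj_on_inverseI)
  have "inv_into U f y = g y" if "y \<in> V" for y
    using that inj gf im by auto
  then show ?thesis using assms by (metis (no_types, lifting) homeomorphism_cong)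
qed

lemma smooth_atlas_imp_topological_atlas:
  assumes "smooth_atlas A" shows "topological_atlas A"
proof -
  have "open U \<and> open (\<phi> ` U) \<and> homeomorphism U (\<phi> ` U) \<phi> (inv_into U \<phi>)" if "(U, \<phi>) \<in> A" for U \<phi>
  proof -
    have *: "\<forall>(U, \<phi>)\<in>A. open U \<and> open (\<phi> ` U) \<and> (\<exists>\<psi>. homeomorphism U (\<phi> ` U) \<phi> \<psi>)"
      using assms unfolding smooth_atlas_def by (elim conjE)
    from bspec[OF * that] show ?thesis using homeomorphism_inv_into[of U "\<phi> ` U" \<phi>] by force
  qed
  moreover have "(\<Union>(U, \<phi>)\<in>A. U) = UNIV" using assms unfolding smooth_atlas_def by (elim conjE)
  ultimately show ?thesis unfolding topological_atlas_def by blast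
qed

lemma topological_atlas_chartE:
  assumes "topological_atlas A"
  obtains U \<phi> where "(U, \<phi>) \<in> A" "p \<in> U"
proof -
  have "p \<in> (\<Union>(U, \<phi>)\<in>A. U)" using assms unfolding topological_atlas_def by simp
  with that show ?thesis by blast
qed

lemma topological_atlasD:
  assumes "topological_atlas A" "(U, \<phi>) \<in> A"
  shows "open U" "open (\<phi> ` U)" "homeomorphism U (\<phi> ` U) \<phi> (inv_into U \<phi>)" "inj_on \<phi> U"
    "continuous_on U \<phi>" "continuous_on (\<phi> ` U) (inv_into U \<phi>)"
proof -
  show h: "homeomorphism U (\<phi> ` U) \<phi> (inv_into U \<phi>)" and "open U" "open (\<phi> ` U)"
    using assms unfolding topological_atlas_def by blast+
  then show "continuous_on U \<phi>" "continuous_on (\<phi> ` U) (inv_into U \<phi>)"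
    by (auto simp: homeomorphism_def)
  show "inj_on \<phi> U" using h by (metis homeomorphism_apply1 inj_on_inverseI)
qed

lemma open_chart_image:
  assumes "topological_atlas A" "(U, \<phi>) \<in> A" "open W"
  shows "open (\<phi> ` (U \<inter> W))"
proof -
  have "\<phi> ` (U \<inter> W) = \<phi> ` U \<inter> inv_into U \<phi> -` W"
    using topological_atlasD(4)[OF assms(1,2)] by (auto simp: inv_into_f_f)
  then show ?thesis
    using continuous_open_preimage[OF topological_atlasD(6,2)[OF assms(1,2)] assms(3)] by simp
qed

lemma inv_into_map_prod:
  assumes "inj_on \<phi> U" "inj_on \<psi> V" "x \<in> \<phi> ` U" "y \<in> \<psi> ` V"
  shows "inv_into (U \<times> V) (map_prod \<phi> \<psi>) (x, y) = (inv_into U \<phi> x, inv_into V \<psi> y)"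
proof (rule inv_into_f_eq)
  show "inj_on (map_prod \<phi> \<psi>) (U \<times> V)" using assms(1,2) by (rule map_prod_inj_on)
qed (use assms(3,4) in \<open>simp_all only: mem_Times_iff fst_conv snd_conv map_prod_simp inv_into_into f_inv_into_f\<close>)

lemma topological_atlas_prod:
  assumes A: "topological_atlas A" and B: "topological_atlas B"
  shows "topological_atlas (prod_atlas A B)"
  unfolding topological_atlas_def
proof (intro conjI)
  have "z \<in> (\<Union>(W, \<theta>)\<in>prod_atlas A B. W)" for z
  proof -
    obtain U \<phi> V \<psi> where "(U, \<phi>) \<in> A" "fst z \<in> U" "(V, \<psi>) \<in> B" "snd z \<in> V"
      using topological_atlas_chartE[OF A] topological_atlas_chartE[OF B] by metis
    then show ?thesis
      by (intro UN_I[of "(U \<times> V, map_prod \<phi> \<psi>)"]) (auto simp: prod_atlas_def mem_Times_iff)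
  qed
  then show "(\<Union>(W, \<theta>)\<in>prod_atlas A B. W) = UNIV" by blast
  have "open (U \<times> V) \<and> open (map_prod \<phi> \<psi> ` (U \<times> V)) \<and>
      homeomorphism (U \<times> V) (map_prod \<phi> \<psi> ` (U \<times> V)) (map_prod \<phi> \<psi>) (inv_into (U \<times> V) (map_prod \<phi> \<psi>))"
    if U: "(U, \<phi>) \<in> A" and V: "(V, \<psi>) \<in> B" for U \<phi> V \<psi>
  proof (intro conjI)
    note Ud = topological_atlasD[OF A U] and Vd = topological_atlasD[OF B V]
    have im: "map_prod \<phi> \<psi> ` (U \<times> V) = (\<phi> ` U) \<times> (\<psi> ` V)" by auto
    show "open (U \<times> V)" "open (map_prod \<phi> \<psi> ` (U \<times> V))"
      unfolding im using Ud(1,2) Vd(1,2) by (auto intro: open_Times)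
    have "homeomorphism (U \<times> V) (map_prod \<phi> \<psi> ` (U \<times> V)) (map_prod \<phi> \<psi>)
       (map_prod (inv_into U \<phi>) (inv_into V \<psi>))"
      unfolding im
    proof (rule homeomorphismI)
      show "continuous_on (U \<times> V) (map_prod \<phi> \<psi>)"
        unfolding map_prod_def case_prod_unfold
        by (intro continuous_on_Pair continuous_on_compose2[OF Ud(5)] continuous_on_compose2[OF Vd(5)]
            continuous_intros) auto
      show "continuous_on (\<phi> ` U \<times> \<psi> ` V) (map_prod (inv_into U \<phi>) (inv_into V \<psi>))"
        unfolding map_prod_def case_prod_unfold
        by (intro continuous_on_Pair continuous_on_compose2[OF Ud(6)] continuous_on_compose2[OF Vd(6)]
            continuous_intros) auto
    qed (use Ud(4) Vd(4) in \<open>auto simp: inv_into_f_f\<close>)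
    then show "homeomorphism (U \<times> V) (map_prod \<phi> \<psi> ` (U \<times> V)) (map_prod \<phi> \<psi>)
       (inv_into (U \<times> V) (map_prod \<phi> \<psi>))"
      by (rule homeomorphism_inv_into)
  qed
  then show "\<forall>(U, \<phi>)\<in>prod_atlas A B. open U \<and> open (\<phi> ` U) \<and> homeomorphism U (\<phi> ` U) \<phi> (inv_into U \<phi>)"
    unfolding prod_atlas_def by blast
qed

lemma smooth_map_id:
  assumes "smooth_atlas A" shows "smooth_map A A (\<lambda>x. x)"
proof -
  have *: "\<forall>(U, \<phi>)\<in>A. \<forall>(V, \<psi>)\<in>A. smooth_on (\<phi> ` (U \<inter> V)) (\<psi> \<circ> inv_into U \<phi>)"
    using assms unfolding smooth_atlas_def by (elim conjE)
  have "smooth_on (\<phi> ` (U \<inter> (\<lambda>x. x) -` V)) (\<psi> \<circ> (\<lambda>x. x) \<circ> inv_into U \<phi>)"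
    if "(U, \<phi>) \<in> A" "(V, \<psi>) \<in> A" for U \<phi> V \<psi>
    using bspec[OF bspec[OF * that(1), unfolded prod.case] that(2)] by (simp add: comp_def)
  then show ?thesis unfolding smooth_map_def by (intro conjI continuous_on_id) blast
qed

text \<open>Meant for the map that inverts the group component and keeps the point: composed with
  the action it gives translation by the inverse, as in the definition of
  \<open>group_translate\<close>.\<close>

lemma smooth_map_map_prod:
  fixes A :: "('m::topological_space, 'e::real_normed_vector) chart set"
    and B :: "('n::topological_space, 'd::real_normed_vector) chart set"
  assumes A: "topological_atlas A" "finite EA" "span EA = (UNIV::'e set)"
    and B: "topological_atlas B" "finite EB" "span EB = (UNIV::'d set)"
    and A': "topological_atlas A'" and B': "topological_atlas B'"
    and f: "smooth_map A A' f" and g: "smooth_map B B' g"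
  shows "smooth_map (prod_atlas A B) (prod_atlas A' B') (map_prod f g)"
  unfolding smooth_map_def
proof
  have cf: "continuous_on UNIV f" and cg: "continuous_on UNIV g"
    using f g by (auto simp: smooth_map_def)
  show "continuous_on UNIV (map_prod f g)"
    unfolding map_prod_def case_prod_unfold
    by (intro continuous_on_Pair continuous_on_compose2[OF cf] continuous_on_compose2[OF cg] continuous_intros) auto
  have "smooth_on (map_prod \<phi> \<psi> ` (U \<times> V \<inter> map_prod f g -` (U' \<times> V')))
     (map_prod \<phi>' \<psi>' \<circ> map_prod f g \<circ> inv_into (U \<times> V) (map_prod \<phi> \<psi>))"
    if U: "(U, \<phi>) \<in> A" and V: "(V, \<psi>) \<in> B" and U': "(U', \<phi>') \<in> A'" and V': "(V', \<psi>') \<in> B'"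
    for U \<phi> V \<psi> U' \<phi>' V' \<psi>'
  proof -
    let ?P = "\<phi> ` (U \<inter> f -` U')" and ?Q = "\<psi> ` (V \<inter> g -` V')"
    have im: "map_prod \<phi> \<psi> ` (U \<times> V \<inter> map_prod f g -` (U' \<times> V')) = ?P \<times> ?Q"
      by (auto simp: image_iff)
    let ?f = "\<phi>' \<circ> f \<circ> inv_into U \<phi>" and ?g = "\<psi>' \<circ> g \<circ> inv_into V \<psi>"
    have F: "smooth_on ?P ?f" and G: "smooth_on ?Q ?g"
      using f g U V U' V' unfolding smooth_map_def by blast+
    have op: "open ?P" "open ?Q"
      using open_chart_image[OF A(1) U] open_chart_image[OF B(1) V] open_vimage[OF _ cf] open_vimage[OF _ cg]
        topological_atlasD(1)[OF A'(1) U'] topological_atlasD(1)[OF B'(1) V'] by blast+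
    have "smooth_on (?P \<times> ?Q) (\<lambda>z. (?f (fst z), ?g (snd z)))"
      by (intro smooth_on_Pair open_Times op smooth_on_compose[OF A(2,3) _ op(1) _ _ F]
          smooth_on_compose[OF B(2,3) _ op(2) _ _ G] smooth_on_bounded_linear
          bounded_linear_fst bounded_linear_snd) auto
    moreover have "(?f (fst z), ?g (snd z)) =
        (map_prod \<phi>' \<psi>' \<circ> map_prod f g \<circ> inv_into (U \<times> V) (map_prod \<phi> \<psi>)) z" if "z \<in> ?P \<times> ?Q" for z
      using that inv_into_map_prod[OF topological_atlasD(4)[OF A(1) U] topological_atlasD(4)[OF B(1) V], of "fst z" "snd z"]
      by (cases z) auto
    ultimately show ?thesis unfolding im
      by (subst smooth_on_cong[OF open_Times[OF op], symmetric]) auto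
  qed
  then show "\<forall>(U, \<phi>)\<in>prod_atlas A B. \<forall>(V, \<psi>)\<in>prod_atlas A' B'.
     smooth_on (\<phi> ` (U \<inter> map_prod f g -` V)) (\<psi> \<circ> map_prod f g \<circ> inv_into U \<phi>)"
    unfolding prod_atlas_def by blast
qed

text \<open>Smoothness may be checked near each point, and near a point \<open>f\<close> takes
  values in a single chart of \<open>B\<close>. There the composite is a composite of two coordinate
  expressions, so the chain rule on the model spaces applies.\<close>

lemma smooth_fun_compose_smooth_map:
  fixes B :: "('n::topological_space, 'd::real_normed_vector) chart set"
  assumes A: "topological_atlas A"
    and B: "topological_atlas B" "finite EB" "span EB = (UNIV::'d set)"
    and f: "smooth_map A B f" and u: "smooth_fun B u"
  shows "smooth_fun A (\<lambda>x. u (f x))"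
  unfolding smooth_fun_def
proof (intro ballI, clarify)
  fix U \<phi> assume U: "(U, \<phi>) \<in> A"
  note Ud = topological_atlasD[OF A U]
  show "smooth_on (\<phi> ` U) ((\<lambda>x. u (f x)) \<circ> inv_into U \<phi>)"
  proof (rule smooth_on_Union)
    fix x assume x: "x \<in> \<phi> ` U"
    obtain V \<psi> where V: "(V, \<psi>) \<in> B" "f (inv_into U \<phi> x) \<in> V" using topological_atlas_chartE[OF B(1)] by blast
    note Vd = topological_atlasD[OF B(1) V(1)]
    let ?W = "\<phi> ` (U \<inter> f -` V)"
    have fV: "open (f -` V)" using f Vd(1) by (auto simp: smooth_map_def intro: open_vimage)
    have xW: "x \<in> ?W" using x V(2) Ud(4) by (auto simp: inv_into_f_f)
    have op: "open ?W" by (rule open_chart_image[OF A U fV])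
    have "smooth_on ?W (\<lambda>x. (u \<circ> inv_into V \<psi>) ((\<psi> \<circ> f \<circ> inv_into U \<phi>) x))"
    proof (rule smooth_on_compose[OF B(2,3) op Vd(2)])
      show "smooth_on ?W (\<psi> \<circ> f \<circ> inv_into U \<phi>)" using f U V(1) unfolding smooth_map_def by blast
      show "smooth_on (\<psi> ` V) (u \<circ> inv_into V \<psi>)" using u V(1) unfolding smooth_fun_def by blast
      show "(\<psi> \<circ> f \<circ> inv_into U \<phi>) ` ?W \<subseteq> \<psi> ` V" using Ud(4) by (auto simp: inv_into_f_f)
    qed
    then have "smooth_on ?W ((\<lambda>x. u (f x)) \<circ> inv_into U \<phi>)"
      by (subst smooth_on_cong[OF op]) (use Ud(4) Vd(4) in \<open>auto simp: inv_into_f_f\<close>)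
    with xW show "\<exists>T. x \<in> T \<and> smooth_on T ((\<lambda>x. u (f x)) \<circ> inv_into U \<phi>)"
      by (intro exI[of _ ?W] conjI)
  qed
qed

lemma smooth_on_prod_chart:
  assumes A: "topological_atlas A" and B: "topological_atlas B" and H: "smooth_fun (prod_atlas A B) H"
    and U: "(U, \<phi>) \<in> A" and V: "(V, \<psi>) \<in> B"
  shows "smooth_on (\<phi> ` U \<times> \<psi> ` V) (\<lambda>(x, y). H (inv_into U \<phi> x, inv_into V \<psi> y))"
proof -
  note Ud = topological_atlasD[OF A U] and Vd = topological_atlasD[OF B V]
  have "(U \<times> V, map_prod \<phi> \<psi>) \<in> prod_atlas A B" using U V by (auto simp: prod_atlas_def)
  then have "smooth_on (map_prod \<phi> \<psi> ` (U \<times> V)) (H \<circ> inv_into (U \<times> V) (map_prod \<phi> \<psi>))"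
    using H unfolding smooth_fun_def by blast
  moreover have "map_prod \<phi> \<psi> ` (U \<times> V) = \<phi> ` U \<times> \<psi> ` V" by auto
  ultimately have "smooth_on (\<phi> ` U \<times> \<psi> ` V) (H \<circ> inv_into (U \<times> V) (map_prod \<phi> \<psi>))" by simp
  then show ?thesis
    by (subst smooth_on_cong[OF open_Times[OF Ud(2) Vd(2)]])
       (auto simp: inv_into_map_prod[OF Ud(4) Vd(4)])
qed

lemma smooth_fun_slice_left:
  assumes A: "topological_atlas A" and B: "topological_atlas B" and H: "smooth_fun (prod_atlas A B) H"
  shows "smooth_fun A (\<lambda>g. H (g, p))"
  unfolding smooth_fun_def
proof (intro ballI, clarify)
  fix U \<phi> assume U: "(U, \<phi>) \<in> A"
  obtain V \<psi> where V: "(V, \<psi>) \<in> B" "p \<in> V" using topological_atlas_chartE[OF B] by blast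
  note Ud = topological_atlasD[OF A U] and Vd = topological_atlasD[OF B V(1)]
  show "smooth_on (\<phi> ` U) ((\<lambda>g. H (g, p)) \<circ> inv_into U \<phi>)"
    using smooth_on_slice_left[OF open_Times[OF Ud(2) Vd(2)] smooth_on_prod_chart[OF assms U V(1)], of "\<phi> ` U" "\<psi> p"]
      V(2) Vd(4) by (simp add: comp_def)
qed

lemma smooth_fun_slice_right:
  assumes A: "topological_atlas A" and B: "topological_atlas B" and H: "smooth_fun (prod_atlas A B) H"
  shows "smooth_fun B (\<lambda>p. H (g, p))"
  unfolding smooth_fun_def
proof (intro ballI, clarify)
  fix V \<psi> assume V: "(V, \<psi>) \<in> B"
  obtain U \<phi> where U: "(U, \<phi>) \<in> A" "g \<in> U" using topological_atlas_chartE[OF A] by blast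
  note Ud = topological_atlasD[OF A U(1)] and Vd = topological_atlasD[OF B V]
  show "smooth_on (\<psi> ` V) ((\<lambda>p. H (g, p)) \<circ> inv_into V \<psi>)"
    using smooth_on_slice_right[OF open_Times[OF Ud(2) Vd(2)] smooth_on_prod_chart[OF assms U(1) V], of "\<psi> ` V" "\<phi> g"]
      U(2) Ud(4) by (simp add: comp_def)
qed

section \<open>Differential operators and parameter derivatives\<close>

lemma differential_operatorE:
  fixes A :: "('m, 'e::real_normed_vector) chart set"
  assumes D: "differential_operator A D" and U: "(U, \<phi>) \<in> A"
  obtains I and a :: "'e list \<Rightarrow> 'e \<Rightarrow> complex"
  where "finite I" "\<And>vs. vs \<in> I \<Longrightarrow> smooth_on (\<phi> ` U) (a vs)"
    "\<And>u y. smooth_fun A u \<Longrightarrow> y \<in> \<phi> ` U \<Longrightarrow>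
      D u (inv_into U \<phi> y) = (\<Sum>vs\<in>I. a vs y * dir_derivs vs (u \<circ> inv_into U \<phi>) y)"
proof -
  obtain k where k: "\<forall>(U, \<phi>)\<in>A. \<exists>I a. finite I \<and>
     (\<forall>vs\<in>I. length vs \<le> k \<and> smooth_on (\<phi> ` U) (a vs :: 'e \<Rightarrow> complex)) \<and>
     (\<forall>u. smooth_fun A u \<longrightarrow> (\<forall>y\<in>\<phi> ` U.
        D u (inv_into U \<phi> y) = (\<Sum>vs\<in>I. a vs y * dir_derivs vs (u \<circ> inv_into U \<phi>) y)))"
    using D unfolding differential_operator_def by (elim exE)
  obtain I a where "finite I"
    "\<forall>vs\<in>I. length vs \<le> k \<and> smooth_on (\<phi> ` U) (a vs :: 'e \<Rightarrow> complex)"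
    "\<forall>u. smooth_fun A u \<longrightarrow> (\<forall>y\<in>\<phi> ` U.
        D u (inv_into U \<phi> y) = (\<Sum>vs\<in>I. a vs y * dir_derivs vs (u \<circ> inv_into U \<phi>) y))"
    using bspec[OF k U] unfolding prod.case by (elim exE conjE)
  with that show ?thesis by blast
qed

lemma smooth_fun_differential_operator:
  fixes A :: "('m::topological_space, 'e::real_normed_vector) chart set"
  assumes A: "topological_atlas A" and D: "differential_operator A D" and u: "smooth_fun A u"
  shows "smooth_fun A (D u)"
  unfolding smooth_fun_def
proof (intro ballI, clarify)
  fix U \<phi> assume U: "(U, \<phi>) \<in> A"
  note Ud = topological_atlasD[OF A U]
  obtain I and a where "finite I" and a: "\<And>vs. vs \<in> I \<Longrightarrow> smooth_on (\<phi> ` U) (a vs :: 'e \<Rightarrow> complex)"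
    and Du: "\<And>u y. smooth_fun A u \<Longrightarrow> y \<in> \<phi> ` U \<Longrightarrow>
        D u (inv_into U \<phi> y) = (\<Sum>vs\<in>I. a vs y * dir_derivs vs (u \<circ> inv_into U \<phi>) y)"
    by (rule differential_operatorE[OF D U]) (rule that)
  have "smooth_on (\<phi> ` U) (\<lambda>y. \<Sum>vs\<in>I. a vs y * dir_derivs vs (u \<circ> inv_into U \<phi>) y)"
    using u U by (intro smooth_on_sum smooth_on_mult smooth_on_dir_derivs a Ud(2)) (auto simp: smooth_fun_def)
  then show "smooth_on (\<phi> ` U) (D u \<circ> inv_into U \<phi>)"
    by (subst smooth_on_cong[OF Ud(2)]) (auto simp: Du[OF u])
qed

text \<open>The interchange is the symmetry of mixed derivatives in a product chart.\<close>

lemma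
  fixes A :: "('g::topological_space, 'd::real_normed_vector) chart set"
    and B :: "('m::topological_space, 'e::real_normed_vector) chart set"
    and H :: "'g \<times> 'm \<Rightarrow> complex" and a :: 'd
  assumes A: "topological_atlas A" and B: "topological_atlas B" and H: "smooth_fun (prod_atlas A B) H"
    and U: "(U, \<phi>) \<in> A" "g \<in> U"
  defines "X \<equiv> \<lambda>h. frechet_derivative (h \<circ> inv_into U \<phi>) (at (\<phi> g)) a"
  shows smooth_fun_parameter_derivative: "smooth_fun B (\<lambda>p. X (\<lambda>g. H (g, p)))"
    and differential_operator_parameter_derivative: "differential_operator B D \<Longrightarrow>
      D (\<lambda>p. X (\<lambda>g. H (g, p))) p = X (\<lambda>g. D (\<lambda>p. H (g, p)) p)"
proof -
  note Ud = topological_atlasD[OF A U(1)]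
  define x0 where "x0 = \<phi> g"
  have x0: "x0 \<in> \<phi> ` U" using U by (simp add: x0_def)
  define F where "F V \<psi> = (\<lambda>(x, y). H (inv_into U \<phi> x, inv_into V \<psi> y))" for V and \<psi> :: "'m \<Rightarrow> 'e"
  have smF: "smooth_on (\<phi> ` U \<times> \<psi> ` V) (F V \<psi>)" and op: "open (\<phi> ` U \<times> \<psi> ` V)" if "(V, \<psi>) \<in> B" for V \<psi>
    unfolding F_def using smooth_on_prod_chart[OF A B H U(1) that] topological_atlasD(2)[OF B that] Ud(2)
    by (auto intro: open_Times)
  \<comment> \<open>Differentiating in the group variable alone is differentiating the product-chart
    expression along \<open>(a, 0)\<close>.\<close>
  have XF: "X (\<lambda>g. H (g, inv_into V \<psi> y)) = dir_derivs [(a, 0)] (F V \<psi>) (x0, y)"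
    if V: "(V, \<psi>) \<in> B" and y: "y \<in> \<psi> ` V" for V \<psi> y
    using dir_derivs_slice_left[OF op[OF V] smF[OF V], of x0 y "[a]"] x0 y
    by (simp add: X_def F_def comp_def x0_def)
  have smXF: "smooth_on (\<psi> ` V) (\<lambda>y. dir_derivs [(a, 0)] (F V \<psi>) (x0, y))" if V: "(V, \<psi>) \<in> B" for V \<psi>
    using x0 by (intro smooth_on_slice_right[OF op[OF V] smooth_on_dir_derivs[OF smF[OF V]]]) auto
  show sm: "smooth_fun B (\<lambda>p. X (\<lambda>g. H (g, p)))"
    unfolding smooth_fun_def
  proof (intro ballI, clarify)
    fix V \<psi> assume V: "(V, \<psi>) \<in> B"
    show "smooth_on (\<psi> ` V) ((\<lambda>p. X (\<lambda>g. H (g, p))) \<circ> inv_into V \<psi>)"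
      using smXF[OF V] by (subst smooth_on_cong[OF topological_atlasD(2)[OF B V]]) (auto simp: XF[OF V])
  qed
  assume D: "differential_operator B D"
  obtain V \<psi> where V: "(V, \<psi>) \<in> B" "p \<in> V" using topological_atlas_chartE[OF B] by blast
  note Vd = topological_atlasD[OF B V(1)]
  define y where "y = \<psi> p"
  have y: "y \<in> \<psi> ` V" "inv_into V \<psi> y = p" using V Vd(4) by (auto simp: y_def)
  obtain I and c where I: "finite I" and "\<And>vs. vs \<in> I \<Longrightarrow> smooth_on (\<psi> ` V) (c vs :: 'e \<Rightarrow> complex)"
    and Du: "\<And>u y. smooth_fun B u \<Longrightarrow> y \<in> \<psi> ` V \<Longrightarrow>
        D u (inv_into V \<psi> y) = (\<Sum>vs\<in>I. c vs y * dir_derivs vs (u \<circ> inv_into V \<psi>) y)"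
    by (rule differential_operatorE[OF D V(1)]) (rule that)
  let ?F = "F V \<psi>" and ?S = "\<phi> ` U \<times> \<psi> ` V"
  let ?r = "map (\<lambda>v::'e. (0::'d, v))"
  have "D (\<lambda>p. X (\<lambda>g. H (g, p))) p = (\<Sum>vs\<in>I. c vs y * dir_derivs vs ((\<lambda>p. X (\<lambda>g. H (g, p))) \<circ> inv_into V \<psi>) y)"
    using Du[OF sm y(1)] y(2) by simp
  also have "\<dots> = (\<Sum>vs\<in>I. c vs y * dir_derivs ((a, 0) # ?r vs) ?F (x0, y))"
  proof (intro sum.cong refl arg_cong2[of _ _ _ _ "(*)"])
    fix vs
    have "dir_derivs vs ((\<lambda>p. X (\<lambda>g. H (g, p))) \<circ> inv_into V \<psi>) y
        = dir_derivs vs (\<lambda>y. dir_derivs [(a, 0)] ?F (x0, y)) y"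
      by (rule dir_derivs_cong_open[OF Vd(2) y(1)]) (simp add: XF[OF V(1)] del: dir_derivs.simps)
    also have "\<dots> = dir_derivs (?r vs @ [(a, 0)]) ?F (x0, y)"
      unfolding dir_derivs_append using x0 y
      by (intro dir_derivs_slice_right[OF op[OF V(1)] smooth_on_dir_derivs[OF smF[OF V(1)]]]) auto
    \<comment> \<open>The group derivative, innermost so far, moves outside past the derivatives of
      \<open>D\<close>.\<close>
    also have "\<dots> = dir_derivs ((a, 0) # ?r vs) ?F (x0, y)"
      using x0 y by (intro dir_derivs_rotate[OF op[OF V(1)] smF[OF V(1)]]) auto
    finally show "dir_derivs vs ((\<lambda>p. X (\<lambda>g. H (g, p))) \<circ> inv_into V \<psi>) y = \<dots>" .
  qed
  also have "\<dots> = X (\<lambda>g. D (\<lambda>p. H (g, p)) p)"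
  proof -
    \<comment> \<open>With the point of the manifold fixed, the coefficients of \<open>D\<close> are
      constants in the group coordinate \<open>x\<close>, so a derivative in \<open>x\<close> meets
      only the derivatives of \<open>F\<close>.\<close>
    have DH: "D (\<lambda>p. H (inv_into U \<phi> x, p)) p = (\<Sum>vs\<in>I. c vs y * dir_derivs (?r vs) ?F (x, y))"
      if x: "x \<in> \<phi> ` U" for x
    proof -
      have "dir_derivs vs ((\<lambda>p. H (inv_into U \<phi> x, p)) \<circ> inv_into V \<psi>) y = dir_derivs (?r vs) ?F (x, y)" for vs
        using dir_derivs_slice_right[OF op[OF V(1)] smF[OF V(1)], of x y vs] x y
        by (simp add: F_def comp_def)
      then show ?thesis
        using Du[OF smooth_fun_slice_right[OF A B H] y(1), of "inv_into U \<phi> x"] y(2) by simp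
    qed
    have "frechet_derivative ((\<lambda>g. D (\<lambda>p. H (g, p)) p) \<circ> inv_into U \<phi>) (at x0)
       = frechet_derivative (\<lambda>x. \<Sum>vs\<in>I. c vs y * dir_derivs (?r vs) ?F (x, y)) (at x0)"
      by (rule frechet_derivative_cong_open[OF Ud(2) x0]) (simp add: DH)
    also have "\<dots> = (\<lambda>h. \<Sum>vs\<in>I. c vs y * frechet_derivative (dir_derivs (?r vs) ?F) (at (x0, y)) (h, 0))"
    proof (intro frechet_derivative_at[symmetric] has_derivative_sum has_derivative_mult_right)
      fix vs
      let ?G = "dir_derivs (?r vs) ?F"
      have "(x0, y) \<in> \<phi> ` U \<times> \<psi> ` V" using x0 y by simp
      then have "(?G has_derivative frechet_derivative ?G (at (x0, y))) (at (x0, y))"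
        using smF[OF V(1)] unfolding smooth_on_def by (simp only: frechet_derivative_works[symmetric])
      from has_derivative_compose[OF has_derivative_Pair[OF has_derivative_ident has_derivative_const] this]
      show "((\<lambda>x. ?G (x, y)) has_derivative (\<lambda>h. frechet_derivative ?G (at (x0, y)) (h, 0))) (at x0)" .
    qed
    finally show ?thesis unfolding X_def x0_def[symmetric] by simp
  qed
  finally show "D (\<lambda>p. X (\<lambda>g. H (g, p))) p = X (\<lambda>g. D (\<lambda>p. H (g, p)) p)" .
qed

section \<open>The infinitesimal action\<close>

text \<open>\<open>inf_action\<close> uses a field only at the identity. There it is a tangent
  vector, that is, a derivative in one chart along a fixed vector.\<close>

lemma lie_algebra_at_one:
  assumes "X \<in> lie_algebra G AG"
  obtains U \<phi> a where "(U, \<phi>) \<in> AG" "\<one>\<^bsub>G\<^esub> \<in> U"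
    "\<And>f. smooth_fun AG f \<Longrightarrow> X f \<one>\<^bsub>G\<^esub> = frechet_derivative (f \<circ> inv_into U \<phi>) (at (\<phi> \<one>\<^bsub>G\<^esub>)) a"
proof -
  have "at_point X \<one>\<^bsub>G\<^esub> \<in> tangent_space AG \<one>\<^bsub>G\<^esub>"
    using assms by (auto simp: lie_algebra_def vector_fields_def)
  then obtain U \<phi> a where "(U, \<phi>) \<in> AG" "\<one>\<^bsub>G\<^esub> \<in> U"
    and "at_point X \<one>\<^bsub>G\<^esub> = (\<lambda>f. if smooth_fun AG f
      then frechet_derivative (f \<circ> inv_into U \<phi>) (at (\<phi> \<one>\<^bsub>G\<^esub>)) a else 0)"
    unfolding tangent_space_def by blast
  with that show ?thesis by (metis at_point_def)
qed

definition smooth_action ::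
  "'g::{t2_space,second_countable_topology} monoid \<Rightarrow> ('g, 'd::real_normed_vector) chart set \<Rightarrow>
   ('m::{t2_space,second_countable_topology}, 'e::real_normed_vector) chart set \<Rightarrow> ('g \<Rightarrow> 'm \<Rightarrow> 'm) \<Rightarrow> bool" where
  "smooth_action G AG AM act \<longleftrightarrow> lie_group G AG \<and> smooth_atlas AM \<and>
     smooth_map (prod_atlas AG AM) AM (\<lambda>(g, p). act g p)"

text \<open>The function is \<open>u\<close> after the action after inversion in the group
  component. Smoothness jointly in group element and point is what interchanging derivatives
  requires.\<close>

lemma smooth_fun_translate:
  fixes AG :: "('g::{t2_space,second_countable_topology}, 'd::real_normed_vector) chart set"
    and AM :: "('m::{t2_space,second_countable_topology}, 'e::real_normed_vector) chart set"
  assumes "smooth_action G AG AM act" and u: "smooth_fun AM u"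
  shows "smooth_fun (prod_atlas AG AM) (\<lambda>(g, p). u (act (inv\<^bsub>G\<^esub> g) p))"
proof -
  have sG: "smooth_atlas AG" and sM: "smooth_atlas AM" and i: "smooth_map AG AG (\<lambda>x. inv\<^bsub>G\<^esub> x)"
    and act: "smooth_map (prod_atlas AG AM) AM (\<lambda>(g, p). act g p)"
    using assms by (auto simp: smooth_action_def lie_group_def)
  have "\<exists>E::'d set. finite E \<and> span E = UNIV" "\<exists>E::'e set. finite E \<and> span E = UNIV"
    using sG sM unfolding smooth_atlas_def by simp_all
  then obtain EG :: "'d set" and EM :: "'e set"
    where E: "finite EG" "span EG = UNIV" "finite EM" "span EM = UNIV" by (elim exE conjE)
  obtain EP :: "('d \<times> 'e) set" where EP: "finite EP" "span EP = UNIV"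
    using finite_span_UNIV_Times[OF E] by (elim exE conjE)
  note tG = smooth_atlas_imp_topological_atlas[OF sG] and tM = smooth_atlas_imp_topological_atlas[OF sM]
  note tP = topological_atlas_prod[OF tG tM]
  have "smooth_fun (prod_atlas AG AM) (\<lambda>z. u (case z of (g, p) \<Rightarrow> act g p))"
    by (rule smooth_fun_compose_smooth_map[OF tP tM E(3,4) act u])
  from smooth_fun_compose_smooth_map[OF tP tP EP smooth_map_map_prod[OF tG E(1,2) tM E(3,4) tG tM i smooth_map_id[OF sM]] this]
  show ?thesis by (simp add: case_prod_unfold)
qed

text \<open>With \<open>H (g, p)\<close> the translate of \<open>u\<close> by \<open>g\<close>,
  evaluated at \<open>p\<close>, invariance of \<open>D\<close> says that applying \<open>D\<close>
  in \<open>p\<close> replaces \<open>u\<close> by \<open>D u\<close>. The interchange of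
  \<open>D\<close> with the derivative in \<open>g\<close> at the identity then gives the
  claim.\<close>

lemma
  assumes GM: "smooth_action G AG AM act" and X: "X \<in> lie_algebra G AG" and u: "smooth_fun AM u"
  shows smooth_fun_inf_action: "smooth_fun AM (inf_action G act X u)"
    and differential_operator_inf_action:
      "differential_operator AM D \<Longrightarrow>
       (\<And>g. D (\<lambda>p. u (act (inv\<^bsub>G\<^esub> g) p)) = (\<lambda>p. D u (act (inv\<^bsub>G\<^esub> g) p))) \<Longrightarrow>
       D (inf_action G act X u) = inf_action G act X (D u)"
proof -
  have tG: "topological_atlas AG" and tM: "topological_atlas AM"
    using GM smooth_atlas_imp_topological_atlas by (auto simp: smooth_action_def lie_group_def)
  obtain U \<phi> a where U: "(U, \<phi>) \<in> AG" "\<one>\<^bsub>G\<^esub> \<in> U" and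
    Xf: "\<And>f. smooth_fun AG f \<Longrightarrow> X f \<one>\<^bsub>G\<^esub> = frechet_derivative (f \<circ> inv_into U \<phi>) (at (\<phi> \<one>\<^bsub>G\<^esub>)) a"
    using lie_algebra_at_one[OF X] by blast
  \<comment> \<open>\<open>Y\<close> agrees with \<open>X\<close> at the identity on smooth
    functions and has the shape that the interchange result expects.\<close>
  define Y where "Y = (\<lambda>h :: _ \<Rightarrow> complex. frechet_derivative (h \<circ> inv_into U \<phi>) (at (\<phi> \<one>\<^bsub>G\<^esub>)) a)"
  have Xu: "inf_action G act X v = (\<lambda>p. Y (\<lambda>g. v (act (inv\<^bsub>G\<^esub> g) p)))" if "smooth_fun AM v" for v
    unfolding inf_action_def Y_def
    using smooth_fun_slice_left[OF tG tM smooth_fun_translate[OF GM that]] by (subst Xf) auto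
  note H = smooth_fun_translate[OF GM u]
  show "smooth_fun AM (inf_action G act X u)"
    unfolding Xu[OF u] Y_def using smooth_fun_parameter_derivative[OF tG tM H U, of a] by simp
  assume D: "differential_operator AM D" and inv: "\<And>g. D (\<lambda>p. u (act (inv\<^bsub>G\<^esub> g) p)) = (\<lambda>p. D u (act (inv\<^bsub>G\<^esub> g) p))"
  have "D (inf_action G act X u) p = inf_action G act X (D u) p" for p
    using differential_operator_parameter_derivative[OF tG tM H U D, of a p]
    unfolding Xu[OF u] Xu[OF smooth_fun_differential_operator[OF tM D u]] Y_def by (simp add: inv)
  then show "D (inf_action G act X u) = inf_action G act X (D u)" by blast
qed

lemma sum_fun_at: "(\<Sum>i\<in>I. f i) x = (\<Sum>i\<in>I. f i x)"
  by (induction I rule: infinite_finite_induct) auto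

lemma smooth_funD:
  "smooth_fun A f \<Longrightarrow> (U, \<phi>) \<in> A \<Longrightarrow> smooth_on (\<phi> ` U) (\<lambda>y. f (inv_into U \<phi> y))"
  by (auto simp: smooth_fun_def comp_def)

lemma smooth_fun_add:
  assumes "topological_atlas A" "smooth_fun A f" "smooth_fun A g"
  shows "smooth_fun A (f + g)"
  unfolding smooth_fun_def
proof (intro ballI, clarify)
  fix U \<phi> assume U: "(U, \<phi>) \<in> A"
  have "smooth_on (\<phi> ` U) (\<lambda>y. f (inv_into U \<phi> y) + g (inv_into U \<phi> y))"
    using assms U by (intro smooth_on_add topological_atlasD[OF assms(1) U] smooth_funD)
  then show "smooth_on (\<phi> ` U) ((f + g) \<circ> inv_into U \<phi>)" by (simp add: comp_def)
qed

lemma smooth_fun_const: "smooth_fun A (\<lambda>_. c)"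
  by (auto simp: smooth_fun_def comp_def smooth_on_const)

lemma smooth_fun_mult_left:
  fixes f :: "'m::topological_space \<Rightarrow> complex"
  assumes "topological_atlas A" "smooth_fun A f"
  shows "smooth_fun A (\<lambda>x. c * f x)"
  unfolding smooth_fun_def
proof (intro ballI, clarify)
  fix U \<phi> assume U: "(U, \<phi>) \<in> A"
  have "smooth_on (\<phi> ` U) (\<lambda>y. c * f (inv_into U \<phi> y))"
    using assms U by (intro smooth_on_mult smooth_on_const topological_atlasD[OF assms(1) U] smooth_funD)
  then show "smooth_on (\<phi> ` U) ((\<lambda>x. c * f x) \<circ> inv_into U \<phi>)" by (simp add: comp_def)
qed

lemma smooth_fun_sum:
  assumes "topological_atlas A" "\<And>i. i \<in> I \<Longrightarrow> smooth_fun A (f i)"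
  shows "smooth_fun A (\<Sum>i\<in>I. f i)"
  using assms(2)
proof (induction I rule: infinite_finite_induct)
  case (insert i I)
  then show ?case by (simp add: smooth_fun_add[OF assms(1)] del: plus_fun_apply)
qed (simp_all add: smooth_fun_const zero_fun_def)

lemma smooth_fun_diff:
  fixes f g :: "'m::topological_space \<Rightarrow> complex"
  assumes "topological_atlas A" "smooth_fun A f" "smooth_fun A g"
  shows "smooth_fun A (f - g)"
proof -
  have "f - g = f + (\<lambda>x. (-1) * g x)" by (simp add: fun_eq_iff)
  then show ?thesis by (simp only: smooth_fun_add smooth_fun_mult_left assms)
qed

text \<open>\<open>differential_operator\<close> does not ask for linearity; on smooth functions it
  follows from the coordinate formula in a chart around each point.\<close>

lemma
  fixes A :: "('m::topological_space, 'e::real_normed_vector) chart set"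
  assumes A: "topological_atlas A" and D: "differential_operator A D" and u: "smooth_fun A u"
  shows differential_operator_add: "smooth_fun A v \<Longrightarrow> D (u + v) = D u + D v"
    and differential_operator_mult_left: "D (\<lambda>x. c * u x) = (\<lambda>x. c * D u x)"
proof -
  have "(smooth_fun A v \<longrightarrow> D (u + v) p = D u p + D v p) \<and> D (\<lambda>x. c * u x) p = c * D u p" for p v
  proof -
    obtain U \<phi> where U: "(U, \<phi>) \<in> A" "p \<in> U" using topological_atlas_chartE[OF A] by blast
    note Ud = topological_atlasD[OF A U(1)]
    obtain I and a where I: "finite I" "\<And>vs. vs \<in> I \<Longrightarrow> smooth_on (\<phi> ` U) (a vs :: 'e \<Rightarrow> complex)"
      and Du: "\<And>u y. smooth_fun A u \<Longrightarrow> y \<in> \<phi> ` U \<Longrightarrow>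
        D u (inv_into U \<phi> y) = (\<Sum>vs\<in>I. a vs y * dir_derivs vs (u \<circ> inv_into U \<phi>) y)"
      by (rule differential_operatorE[OF D U(1)]) (rule that)
    have y: "\<phi> p \<in> \<phi> ` U" "inv_into U \<phi> (\<phi> p) = p" using U(2) Ud(4) by auto
    have su: "smooth_on (\<phi> ` U) (w \<circ> inv_into U \<phi>)" if "smooth_fun A w" for w :: "'m cfun"
      using that U(1) by (auto simp: smooth_fun_def)
    have "D (u + v) p = D u p + D v p" if v: "smooth_fun A v"
    proof -
      have "(u + v) \<circ> inv_into U \<phi> = (\<lambda>y. (u \<circ> inv_into U \<phi>) y + (v \<circ> inv_into U \<phi>) y)"
        by (simp add: fun_eq_iff)
      then have "dir_derivs vs ((u + v) \<circ> inv_into U \<phi>) (\<phi> p)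
          = dir_derivs vs (u \<circ> inv_into U \<phi>) (\<phi> p) + dir_derivs vs (v \<circ> inv_into U \<phi>) (\<phi> p)" for vs
        by (simp only: dir_derivs_add[OF Ud(2) su[OF u] su[OF v] y(1)])
      then show ?thesis
        using Du[OF smooth_fun_add[OF A u v] y(1)] Du[OF u y(1)] Du[OF v y(1)]
        by (simp add: y(2) distrib_left sum.distrib)
    qed
    moreover have "D (\<lambda>x. c * u x) p = c * D u p"
    proof -
      have "(\<lambda>x. c * u x) \<circ> inv_into U \<phi> = (\<lambda>y. c * (u \<circ> inv_into U \<phi>) y)"
        by (simp add: fun_eq_iff)
      then have "dir_derivs vs ((\<lambda>x. c * u x) \<circ> inv_into U \<phi>) (\<phi> p)
          = c * dir_derivs vs (u \<circ> inv_into U \<phi>) (\<phi> p)" for vs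
        by (simp only: dir_derivs_mult_left[OF Ud(2) su[OF u] y(1)])
      then show ?thesis
        using Du[OF smooth_fun_mult_left[OF A u] y(1), of c] Du[OF u y(1)]
        by (simp add: y(2) sum_distrib_left mult_ac)
    qed
    ultimately show ?thesis by blast
  qed
  then show "smooth_fun A v \<Longrightarrow> D (u + v) = D u + D v" "D (\<lambda>x. c * u x) = (\<lambda>x. c * D u x)"
    by (auto simp: fun_eq_iff)
qed

text \<open>Elements of the Lie algebra are not additive by definition. Additivity on smooth
  functions comes from the Frechet derivative that represents the field at the identity.\<close>

lemma inf_action_add:
  assumes GM: "smooth_action G AG AM act" and X: "X \<in> lie_algebra G AG"
    and u: "smooth_fun AM u" and v: "smooth_fun AM v"
  shows "inf_action G act X (u + v) = inf_action G act X u + inf_action G act X v"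
proof
  fix p
  have tG: "topological_atlas AG" and tM: "topological_atlas AM"
    using GM smooth_atlas_imp_topological_atlas by (auto simp: smooth_action_def lie_group_def)
  obtain U \<phi> a where U: "(U, \<phi>) \<in> AG" "\<one>\<^bsub>G\<^esub> \<in> U" and
    Xf: "\<And>f. smooth_fun AG f \<Longrightarrow> X f \<one>\<^bsub>G\<^esub> = frechet_derivative (f \<circ> inv_into U \<phi>) (at (\<phi> \<one>\<^bsub>G\<^esub>)) a"
    using lie_algebra_at_one[OF X] by blast
  let ?t = "\<lambda>w g. w (act (inv\<^bsub>G\<^esub> g) p)" and ?x = "\<phi> \<one>\<^bsub>G\<^esub>"
  have sm: "smooth_fun AG (?t w)" if "smooth_fun AM w" for w :: "'c cfun"
    using smooth_fun_slice_left[OF tG tM smooth_fun_translate[OF GM that], of p] by simp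
  have d: "(?t w \<circ> inv_into U \<phi>) differentiable (at ?x)" if "smooth_fun AM w" for w :: "'c cfun"
    using sm[OF that] U by (intro smooth_on_imp_differentiable[of "\<phi> ` U"]) (auto simp: smooth_fun_def)
  have "inf_action G act X (u + v) p = frechet_derivative (?t (u + v) \<circ> inv_into U \<phi>) (at ?x) a"
    unfolding inf_action_def by (rule Xf[OF sm[OF smooth_fun_add[OF tM u v]]])
  also have "?t (u + v) \<circ> inv_into U \<phi> = (\<lambda>y. (?t u \<circ> inv_into U \<phi>) y + (?t v \<circ> inv_into U \<phi>) y)"
    by (simp add: fun_eq_iff)
  also have "frechet_derivative (\<lambda>y. (?t u \<circ> inv_into U \<phi>) y + (?t v \<circ> inv_into U \<phi>) y) (at ?x)
    = (\<lambda>h. frechet_derivative (?t u \<circ> inv_into U \<phi>) (at ?x) h + frechet_derivative (?t v \<circ> inv_into U \<phi>) (at ?x) h)"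
    by (intro frechet_derivative_at[symmetric] has_derivative_add)
      (use d[OF u] d[OF v] in \<open>simp_all only: frechet_derivative_works[symmetric]\<close>)
  also have "frechet_derivative (?t u \<circ> inv_into U \<phi>) (at ?x) a = inf_action G act X u p"
    unfolding inf_action_def by (rule Xf[OF sm[OF u], symmetric])
  also have "frechet_derivative (?t v \<circ> inv_into U \<phi>) (at ?x) a = inf_action G act X v p"
    unfolding inf_action_def by (rule Xf[OF sm[OF v], symmetric])
  finally show "inf_action G act X (u + v) p = (inf_action G act X u + inf_action G act X v) p"
    by (rule trans[OF _ plus_fun_apply[symmetric]])
qed

section \<open>Quotients of the free algebra and uniqueness of quantum moment maps\<close>

lemma free_algebra_simps:
  "p \<in> carrier (free_algebra S) \<longleftrightarrow> finite {w. p w \<noteq> 0} \<and> (\<forall>w. p w \<noteq> 0 \<longrightarrow> set w \<subseteq> S)"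
  "p \<otimes>\<^bsub>free_algebra S\<^esub> q = (\<lambda>w. \<Sum>i\<le>length w. p (take i w) * q (drop i w))"
  "\<one>\<^bsub>free_algebra S\<^esub> = (\<lambda>w. if w = [] then 1 else 0)"
  "\<zero>\<^bsub>free_algebra S\<^esub> = (\<lambda>w. 0)"
  "p \<oplus>\<^bsub>free_algebra S\<^esub> q = (\<lambda>w. p w + q w)"
  "c \<odot>\<^bsub>free_algebra S\<^esub> p = (\<lambda>w. c * p w)"
  by (simp_all add: free_algebra_def)

lemma free_algebra_add_closed:
  assumes "p \<in> carrier (free_algebra S)" "q \<in> carrier (free_algebra S)"
  shows "(\<lambda>w. p w + q w) \<in> carrier (free_algebra S)"
proof -
  have "{w. p w + q w \<noteq> 0} \<subseteq> {w. p w \<noteq> 0} \<union> {w. q w \<noteq> 0}" by auto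
  then have "finite {w. p w + q w \<noteq> 0}"
    by (rule finite_subset) (use assms in \<open>simp add: free_algebra_simps\<close>)
  moreover have "set w \<subseteq> S" if "p w + q w \<noteq> 0" for w
  proof -
    have "p w \<noteq> 0 \<or> q w \<noteq> 0" using that by auto
    then show ?thesis using assms by (auto simp: free_algebra_simps)
  qed
  ultimately show ?thesis by (simp add: free_algebra_simps)
qed

lemma free_algebra_scale_closed:
  assumes "p \<in> carrier (free_algebra S)"
  shows "(\<lambda>w. c * p w) \<in> carrier (free_algebra S)"
proof -
  have "{w. c * p w \<noteq> 0} \<subseteq> {w. p w \<noteq> 0}" by auto
  then have "finite {w. c * p w \<noteq> 0}"
    by (rule finite_subset) (use assms in \<open>simp add: free_algebra_simps\<close>)
  then show ?thesis using assms by (simp add: free_algebra_simps)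
qed

text \<open>A word with nonzero coefficient in the product is a concatenation of a word in the
  support of \<open>p\<close> and one in the support of \<open>q\<close>.\<close>

lemma free_algebra_mult_closed:
  assumes p: "p \<in> carrier (free_algebra S)" and q: "q \<in> carrier (free_algebra S)"
  shows "(\<lambda>w. \<Sum>i\<le>length w. p (take i w) * q (drop i w)) \<in> carrier (free_algebra S)"
proof -
  have *: "\<exists>a b. p a \<noteq> 0 \<and> q b \<noteq> 0 \<and> w = a @ b"
    if nz: "(\<Sum>i\<le>length w. p (take i w) * q (drop i w)) \<noteq> 0" for w
  proof -
    obtain i where "p (take i w) * q (drop i w) \<noteq> 0"
      using sum.not_neutral_contains_not_neutral[OF nz] by blast
    then show ?thesis by (intro exI[of _ "take i w"] exI[of _ "drop i w"]) auto
  qed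
  have "{w. (\<Sum>i\<le>length w. p (take i w) * q (drop i w)) \<noteq> 0}
      \<subseteq> (\<lambda>(a, b). a @ b) ` ({w. p w \<noteq> 0} \<times> {w. q w \<noteq> 0})"
  proof
    fix w assume "w \<in> {w. (\<Sum>i\<le>length w. p (take i w) * q (drop i w)) \<noteq> 0}"
    then obtain a b where "p a \<noteq> 0" "q b \<noteq> 0" "w = a @ b" using * by blast
    then show "w \<in> (\<lambda>(a, b). a @ b) ` ({w. p w \<noteq> 0} \<times> {w. q w \<noteq> 0})"
      by (intro image_eqI[of _ _ "(a, b)"]) auto
  qed
  then have "finite {w. (\<Sum>i\<le>length w. p (take i w) * q (drop i w)) \<noteq> 0}"
    by (rule finite_subset) (use p q in \<open>simp add: free_algebra_simps\<close>)
  moreover have "set w \<subseteq> S" if nz: "(\<Sum>i\<le>length w. p (take i w) * q (drop i w)) \<noteq> 0" for w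
  proof -
    obtain a b where "p a \<noteq> 0" "q b \<noteq> 0" and w: "w = a @ b" using *[OF nz] by blast
    then have "set a \<subseteq> S" "set b \<subseteq> S" using p q by (simp_all add: free_algebra_simps)
    then show ?thesis by (simp add: w)
  qed
  ultimately show ?thesis by (simp add: free_algebra_simps)
qed

lemma free_algebra_one_closed: "(\<lambda>w. if w = [] then 1 else 0) \<in> carrier (free_algebra S)"
proof -
  have "{w::'a list. (if w = [] then 1 else 0 :: complex fps) \<noteq> 0} \<subseteq> {[]}" by auto
  then show ?thesis using finite_subset by (auto simp: free_algebra_simps split: if_splits)
qed

text \<open>The triangle \<open>i + j \<le> n\<close> is summed by diagonals or by rows. The same
  exchange gives associativity of the free algebra and linearity of \<open>T\<close> over formal
  power series.\<close>

lemma sum_triangle_reindex: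
  fixes f :: "nat \<Rightarrow> nat \<Rightarrow> 'a::comm_monoid_add"
  shows "(\<Sum>k\<le>n. \<Sum>i\<le>k. f i (k - i)) = (\<Sum>i\<le>n. \<Sum>j\<le>n - i. f i j)"
proof -
  have "{(i, j). i + j \<le> n} = (SIGMA i:{..n}. {..n - i})" by auto
  then show ?thesis
    using sum.triangle_reindex_eq[of f n, symmetric] by (simp add: sum.Sigma)
qed

text \<open>Both sides sum over the ways of cutting a word into three consecutive pieces.\<close>

lemma free_algebra_mult_assoc:
  "(p \<otimes>\<^bsub>free_algebra S\<^esub> q) \<otimes>\<^bsub>free_algebra S\<^esub> r = p \<otimes>\<^bsub>free_algebra S\<^esub> (q \<otimes>\<^bsub>free_algebra S\<^esub> r)"
proof
  fix w :: "'a list"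
  let ?f = "\<lambda>j k. p (take j w) * (q (take k (drop j w)) * r (drop (j + k) w))"
  have "((p \<otimes>\<^bsub>free_algebra S\<^esub> q) \<otimes>\<^bsub>free_algebra S\<^esub> r) w = (\<Sum>i\<le>length w. \<Sum>j\<le>i. ?f j (i - j))"
    unfolding free_algebra_simps sum_distrib_right
    by (intro sum.cong) (auto simp: min_def drop_take mult.assoc)
  also have "\<dots> = (\<Sum>j\<le>length w. \<Sum>k\<le>length w - j. ?f j k)"
    by (rule sum_triangle_reindex)
  also have "\<dots> = (p \<otimes>\<^bsub>free_algebra S\<^esub> (q \<otimes>\<^bsub>free_algebra S\<^esub> r)) w"
    unfolding free_algebra_simps sum_distrib_left
    by (intro sum.cong) (auto simp: add.commute)
  finally show "((p \<otimes>\<^bsub>free_algebra S\<^esub> q) \<otimes>\<^bsub>free_algebra S\<^esub> r) w = \<dots>" .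
qed

lemma ring_free_algebra: "ring (free_algebra S)"
proof (rule ringI)
  show "abelian_group (free_algebra S)"
  proof (rule abelian_groupI)
    show "\<exists>q\<in>carrier (free_algebra S). q \<oplus>\<^bsub>free_algebra S\<^esub> p = \<zero>\<^bsub>free_algebra S\<^esub>"
      if "p \<in> carrier (free_algebra S)" for p
      by (rule bexI[OF _ free_algebra_scale_closed[OF that, of "-1"]]) (simp add: free_algebra_simps(4,5))
    show "\<zero>\<^bsub>free_algebra S\<^esub> \<in> carrier (free_algebra S)" by (simp add: free_algebra_simps)
  qed (simp_all add: free_algebra_simps(2-) free_algebra_add_closed add_ac)
  show "Group.monoid (free_algebra S)"
  proof (rule monoidI)
    show "\<one>\<^bsub>free_algebra S\<^esub> \<otimes>\<^bsub>free_algebra S\<^esub> p = p" for p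
    proof
      fix w :: "'a list"
      have "(\<one>\<^bsub>free_algebra S\<^esub> \<otimes>\<^bsub>free_algebra S\<^esub> p) w = (\<Sum>i\<le>length w. if i = 0 then p w else 0)"
        unfolding free_algebra_simps by (intro sum.cong) auto
      then show "(\<one>\<^bsub>free_algebra S\<^esub> \<otimes>\<^bsub>free_algebra S\<^esub> p) w = p w" by simp
    qed
    show "p \<otimes>\<^bsub>free_algebra S\<^esub> \<one>\<^bsub>free_algebra S\<^esub> = p" for p
    proof
      fix w :: "'a list"
      have "(p \<otimes>\<^bsub>free_algebra S\<^esub> \<one>\<^bsub>free_algebra S\<^esub>) w = (\<Sum>i\<le>length w. if i = length w then p w else 0)"
        unfolding free_algebra_simps by (intro sum.cong) auto
      then show "(p \<otimes>\<^bsub>free_algebra S\<^esub> \<one>\<^bsub>free_algebra S\<^esub>) w = p w" by simp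
    qed
  qed (simp_all add: free_algebra_mult_assoc,
      simp_all add: free_algebra_simps(2-) free_algebra_mult_closed free_algebra_one_closed)
qed (simp_all add: free_algebra_simps(2-) distrib_right distrib_left sum.distrib)

lemma gen_closed: "x \<in> S \<Longrightarrow> gen x \<in> carrier (free_algebra S)"
proof -
  assume x: "x \<in> S"
  have "{w. gen x w \<noteq> 0} \<subseteq> {[x]}" by (auto simp: gen_def)
  then show ?thesis using x finite_subset by (auto simp: free_algebra_simps gen_def split: if_splits)
qed

text \<open>For \<open>x\<close> outside \<open>S\<close> the coefficient of \<open>q\<close> at the
  word \<open>[x]\<close> is 0, so the difference has coefficient 1 there. This turns membership in
  the free algebra into membership in \<open>S\<close>.\<close>

lemma gen_diff_closedD:
  assumes "gen x - q \<in> carrier (free_algebra S)" "q \<in> carrier (free_algebra S)"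
  shows "x \<in> S"
proof (rule ccontr)
  assume x: "x \<notin> S"
  then have "q [x] = 0" using assms(2) by (force simp: free_algebra_simps)
  then have "(gen x - q) [x] \<noteq> 0" by (simp add: gen_def)
  then show False using assms(1) x by (force simp: free_algebra_simps)
qed

text \<open>Multiplicativity extends the agreement from generators to words, linearity to finite
  combinations of words; the second induction runs over a finite set of words containing the
  support.\<close>

lemma algebra_hom_free_algebra_eqI:
  assumes f: "f \<in> algebra_hom (free_algebra S) N" and g: "g \<in> algebra_hom (free_algebra S) N"
    and eq: "\<And>x. x \<in> S \<Longrightarrow> f (gen x) = g (gen x)" and p: "p \<in> carrier (free_algebra S)"
  shows "f p = g p"
proof -
  define \<delta> where "\<delta> v = (\<lambda>w. if w = v then 1 else 0 :: complex fps)" for v :: "'a list"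
  have \<delta>c: "\<delta> w \<in> carrier (free_algebra S)" if "set w \<subseteq> S" for w
  proof -
    have "{v. \<delta> w v \<noteq> 0} \<subseteq> {w}" by (auto simp: \<delta>_def)
    then show ?thesis using that finite_subset by (auto simp: free_algebra_simps \<delta>_def split: if_splits)
  qed
  have \<delta>: "f (\<delta> w) = g (\<delta> w)" if "set w \<subseteq> S" for w
    using that
  proof (induction w)
    case Nil
    have "\<delta> [] = \<one>\<^bsub>free_algebra S\<^esub>" by (simp add: \<delta>_def free_algebra_simps)
    then show ?case using f g by (simp add: algebra_hom_def ring_hom_def)
  next
    case (Cons x w)
    have "\<delta> (x # w) = gen x \<otimes>\<^bsub>free_algebra S\<^esub> \<delta> w"
    proof
      fix v :: "'a list"
      have "(gen x \<otimes>\<^bsub>free_algebra S\<^esub> \<delta> w) v = (\<Sum>i\<le>length v. if i = 1 then \<delta> (x # w) v else 0)"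
        unfolding free_algebra_simps
      proof (intro sum.cong refl)
        fix i assume i: "i \<in> {..length v}"
        show "gen x (take i v) * \<delta> w (drop i v) = (if i = 1 then \<delta> (x # w) v else 0)"
        proof (cases "i = 1")
          case True
          then show ?thesis using i by (cases v) (auto simp: gen_def \<delta>_def)
        next
          case False
          then have "take i v \<noteq> [x]" using i by (metis One_nat_def atMost_iff length_Cons length_take list.size(3) min.absorb2)
          then show ?thesis using False by (simp add: gen_def)
        qed
      qed
      also have "\<dots> = \<delta> (x # w) v"
        by (cases v) (auto simp: \<delta>_def Suc_le_eq)
      finally show "\<delta> (x # w) v = (gen x \<otimes>\<^bsub>free_algebra S\<^esub> \<delta> w) v" by simp
    qed
    then show ?case
      using f g Cons eq[of x] gen_closed[of x S] \<delta>c[of w] by (simp add: algebra_hom_def ring_hom_def)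
  qed
  have "\<And>p. p \<in> carrier (free_algebra S) \<Longrightarrow> {w. p w \<noteq> 0} \<subseteq> W \<Longrightarrow> f p = g p"
    if "finite W" "\<And>w. w \<in> W \<Longrightarrow> set w \<subseteq> S" for W
    using that
  proof (induction W rule: finite_induct)
    case empty
    \<comment> \<open>\<open>N\<close> is an arbitrary record in which sums need not cancel, so the
      value at 0 is obtained from the unit by scaling with 0.\<close>
    have "p = 0 \<odot>\<^bsub>free_algebra S\<^esub> \<one>\<^bsub>free_algebra S\<^esub>" using empty by (auto simp: free_algebra_simps)
    moreover have "f (\<one>\<^bsub>free_algebra S\<^esub>) = g (\<one>\<^bsub>free_algebra S\<^esub>)" "\<one>\<^bsub>free_algebra S\<^esub> \<in> carrier (free_algebra S)"
      using f g ring.ring_simprules(6)[OF ring_free_algebra] by (auto simp: algebra_hom_def ring_hom_def)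
    ultimately show ?case using f g by (simp add: algebra_hom_def)
  next
    case (insert w W)
    let ?q = "\<lambda>v. if v = w then 0 else p v"
    have "finite {v. ?q v \<noteq> 0}"
      by (rule finite_subset[of _ "{v. p v \<noteq> 0}"]) (use insert.prems(1) in \<open>auto simp: free_algebra_simps\<close>)
    then have q: "?q \<in> carrier (free_algebra S)"
      using insert.prems(1) by (simp add: free_algebra_simps)
    let ?r = "p w \<odot>\<^bsub>free_algebra S\<^esub> \<delta> w"
    have w: "set w \<subseteq> S" using insert.prems by blast
    have fg: "f ?q = g ?q" by (rule insert.IH[OF q]) (use insert.prems in auto)
    have r: "?r \<in> carrier (free_algebra S)"
      using free_algebra_scale_closed[OF \<delta>c[OF w]] by (simp add: free_algebra_simps(6))
    have "f (?q \<oplus>\<^bsub>free_algebra S\<^esub> ?r) = g (?q \<oplus>\<^bsub>free_algebra S\<^esub> ?r)"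
      using f g q r fg \<delta>[OF w] \<delta>c[OF w] by (simp add: algebra_hom_def ring_hom_def)
    moreover have "p = ?q \<oplus>\<^bsub>free_algebra S\<^esub> ?r"
      by (auto simp: free_algebra_simps \<delta>_def)
    ultimately show ?case by (rule ssubst[of p _ "\<lambda>p. f p = g p", rotated])
  qed
  from this[of "{w. p w \<noteq> 0}" p] p show ?thesis by (auto simp: free_algebra_simps)
qed

lemma algebra_hom_compose:
  assumes "f \<in> algebra_hom A B" "g \<in> algebra_hom B C"
  shows "(\<lambda>x. g (f x)) \<in> algebra_hom A C"
  using assms unfolding algebra_hom_def ring_hom_def by (simp add: Pi_iff)

section \<open>The enveloping algebra as a quotient\<close>

text \<open>Named separately because the generated ideal behaves as expected only once these
  relations are known to lie in the free algebra.\<close>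

definition uea_relations :: "('g cfun \<Rightarrow> 'g cfun) set \<Rightarrow> (('g cfun \<Rightarrow> 'g cfun) fps list \<Rightarrow> complex fps) set" where
  "uea_relations L = (let F = free_algebra (formal_lie L) in
     {gen (\<xi> + \<eta>) - (gen \<xi> + gen \<eta>) | \<xi> \<eta>. \<xi> \<in> formal_lie L \<and> \<eta> \<in> formal_lie L} \<union>
     {gen (formal_lie_scale r \<xi>) - complexify r \<odot>\<^bsub>F\<^esub> gen \<xi> | r \<xi>. \<xi> \<in> formal_lie L} \<union>
     {gen \<xi> \<otimes>\<^bsub>F\<^esub> gen \<eta> - gen \<eta> \<otimes>\<^bsub>F\<^esub> gen \<xi> - gen (formal_lie_bracket \<xi> \<eta>) | \<xi> \<eta>.
        \<xi> \<in> formal_lie L \<and> \<eta> \<in> formal_lie L})"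

lemma uea_ideal_eq: "uea_ideal L = genideal (free_algebra (formal_lie L)) (uea_relations L)"
  by (simp add: uea_ideal_def uea_relations_def Let_def)

lemma uea_simps:
  "carrier (uea L) = carrier (free_algebra (formal_lie L) Quot uea_ideal L)"
  "mult (uea L) = mult (free_algebra (formal_lie L) Quot uea_ideal L)"
  "one (uea L) = one (free_algebra (formal_lie L) Quot uea_ideal L)"
  "add (uea L) = add (free_algebra (formal_lie L) Quot uea_ideal L)"
  "c \<odot>\<^bsub>uea L\<^esub> P = (\<Union>p\<in>P. uea_ideal L +>\<^bsub>free_algebra (formal_lie L)\<^esub> (c \<odot>\<^bsub>free_algebra (formal_lie L)\<^esub> p))"
  by (simp_all add: uea_def Let_def)

text \<open>If some relation were not an element of the free algebra, no ideal would contain the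
  relations, the generated ideal would be \<open>UNIV\<close> and the quotient a single point. Hence the
  existence of a homomorphism to a nonzero algebra shows that \<open>L\<close> is closed under the operations
  occurring in the relations.\<close>

lemma uea_relations_closed:
  assumes \<Phi>: "\<Phi> \<in> algebra_hom (uea L) (star_algebra A star)"
  shows "uea_relations L \<subseteq> carrier (free_algebra (formal_lie L))"
proof (rule ccontr)
  let ?F = "free_algebra (formal_lie L)"
  assume n: "\<not> uea_relations L \<subseteq> carrier ?F"
  have e: "{J. ideal J ?F \<and> uea_relations L \<subseteq> J} = {}"
    using n by (auto dest: ideal.Icarr)
  have I: "uea_ideal L = UNIV"
    unfolding uea_ideal_eq genideal_def e by (rule Inter_empty)
  have add: "p \<oplus>\<^bsub>?F\<^esub> q = p + q" for p q by (auto simp: free_algebra_simps)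
  \<comment> \<open>The operations of the record act on all functions, also on those of infinite
    support, so every function is reached from \<open>UNIV\<close> by subtracting
    \<open>p\<close>.\<close>
  have coset: "UNIV +>\<^bsub>?F\<^esub> p = UNIV" for p
  proof -
    have "q \<in> UNIV +>\<^bsub>?F\<^esub> p" for q
      unfolding a_r_coset_def r_coset_def by (intro UN_I[of "q - p"]) (simp_all add: add)
    then show ?thesis by auto
  qed
  have "UNIV <+>\<^bsub>?F\<^esub> UNIV = UNIV"
  proof -
    have "q \<in> UNIV <+>\<^bsub>?F\<^esub> UNIV" for q
      unfolding set_add_def' by (intro UN_I[of q] UN_I[of 0]) (simp_all add: add)
    then show ?thesis by auto
  qed
  then have a: "UNIV \<oplus>\<^bsub>uea L\<^esub> UNIV = UNIV" by (simp add: uea_simps FactRing_def I)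
  have o: "\<one>\<^bsub>uea L\<^esub> = UNIV" by (simp add: uea_simps FactRing_def I coset)
  have "UNIV \<in> carrier (uea L)"
    unfolding uea_simps FactRing_def A_RCOSETS_def'
    using free_algebra_one_closed[of "formal_lie L"] by (simp add: I coset) blast
  \<comment> \<open>The single point equals its own double and is also the unit, so its image would
    be both 0 and 1.\<close>
  then have "\<Phi> UNIV = \<Phi> UNIV + \<Phi> UNIV"
    using \<Phi> a by (force simp: algebra_hom_def ring_hom_def star_algebra_def)
  then have "\<Phi> UNIV = 0" by simp
  moreover have "\<Phi> UNIV = 1" using \<Phi> o by (auto simp: algebra_hom_def ring_hom_def star_algebra_def)
  ultimately have "fps_nth (1 :: 'c cfun fps) 0 = 0" by simp
  then show False by simp
qed

text \<open>Scalar multiplication of a coset is a union over its representatives. Scaling by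
  \<open>c\<close> is left multiplication by \<open>c\<close> times the unit, so the ideal is stable
  under it and all representatives yield the same coset.\<close>

lemma
  assumes rel: "uea_relations L \<subseteq> carrier (free_algebra (formal_lie L))"
  shows ideal_uea_ideal: "ideal (uea_ideal L) (free_algebra (formal_lie L))"
    and uea_coset_algebra_hom:
      "(\<lambda>p. uea_ideal L +>\<^bsub>free_algebra (formal_lie L)\<^esub> p) \<in> algebra_hom (free_algebra (formal_lie L)) (uea L)"
    and carrier_uea:
      "carrier (uea L) = (\<lambda>p. uea_ideal L +>\<^bsub>free_algebra (formal_lie L)\<^esub> p) ` carrier (free_algebra (formal_lie L))"
proof -
  let ?F = "free_algebra (formal_lie L)" and ?I = "uea_ideal L"
  interpret F: ring ?F by (rule ring_free_algebra)
  show I: "ideal ?I ?F" unfolding uea_ideal_eq by (rule F.genideal_ideal[OF rel])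
  interpret I: ideal ?I ?F by (rule I)
  show "carrier (uea L) = (\<lambda>p. ?I +>\<^bsub>?F\<^esub> p) ` carrier ?F"
    by (auto simp: uea_simps FactRing_def A_RCOSETS_def')
  have h: "(\<lambda>p. ?I +>\<^bsub>?F\<^esub> p) \<in> ring_hom ?F (uea L)"
    using I.rcos_ring_hom unfolding ring_hom_def uea_simps by simp
  have "?I +>\<^bsub>?F\<^esub> (c \<odot>\<^bsub>?F\<^esub> p) = c \<odot>\<^bsub>uea L\<^esub> (?I +>\<^bsub>?F\<^esub> p)" if p: "p \<in> carrier ?F" for c p
  proof -
    have smult: "c \<odot>\<^bsub>?F\<^esub> q = (c \<odot>\<^bsub>?F\<^esub> \<one>\<^bsub>?F\<^esub>) \<otimes>\<^bsub>?F\<^esub> q" for q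
    proof
      fix w :: "('a cfun \<Rightarrow> 'a cfun) fps list"
      have "((c \<odot>\<^bsub>?F\<^esub> \<one>\<^bsub>?F\<^esub>) \<otimes>\<^bsub>?F\<^esub> q) w = (\<Sum>i\<le>length w. if i = 0 then c * q w else 0)"
        unfolding free_algebra_simps by (intro sum.cong) auto
      then show "(c \<odot>\<^bsub>?F\<^esub> q) w = ((c \<odot>\<^bsub>?F\<^esub> \<one>\<^bsub>?F\<^esub>) \<otimes>\<^bsub>?F\<^esub> q) w" by (simp add: free_algebra_simps(6))
    qed
    have cF: "c \<odot>\<^bsub>?F\<^esub> q \<in> carrier ?F" if "q \<in> carrier ?F" for q
      using free_algebra_scale_closed[OF that] by (simp add: free_algebra_simps(6))
    have "?I +>\<^bsub>?F\<^esub> (c \<odot>\<^bsub>?F\<^esub> q) = ?I +>\<^bsub>?F\<^esub> (c \<odot>\<^bsub>?F\<^esub> p)" if q: "q \<in> ?I +>\<^bsub>?F\<^esub> p" for q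
    proof (rule I.a_repr_independence'[OF _ cF[OF p], symmetric])
      obtain i where i: "i \<in> ?I" "q = i \<oplus>\<^bsub>?F\<^esub> p" using q by (auto simp: a_r_coset_def r_coset_def)
      have "c \<odot>\<^bsub>?F\<^esub> i \<in> ?I"
        unfolding smult[of i] by (intro I.I_l_closed i cF F.one_closed)
      moreover have "c \<odot>\<^bsub>?F\<^esub> q = (c \<odot>\<^bsub>?F\<^esub> i) \<oplus>\<^bsub>?F\<^esub> (c \<odot>\<^bsub>?F\<^esub> p)"
        by (simp add: i free_algebra_simps distrib_left)
      ultimately show "c \<odot>\<^bsub>?F\<^esub> q \<in> ?I +>\<^bsub>?F\<^esub> (c \<odot>\<^bsub>?F\<^esub> p)"
        by (auto simp: a_r_coset_def r_coset_def)
    qed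
    moreover have "p \<in> ?I +>\<^bsub>?F\<^esub> p" using p by (rule I.a_rcos_self)
    ultimately show ?thesis unfolding uea_simps by blast
  qed
  with h show "(\<lambda>p. ?I +>\<^bsub>?F\<^esub> p) \<in> algebra_hom ?F (uea L)" by (simp add: algebra_hom_def)
qed

text \<open>In each relation the generator of the result of the operation stands beside an element
  of the free algebra. As the relation is itself in the free algebra, so is that generator, which
  puts the result in \<open>formal_lie L\<close>.\<close>

lemma
  assumes rel: "uea_relations L \<subseteq> carrier (free_algebra (formal_lie L))"
    and \<xi>: "\<xi> \<in> formal_lie L"
  shows formal_lie_scale_closed: "formal_lie_scale r \<xi> \<in> formal_lie L"
    and formal_lie_bracket_closed: "\<eta> \<in> formal_lie L \<Longrightarrow> formal_lie_bracket \<xi> \<eta> \<in> formal_lie L"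
proof -
  let ?F = "free_algebra (formal_lie L)"
  interpret F: ring ?F by (rule ring_free_algebra)
  have scale: "c \<odot>\<^bsub>?F\<^esub> p \<in> carrier ?F" if "p \<in> carrier ?F" for c p
    using free_algebra_scale_closed[OF that] by (simp add: free_algebra_simps(6))
  have add: "p + q \<in> carrier ?F" if "p \<in> carrier ?F" "q \<in> carrier ?F" for p q
    using free_algebra_add_closed[OF that] by (simp add: plus_fun_def)
  have uminus: "- p \<in> carrier ?F" if "p \<in> carrier ?F" for p
    using free_algebra_scale_closed[OF that, of "-1"] by (simp add: fun_Compl_def)
  show "formal_lie_scale r \<xi> \<in> formal_lie L"
    using rel \<xi> gen_diff_closedD[OF _ scale[OF gen_closed[OF \<xi>]]]
    unfolding uea_relations_def Let_def by blast
  assume \<eta>: "\<eta> \<in> formal_lie L"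
  let ?c = "gen \<xi> \<otimes>\<^bsub>?F\<^esub> gen \<eta> - gen \<eta> \<otimes>\<^bsub>?F\<^esub> gen \<xi>"
  have c: "?c \<in> carrier ?F"
    unfolding diff_conv_add_uminus by (intro add uminus F.m_closed gen_closed \<xi> \<eta>)
  have "?c - gen (formal_lie_bracket \<xi> \<eta>) \<in> carrier ?F"
    using rel \<xi> \<eta> unfolding uea_relations_def Let_def by blast
  from uminus[OF this] have "gen (formal_lie_bracket \<xi> \<eta>) - ?c \<in> carrier ?F" by simp
  from gen_diff_closedD[OF this c] show "formal_lie_bracket \<xi> \<eta> \<in> formal_lie L" .
qed

text \<open>Pulled back to the free algebra along the quotient map, \<open>\<Phi>\<close> vanishes
  on the ideal and therefore identifies the two sides of every relation.\<close>

lemma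
  fixes L :: "('g cfun \<Rightarrow> 'g cfun) set"
  assumes \<Phi>: "\<Phi> \<in> algebra_hom (uea L) (star_algebra A star)" and \<xi>: "\<xi> \<in> formal_lie L"
  defines "h \<equiv> \<lambda>\<xi>. \<Phi> (uea_ideal L +>\<^bsub>free_algebra (formal_lie L)\<^esub> gen \<xi>)"
  shows uea_hom_gen_closed: "h \<xi> \<in> formal_funs A"
    and uea_hom_gen_add: "\<eta> \<in> formal_lie L \<Longrightarrow> h (\<xi> + \<eta>) = h \<xi> + h \<eta>"
    and uea_hom_gen_scale: "h (formal_lie_scale r \<xi>) = formal_scale (complexify r) (h \<xi>)"
    and uea_hom_gen_bracket: "\<eta> \<in> formal_lie L \<Longrightarrow>
      h (formal_lie_bracket \<xi> \<eta>) = star (h \<xi>) (h \<eta>) - star (h \<eta>) (h \<xi>)"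
proof -
  let ?F = "free_algebra (formal_lie L)" and ?I = "uea_ideal L"
  note rel = uea_relations_closed[OF \<Phi>]
  interpret I: ideal ?I ?F by (rule ideal_uea_ideal[OF rel])
  define f where "f p = \<Phi> (?I +>\<^bsub>?F\<^esub> p)" for p
  have f: "f \<in> algebra_hom ?F (star_algebra A star)"
    unfolding f_def by (rule algebra_hom_compose[OF uea_coset_algebra_hom[OF rel] \<Phi>])
  have hf: "h \<xi> = f (gen \<xi>)" for \<xi> by (simp add: h_def f_def)
  have closed: "f p \<in> formal_funs A" if "p \<in> carrier ?F" for p
    using f that by (auto simp: algebra_hom_def ring_hom_def star_algebra_def)
  have plus: "f (p + q) = f p + f q" and mult: "f (p \<otimes>\<^bsub>?F\<^esub> q) = star (f p) (f q)"
    if "p \<in> carrier ?F" "q \<in> carrier ?F" for p q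
  proof -
    have "p + q = p \<oplus>\<^bsub>?F\<^esub> q" by (auto simp: free_algebra_simps)
    then show "f (p + q) = f p + f q" "f (p \<otimes>\<^bsub>?F\<^esub> q) = star (f p) (f q)"
      using f that by (auto simp: algebra_hom_def ring_hom_def star_algebra_def)
  qed
  have scale: "f (c \<odot>\<^bsub>?F\<^esub> p) = formal_scale c (f p)" if "p \<in> carrier ?F" for c p
    using f that by (auto simp: algebra_hom_def star_algebra_def)
  have zero: "f p = 0" if p: "p \<in> ?I" for p
  proof -
    have "?I +>\<^bsub>?F\<^esub> p = ?I" "?I +>\<^bsub>?F\<^esub> \<zero>\<^bsub>?F\<^esub> = ?I" using p by (simp_all add: I.a_rcos_const I.zero_closed)
    then have "f p = f (\<zero>\<^bsub>?F\<^esub>)" by (simp add: f_def)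
    moreover have "f (\<zero>\<^bsub>?F\<^esub> + \<zero>\<^bsub>?F\<^esub>) = f (\<zero>\<^bsub>?F\<^esub>) + f (\<zero>\<^bsub>?F\<^esub>)" by (intro plus I.zero_closed)
    moreover have "\<zero>\<^bsub>?F\<^esub> + \<zero>\<^bsub>?F\<^esub> = \<zero>\<^bsub>?F\<^esub>" by (auto simp: free_algebra_simps)
    ultimately show ?thesis by simp
  qed
  have diff: "f p = f q" if "p - q \<in> uea_relations L" "q \<in> carrier ?F" for p q
  proof -
    have "p - q \<in> ?I" using that I.genideal_self[OF rel] unfolding uea_ideal_eq by blast
    then have "f (p - q) = 0" "p - q \<in> carrier ?F" using zero I.Icarr by auto
    then show ?thesis using plus[of "p - q" q] that by simp
  qed
  have gen: "gen \<zeta> \<in> carrier ?F" if "\<zeta> \<in> formal_lie L" for \<zeta> using that by (rule gen_closed)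
  show "h \<xi> \<in> formal_funs A" unfolding hf by (intro closed gen \<xi>)
  have "f (gen (formal_lie_scale r \<xi>)) = f (complexify r \<odot>\<^bsub>?F\<^esub> gen \<xi>)"
  proof (rule diff)
    show "gen (formal_lie_scale r \<xi>) - complexify r \<odot>\<^bsub>?F\<^esub> gen \<xi> \<in> uea_relations L"
      using \<xi> unfolding uea_relations_def Let_def by blast
    show "complexify r \<odot>\<^bsub>?F\<^esub> gen \<xi> \<in> carrier ?F"
      using free_algebra_scale_closed[OF gen[OF \<xi>]] by (simp add: free_algebra_simps(6))
  qed
  then show "h (formal_lie_scale r \<xi>) = formal_scale (complexify r) (h \<xi>)"
    unfolding hf by (simp add: scale gen \<xi>)
  assume \<eta>: "\<eta> \<in> formal_lie L"
  have gg: "gen \<xi> + gen \<eta> \<in> carrier ?F"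
    using free_algebra_add_closed[OF gen[OF \<xi>] gen[OF \<eta>]] by (simp add: plus_fun_def)
  have "f (gen (\<xi> + \<eta>)) = f (gen \<xi> + gen \<eta>)"
    by (rule diff[OF _ gg]) (use \<xi> \<eta> in \<open>unfold uea_relations_def Let_def, blast\<close>)
  then show "h (\<xi> + \<eta>) = h \<xi> + h \<eta>" unfolding hf by (simp add: plus gen \<xi> \<eta>)
  let ?b = "gen (formal_lie_bracket \<xi> \<eta>)"
  have b: "?b \<in> carrier ?F" by (intro gen formal_lie_bracket_closed[OF rel] \<xi> \<eta>)
  have m: "gen \<xi> \<otimes>\<^bsub>?F\<^esub> gen \<eta> \<in> carrier ?F" "gen \<eta> \<otimes>\<^bsub>?F\<^esub> gen \<xi> \<in> carrier ?F"
    by (intro I.m_closed gen \<xi> \<eta>)+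
  have "gen \<xi> \<otimes>\<^bsub>?F\<^esub> gen \<eta> - gen \<eta> \<otimes>\<^bsub>?F\<^esub> gen \<xi> - ?b \<in> uea_relations L"
    using \<xi> \<eta> unfolding uea_relations_def Let_def by blast
  then have "gen \<xi> \<otimes>\<^bsub>?F\<^esub> gen \<eta> - (gen \<eta> \<otimes>\<^bsub>?F\<^esub> gen \<xi> + ?b) \<in> uea_relations L"
    by (simp add: diff_diff_eq)
  moreover have "gen \<eta> \<otimes>\<^bsub>?F\<^esub> gen \<xi> + ?b \<in> carrier ?F"
    using free_algebra_add_closed[OF m(2) b] by (simp add: plus_fun_def)
  ultimately have "f (gen \<xi> \<otimes>\<^bsub>?F\<^esub> gen \<eta>) = f (gen \<eta> \<otimes>\<^bsub>?F\<^esub> gen \<xi> + ?b)" by (rule diff)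
  then show "h (formal_lie_bracket \<xi> \<eta>) = star (h \<xi>) (h \<eta>) - star (h \<eta>) (h \<xi>)"
    unfolding hf by (simp add: plus mult m b gen \<xi> \<eta>)
qed

lemma uea_hom_eqI:
  assumes \<Phi>: "\<Phi> \<in> algebra_hom (uea L) (star_algebra A star)"
    and \<Psi>: "\<Psi> \<in> algebra_hom (uea L) (star_algebra A star)"
    and eq: "\<And>\<xi>. \<xi> \<in> formal_lie L \<Longrightarrow>
      \<Phi> (uea_ideal L +>\<^bsub>free_algebra (formal_lie L)\<^esub> gen \<xi>) = \<Psi> (uea_ideal L +>\<^bsub>free_algebra (formal_lie L)\<^esub> gen \<xi>)"
    and a: "a \<in> carrier (uea L)"
  shows "\<Phi> a = \<Psi> a"
proof -
  note rel = uea_relations_closed[OF \<Phi>]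
  obtain p where p: "p \<in> carrier (free_algebra (formal_lie L))"
    "a = uea_ideal L +>\<^bsub>free_algebra (formal_lie L)\<^esub> p"
    using a unfolding carrier_uea[OF rel] by blast
  show ?thesis
    unfolding p(2)
    by (rule algebra_hom_free_algebra_eqI[OF algebra_hom_compose[OF uea_coset_algebra_hom[OF rel] \<Phi>]
        algebra_hom_compose[OF uea_coset_algebra_hom[OF rel] \<Psi>] eq p(1)])
qed

section \<open>Series with coefficients in the Lie algebra\<close>

text \<open>The bracket of a field with the zero field evaluates that field at the zero function.
  Such terms occur in the bracket of two constant series and must vanish.\<close>

lemma vector_field_zero:
  assumes "X \<in> vector_fields A" shows "X 0 = 0"
proof
  fix p
  have "at_point X p \<in> tangent_space A p" using assms by (simp add: vector_fields_def)
  then obtain U and \<phi> :: "'a \<Rightarrow> 'b" and a where "at_point X p = (\<lambda>f. if smooth_fun A f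
      then frechet_derivative (f \<circ> inv_into U \<phi>) (at (\<phi> p)) a else 0)"
    unfolding tangent_space_def by blast
  from fun_cong[OF this, of 0] show "X 0 p = 0 p"
    by (simp add: at_point_def comp_def)
qed

lemma vf_scale_simps: "vf_scale 0 X = 0" "vf_scale 1 X = X" "vf_scale c 0 = 0"
  by (auto simp: vf_scale_def fun_eq_iff)

lemma formal_lie_scale_fps_X: "formal_lie_scale fps_X \<xi> = Abs_fps (\<lambda>n. case n of 0 \<Rightarrow> 0 | Suc m \<Rightarrow> fps_nth \<xi> m)"
proof (rule fps_ext)
  fix n
  have "(\<Sum>i\<le>n. vf_scale (fps_nth fps_X i) (fps_nth \<xi> (n - i))) = (\<Sum>i\<le>n. if i = 1 then fps_nth \<xi> (n - 1) else 0)"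
    by (intro sum.cong) (auto simp: vf_scale_simps)
  also have "\<dots> = (case n of 0 \<Rightarrow> 0 | Suc m \<Rightarrow> fps_nth \<xi> m)" by (cases n) auto
  finally show "fps_nth (formal_lie_scale fps_X \<xi>) n = fps_nth (Abs_fps (\<lambda>n. case n of 0 \<Rightarrow> 0 | Suc m \<Rightarrow> fps_nth \<xi> m)) n"
    by (simp add: formal_lie_scale_def)
qed

lemma formal_lie_scale_const: "formal_lie_scale (fps_const c) (fps_const X) = fps_const (vf_scale c X)"
proof (rule fps_ext)
  fix n
  have "(\<Sum>i\<le>n. vf_scale (fps_nth (fps_const c) i) (fps_nth (fps_const X) (n - i)))
     = (\<Sum>i\<le>n. if i = 0 then vf_scale c (fps_nth (fps_const X) n) else 0)"
    by (intro sum.cong) (auto simp: vf_scale_simps)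
  then show "fps_nth (formal_lie_scale (fps_const c) (fps_const X)) n = fps_nth (fps_const (vf_scale c X)) n"
    by (simp add: formal_lie_scale_def vf_scale_simps)
qed

lemma formal_lie_bracket_const:
  assumes X: "X 0 = 0" and Y: "Y 0 = 0"
  shows "formal_lie_bracket (fps_const X) (fps_const Y) = formal_lie_scale fps_X (fps_const (vf_bracket X Y))"
proof (rule fps_ext)
  fix n
  have b: "vf_bracket 0 Y = 0" "vf_bracket X 0 = 0" "vf_bracket 0 0 = 0"
    using X Y by (auto simp: vf_bracket_def fun_eq_iff)
  show "fps_nth (formal_lie_bracket (fps_const X) (fps_const Y)) n
      = fps_nth (formal_lie_scale fps_X (fps_const (vf_bracket X Y))) n"
  proof (cases n)
    case (Suc m)
    have "(\<Sum>i\<le>m. vf_bracket (fps_nth (fps_const X) i) (fps_nth (fps_const Y) (m - i)))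
      = (\<Sum>i\<le>m. if i = 0 then if m = 0 then vf_bracket X Y else 0 else 0)"
      by (intro sum.cong) (auto simp: b)
    then show ?thesis using Suc by (simp add: formal_lie_bracket_def formal_lie_scale_fps_X)
  qed (simp add: formal_lie_bracket_def formal_lie_scale_fps_X)
qed

lemma complexify_simps: "complexify fps_X = fps_X" "complexify (fps_const c) = fps_const (complex_of_real c)"
  by (auto simp: complexify_def fps_eq_iff)

lemma formal_scale_fps_X: "formal_scale fps_X u = Abs_fps (\<lambda>n. case n of 0 \<Rightarrow> 0 | Suc m \<Rightarrow> fps_nth u m)"
proof (rule fps_ext, rule ext)
  fix n x
  have "(\<Sum>i\<le>n. fps_nth fps_X i * fps_nth u (n - i) x) = (\<Sum>i\<le>n. if i = 1 then fps_nth u (n - 1) x else 0)"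
    by (intro sum.cong) auto
  also have "\<dots> = (case n of 0 \<Rightarrow> 0 | Suc m \<Rightarrow> fps_nth u m) x" by (cases n) auto
  finally show "fps_nth (formal_scale fps_X u) n x = fps_nth (Abs_fps (\<lambda>n. case n of 0 \<Rightarrow> 0 | Suc m \<Rightarrow> fps_nth u m)) n x"
    by (simp add: formal_scale_def)
qed

lemma fps_nth_formal_scale_const: "fps_nth (formal_scale (fps_const c) u) n x = c * fps_nth u n x"
proof -
  have "(\<Sum>i\<le>n. fps_nth (fps_const c) i * fps_nth u (n - i) x) = (\<Sum>i\<le>n. if i = 0 then c * fps_nth u n x else 0)"
    by (intro sum.cong) auto
  then show ?thesis by (simp add: formal_scale_def)
qed

text \<open>The higher coefficients of a constant series are 0, so 0 must lie in \<open>L\<close>.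
  It is the lowest coefficient of \<lambda> times the series all of whose coefficients are
  \<open>X\<close>.\<close>

lemma fps_const_formal_lie:
  assumes rel: "uea_relations L \<subseteq> carrier (free_algebra (formal_lie L))" and X: "X \<in> L"
  shows "fps_const X \<in> formal_lie L"
proof -
  have "Abs_fps (\<lambda>n. X) \<in> formal_lie L" using X by (simp add: formal_lie_def)
  from formal_lie_scale_closed[OF rel this, of fps_X] have "0 \<in> L"
    by (auto simp: formal_lie_scale_fps_X formal_lie_def dest: spec[of _ 0])
  with X show ?thesis by (simp add: formal_lie_def)
qed

section \<open>Uniqueness of quantum moment maps\<close>

lemma quantum_moment_map_unique:
  assumes H1: "H1_vanishes (lie_algebra G AG)"
    and \<Phi>: "quantum_moment_map G AG AM act star \<Phi>" and \<Psi>: "quantum_moment_map G AG AM act star \<Psi>"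
    and a: "a \<in> carrier (uea (lie_algebra G AG))"
  shows "\<Phi> a = \<Psi> a"
proof -
  define L where "L = lie_algebra G AG"
  define h where "h \<Phi> \<xi> = \<Phi> (uea_ideal L +>\<^bsub>free_algebra (formal_lie L)\<^esub> gen \<xi>)"
    for \<Phi> :: "(('a cfun \<Rightarrow> 'a cfun) fps list \<Rightarrow> complex fps) set \<Rightarrow> 'c cfun fps" and \<xi>
  have h\<Phi>: "\<Phi> \<in> algebra_hom (uea L) (star_algebra AM star)"
    and h\<Psi>: "\<Psi> \<in> algebra_hom (uea L) (star_algebra AM star)"
    using \<Phi> \<Psi> by (auto simp: quantum_moment_map_def L_def)
  note rel = uea_relations_closed[OF h\<Phi>]
  have comm: "star (h \<Theta> (fps_const X)) u - star u (h \<Theta> (fps_const X)) = formal_scale fps_X (formal_inf_action G act X u)"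
    if "quantum_moment_map G AG AM act star \<Theta>" "X \<in> L" "u \<in> formal_funs AM" for \<Theta> X u
    using that by (simp add: quantum_moment_map_def uea_incl_def h_def L_def Let_def)
  note const = fps_const_formal_lie[OF rel]
  have bracket: "vf_bracket X Y \<in> L \<and> h \<Phi> (fps_const (vf_bracket X Y)) = h \<Psi> (fps_const (vf_bracket X Y))"
    if X: "X \<in> L" and Y: "Y \<in> L" for X Y
  proof -
    let ?b = "formal_lie_bracket (fps_const X) (fps_const Y)"
    have "X \<in> vector_fields AG" "Y \<in> vector_fields AG" using X Y by (auto simp: L_def lie_algebra_def)
    then have b: "?b = formal_lie_scale fps_X (fps_const (vf_bracket X Y))"
      by (intro formal_lie_bracket_const vector_field_zero)
    \<comment> \<open>The factor \<lambda> places the ordinary bracket at order 1 of the formal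
      one.\<close>
    have "fps_nth ?b 1 \<in> L"
      using formal_lie_bracket_closed[OF rel const[OF X] const[OF Y]] by (simp add: formal_lie_def)
    then have bL: "vf_bracket X Y \<in> L" unfolding b by (simp add: formal_lie_scale_fps_X)
    have c: "h \<Phi> (fps_const Y) \<in> formal_funs AM" "h \<Psi> (fps_const X) \<in> formal_funs AM"
      unfolding h_def by (intro uea_hom_gen_closed[OF h\<Phi>] uea_hom_gen_closed[OF h\<Psi>] const X Y)+
    have "h \<Phi> ?b = star (h \<Phi> (fps_const X)) (h \<Phi> (fps_const Y)) - star (h \<Phi> (fps_const Y)) (h \<Phi> (fps_const X))"
      unfolding h_def by (intro uea_hom_gen_bracket[OF h\<Phi>] const X Y)
    also have "\<dots> = star (h \<Psi> (fps_const X)) (h \<Phi> (fps_const Y)) - star (h \<Phi> (fps_const Y)) (h \<Psi> (fps_const X))"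
      unfolding comm[OF \<Phi> X c(1)] comm[OF \<Psi> X c(1)] ..
    also have "\<dots> = - (star (h \<Phi> (fps_const Y)) (h \<Psi> (fps_const X)) - star (h \<Psi> (fps_const X)) (h \<Phi> (fps_const Y)))"
      by simp
    also have "\<dots> = - (star (h \<Psi> (fps_const Y)) (h \<Psi> (fps_const X)) - star (h \<Psi> (fps_const X)) (h \<Psi> (fps_const Y)))"
      unfolding comm[OF \<Phi> Y c(2)] comm[OF \<Psi> Y c(2)] ..
    also have "\<dots> = star (h \<Psi> (fps_const X)) (h \<Psi> (fps_const Y)) - star (h \<Psi> (fps_const Y)) (h \<Psi> (fps_const X))"
      by simp
    also have "\<dots> = h \<Psi> ?b"
      unfolding h_def by (intro uea_hom_gen_bracket[OF h\<Psi>, symmetric] const X Y)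
    finally have "formal_scale fps_X (h \<Phi> (fps_const (vf_bracket X Y))) = formal_scale fps_X (h \<Psi> (fps_const (vf_bracket X Y)))"
      unfolding b h_def uea_hom_gen_scale[OF h\<Phi> const[OF bL]] uea_hom_gen_scale[OF h\<Psi> const[OF bL]] complexify_simps .
    \<comment> \<open>Cancellation of \<lambda>: order \<open>n + 1\<close> of the scaled series is
      order \<open>n\<close> of the original one.\<close>
    then have "fps_nth (h \<Phi> (fps_const (vf_bracket X Y))) n = fps_nth (h \<Psi> (fps_const (vf_bracket X Y))) n" for n
      unfolding formal_scale_fps_X by (auto simp: fps_eq_iff dest: spec[of _ "Suc n"])
    with bL show ?thesis by (simp add: fps_eq_iff)
  qed
  have eq_const: "h \<Phi> (fps_const X) = h \<Psi> (fps_const X)" if X: "X \<in> L" for X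
  proof -
    define c where "c Z n p = fps_nth (h \<Phi> (fps_const Z)) n p - fps_nth (h \<Psi> (fps_const Z)) n p" for Z n p
    have add: "c (Z + W) n p = c Z n p + c W n p" if "Z \<in> L" "W \<in> L" for Z W n p
      unfolding c_def h_def fps_const_add[symmetric] uea_hom_gen_add[OF h\<Phi> const[OF that(1)] const[OF that(2)]]
        uea_hom_gen_add[OF h\<Psi> const[OF that(1)] const[OF that(2)]] by simp
    have scale: "c (vf_scale r Z) n p = of_real r * c Z n p" if "Z \<in> L" for Z n p r
      unfolding c_def h_def formal_lie_scale_const[symmetric] uea_hom_gen_scale[OF h\<Phi> const[OF that]]
        uea_hom_gen_scale[OF h\<Psi> const[OF that]] complexify_simps fps_nth_formal_scale_const
      by (simp add: right_diff_distrib)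
    have br: "c (vf_bracket Z W) n p = 0" if "Z \<in> L" "W \<in> L" for Z W n p
      using bracket[OF that] by (simp add: c_def)
    have "(\<lambda>Z. Re (c Z n p)) \<in> cocycles1 L" "(\<lambda>Z. Im (c Z n p)) \<in> cocycles1 L" for n p
      by (auto simp: cocycles1_def linear_form_def add scale br)
    then have "(\<lambda>Z. Re (c Z n p)) \<in> coboundaries1 L" "(\<lambda>Z. Im (c Z n p)) \<in> coboundaries1 L" for n p
      using H1 by (auto simp: H1_vanishes_def L_def)
    then have "Re (c X n p) = 0" "Im (c X n p) = 0" for n p
      using X by (auto simp: coboundaries1_def)
    then have "c X n p = 0" for n p by (simp add: complex_eq_iff)
    then show ?thesis by (simp add: c_def fps_eq_iff fun_eq_iff)
  qed
  have "fps_nth (h \<Phi> \<xi>) n = fps_nth (h \<Psi> \<xi>) n" if "\<xi> \<in> formal_lie L" for \<xi> n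
    using that
  proof (induction n arbitrary: \<xi>)
    \<comment> \<open>A series is an infinite combination of constants, while
      \<open>\<Theta>\<close> respects finite sums only. With this identity, order
      \<open>n + 1\<close> of the image depends only on the constant term and on order
      \<open>n\<close> of the image of the tail.\<close>
    have split: "h \<Theta> \<xi> = h \<Theta> (fps_const (fps_nth \<xi> 0)) + formal_scale fps_X (h \<Theta> (fps_shift 1 \<xi>))"
      if "\<Theta> \<in> algebra_hom (uea L) (star_algebra AM star)" and \<xi>: "\<xi> \<in> formal_lie L" for \<Theta> \<xi>
    proof -
      have s: "fps_shift 1 \<xi> \<in> formal_lie L" and c: "fps_const (fps_nth \<xi> 0) \<in> formal_lie L"
        using \<xi> const by (auto simp: formal_lie_def)
      have "\<xi> = fps_const (fps_nth \<xi> 0) + formal_lie_scale fps_X (fps_shift 1 \<xi>)"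
        by (auto simp: fps_eq_iff formal_lie_scale_fps_X split: nat.splits)
      then have "h \<Theta> \<xi> = h \<Theta> (fps_const (fps_nth \<xi> 0) + formal_lie_scale fps_X (fps_shift 1 \<xi>))" by simp
      also have "\<dots> = h \<Theta> (fps_const (fps_nth \<xi> 0)) + formal_scale fps_X (h \<Theta> (fps_shift 1 \<xi>))"
        unfolding h_def uea_hom_gen_add[OF that(1) c formal_lie_scale_closed[OF rel s]]
          uea_hom_gen_scale[OF that(1) s] complexify_simps ..
      finally show ?thesis .
    qed
    {
      case 0
      have "fps_nth \<xi> 0 \<in> L" using 0 by (simp add: formal_lie_def)
      then show ?case
        unfolding split[OF h\<Phi> 0] split[OF h\<Psi> 0] by (simp add: eq_const formal_scale_fps_X)
    next
      case (Suc n)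
      have "fps_nth \<xi> 0 \<in> L" "fps_shift 1 \<xi> \<in> formal_lie L"
        using Suc.prems by (auto simp: formal_lie_def)
      then show ?case
        unfolding split[OF h\<Phi> Suc.prems] split[OF h\<Psi> Suc.prems]
        by (simp add: eq_const formal_scale_fps_X Suc.IH)
    }
  qed
  then have "h \<Phi> \<xi> = h \<Psi> \<xi>" if "\<xi> \<in> formal_lie L" for \<xi>
    using that by (simp add: fps_eq_iff)
  then show ?thesis
    unfolding h_def by (rule uea_hom_eqI[OF h\<Phi> h\<Psi> _ a[folded L_def]])
qed

section \<open>Transport along an equivalence\<close>

text \<open>Coefficients of the preimage of a series under \<open>Id + \<Sum>\<^sub>n \<lambda>\<^sup>n D\<^sub>n\<close>.\<close>

fun preimage_coeff :: "(nat \<Rightarrow> 'a \<Rightarrow> 'a) \<Rightarrow> (nat \<Rightarrow> 'a::ab_group_add) \<Rightarrow> nat \<Rightarrow> 'a" where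
  "preimage_coeff D v n = v n - (\<Sum>i\<in>{1..n}. D i (preimage_coeff D v (n - i)))"

declare preimage_coeff.simps [simp del]

text \<open>Isolates what concerns \<open>T\<close> alone; star products enter only when a quantum
  moment map is transported. \<open>T\<close> is described on \<open>formal_funs\<close> only, so
  all its properties are relative to that set.\<close>

locale invariant_formal_operator =
  fixes G :: "'g::{t2_space,second_countable_topology} monoid"
    and AG :: "('g, 'd::real_normed_vector) chart set"
    and AM :: "('m::{t2_space,second_countable_topology}, 'e::real_normed_vector) chart set"
    and act :: "'g \<Rightarrow> 'm \<Rightarrow> 'm"
    and T :: "'m cfun fps \<Rightarrow> 'm cfun fps" and D :: "nat \<Rightarrow> 'm cfun \<Rightarrow> 'm cfun"
  assumes GM: "smooth_action G AG AM act"
    and D_0: "\<And>f. D 0 f = f"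
    and D_diff: "\<And>n. n \<ge> 1 \<Longrightarrow> differential_operator AM (D n)"
    and D_const: "\<And>n c. n \<ge> 1 \<Longrightarrow> D n (\<lambda>_. c) = 0"
    and T_nth: "\<And>u n p. u \<in> formal_funs AM \<Longrightarrow> fps_nth (T u) n p = (\<Sum>i\<le>n. D i (fps_nth u (n - i)) p)"
    and T_translate: "\<And>g u. u \<in> formal_funs AM \<Longrightarrow> T (group_translate G act g u) = group_translate G act g (T u)"
begin

section \<open>Linearity and bijectivity of the equivalence\<close>

lemma tM: "topological_atlas AM" and tG: "topological_atlas AG"
  using GM smooth_atlas_imp_topological_atlas by (auto simp: smooth_action_def lie_group_def)

lemma T_nth_sum: "u \<in> formal_funs AM \<Longrightarrow> fps_nth (T u) n = (\<Sum>i\<le>n. D i (fps_nth u (n - i)))"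
  by (rule ext) (simp add: T_nth sum_fun_at)

text \<open>\<open>D 0\<close> is given as the identity and not as a
  \<open>differential_operator\<close>; hence the case distinction on \<open>n\<close> here and in
  the next lemmas.\<close>

lemma D_smooth: "smooth_fun AM f \<Longrightarrow> smooth_fun AM (D n f)"
  using smooth_fun_differential_operator[OF tM D_diff] by (cases n) (auto simp: D_0)

lemma D_add: "smooth_fun AM f \<Longrightarrow> smooth_fun AM g \<Longrightarrow> D n (f + g) = D n f + D n g"
  using differential_operator_add[OF tM D_diff] by (cases n) (auto simp: D_0)

lemma D_mult_left: "smooth_fun AM f \<Longrightarrow> D n (\<lambda>x. c * f x) = (\<lambda>x. c * D n f x)"
  using differential_operator_mult_left[OF tM D_diff] by (cases n) (auto simp: D_0)

lemma D_sum: "(\<And>i. i \<in> I \<Longrightarrow> smooth_fun AM (f i)) \<Longrightarrow> D n (\<Sum>i\<in>I. f i) = (\<Sum>i\<in>I. D n (f i))"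
proof (induction I rule: infinite_finite_induct)
  case (insert i I)
  then show ?case by (simp add: D_add smooth_fun_sum[OF tM] del: plus_fun_apply)
qed (use D_const[of n 0] in \<open>cases n; simp add: D_0 zero_fun_def\<close>)+

lemma formal_funs_nth: "u \<in> formal_funs AM \<Longrightarrow> smooth_fun AM (fps_nth u n)"
  by (simp add: formal_funs_def)

lemma T_closed: "u \<in> formal_funs AM \<Longrightarrow> T u \<in> formal_funs AM"
  by (simp add: formal_funs_def[of AM] T_nth_sum) (auto intro!: smooth_fun_sum[OF tM] D_smooth simp: formal_funs_nth)

lemma formal_funs_add: "u \<in> formal_funs AM \<Longrightarrow> v \<in> formal_funs AM \<Longrightarrow> u + v \<in> formal_funs AM"
  by (simp add: formal_funs_def smooth_fun_add[OF tM])

lemma formal_funs_diff: "u \<in> formal_funs AM \<Longrightarrow> v \<in> formal_funs AM \<Longrightarrow> u - v \<in> formal_funs AM"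
  by (simp add: formal_funs_def smooth_fun_diff[OF tM])

lemma formal_scale_nth: "fps_nth (formal_scale c u) n = (\<Sum>j\<le>n. (\<lambda>x. fps_nth c j * fps_nth u (n - j) x))"
  by (simp add: formal_scale_def fun_eq_iff sum_fun_at)

lemma formal_funs_scale: "u \<in> formal_funs AM \<Longrightarrow> formal_scale c u \<in> formal_funs AM"
  by (simp add: formal_funs_def[of AM] formal_scale_nth)
    (auto intro!: smooth_fun_sum[OF tM] smooth_fun_mult_left[OF tM] simp: formal_funs_nth)

lemma T_add: "u \<in> formal_funs AM \<Longrightarrow> v \<in> formal_funs AM \<Longrightarrow> T (u + v) = T u + T v"
  by (simp add: fps_eq_iff T_nth_sum formal_funs_add D_add formal_funs_nth sum.distrib)

lemma T_diff:
  assumes "u \<in> formal_funs AM" "v \<in> formal_funs AM" shows "T (u - v) = T u - T v"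
  using T_add[OF formal_funs_diff[OF assms] assms(2)] by (simp add: eq_diff_eq)

lemma T_scale:
  assumes u: "u \<in> formal_funs AM" shows "T (formal_scale c u) = formal_scale c (T u)"
proof (rule fps_ext, rule ext)
  fix n x
  let ?f = "\<lambda>i j. fps_nth c j * D i (fps_nth u (n - i - j)) x"
  have "fps_nth (T (formal_scale c u)) n x = (\<Sum>i\<le>n. \<Sum>j\<le>n - i. ?f i j)"
    using u by (simp add: T_nth formal_funs_scale formal_scale_nth D_sum smooth_fun_mult_left[OF tM]
        formal_funs_nth D_mult_left sum_fun_at)
  also have "\<dots> = (\<Sum>k\<le>n. \<Sum>i\<le>k. ?f i (k - i))" by (rule sum_triangle_reindex[symmetric])
  \<comment> \<open>Reversing the order within each diagonal lets the same triangle be read with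
    \<open>j\<close> as the outer index.\<close>
  also have "\<dots> = (\<Sum>k\<le>n. \<Sum>j\<le>k. ?f (k - j) j)"
  proof (rule sum.cong[OF refl])
    fix k
    show "(\<Sum>i\<le>k. ?f i (k - i)) = (\<Sum>j\<le>k. ?f (k - j) j)"
      by (rule sum.reindex_bij_witness[of _ "\<lambda>i. k - i" "\<lambda>i. k - i"]) auto
  qed
  also have "\<dots> = (\<Sum>j\<le>n. \<Sum>i\<le>n - j. ?f i j)" by (rule sum_triangle_reindex)
  also have "\<dots> = fps_nth (formal_scale c (T u)) n x"
    by (simp add: formal_scale_nth sum_fun_at T_nth u sum_distrib_left add.commute)
  finally show "fps_nth (T (formal_scale c u)) n x = fps_nth (formal_scale c (T u)) n x" .
qed

lemma one_closed: "1 \<in> formal_funs AM"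
  by (auto simp: formal_funs_def one_fun_def zero_fun_def smooth_fun_const)

lemma D_zero: "D n 0 = 0"
  using D_const[of n 0] by (cases n) (auto simp: D_0 zero_fun_def)

text \<open>On a constant series \<open>T\<close> exhibits its operators one by one, so identities
  for \<open>T\<close> can be read as identities for each \<open>D n\<close>.\<close>

lemma T_const:
  assumes f: "smooth_fun AM f" shows "fps_nth (T (fps_const f)) n = D n f"
proof -
  have "fps_const f \<in> formal_funs AM"
    using f by (auto simp: formal_funs_def zero_fun_def smooth_fun_const)
  then have "fps_nth (T (fps_const f)) n = (\<Sum>i\<le>n. D i (fps_nth (fps_const f) (n - i)))"
    by (rule T_nth_sum)
  also have "\<dots> = (\<Sum>i\<le>n. if i = n then D n f else 0)"
    by (intro sum.cong) (auto simp: D_zero)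
  finally show ?thesis by simp
qed

lemma T_one: "T 1 = 1"
proof (rule fps_ext)
  fix n
  have "fps_nth (T (fps_const 1)) n = D n 1"
    by (rule T_const) (simp add: one_fun_def smooth_fun_const)
  also have "\<dots> = fps_nth (fps_const 1) n"
    using D_const[of n 1] by (cases n) (auto simp: D_0 one_fun_def)
  finally show "fps_nth (T 1) n = fps_nth 1 n" by simp
qed

text \<open>\<open>T\<close> is unitriangular: order \<open>n\<close> of \<open>T w\<close> is order
  \<open>n\<close> of \<open>w\<close> plus terms in lower orders, so the coefficients of
  \<open>w\<close> are recovered by strong induction.\<close>

lemma T_inj: "inj_on T (formal_funs AM)"
proof (rule inj_onI)
  fix u v assume u: "u \<in> formal_funs AM" and v: "v \<in> formal_funs AM" and eq: "T u = T v"
  have "fps_nth u n = fps_nth v n" for n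
  proof (induction n rule: less_induct)
    case (less n)
    have split: "fps_nth (T w) n = fps_nth w n + (\<Sum>i\<in>{1..n}. D i (fps_nth w (n - i)))"
      if "w \<in> formal_funs AM" for w
      using that by (simp add: T_nth_sum atMost_atLeast0 sum.atLeast_Suc_atMost D_0)
    have "(\<Sum>i\<in>{1..n}. D i (fps_nth u (n - i))) = (\<Sum>i\<in>{1..n}. D i (fps_nth v (n - i)))"
      by (intro sum.cong refl arg_cong[of _ _ "D _"] less) auto
    then show ?case using split[OF u] split[OF v] eq by simp
  qed
  then show "u = v" by (simp add: fps_eq_iff)
qed

text \<open>The same triangular system is solved for the unknown coefficients; they are smooth by
  strong induction, since every \<open>D i\<close> preserves smoothness.\<close>

lemma T_surj:
  assumes v: "v \<in> formal_funs AM"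
  obtains u where "u \<in> formal_funs AM" "T u = v"
proof -
  define u where "u = Abs_fps (preimage_coeff D (fps_nth v))"
  have rec: "fps_nth u n = fps_nth v n - (\<Sum>i\<in>{1..n}. D i (fps_nth u (n - i)))" for n
    unfolding u_def fps_nth_Abs_fps by (rule preimage_coeff.simps)
  have "smooth_fun AM (fps_nth u n)" for n
  proof (induction n rule: less_induct)
    case (less n)
    show ?case
      by (subst rec) (intro smooth_fun_diff[OF tM] smooth_fun_sum[OF tM] D_smooth less formal_funs_nth v; simp)
  qed
  then have u: "u \<in> formal_funs AM" by (simp add: formal_funs_def)
  have "fps_nth (T u) n = fps_nth u n + (\<Sum>i\<in>{1..n}. D i (fps_nth u (n - i)))" for n
    using u by (simp add: T_nth_sum atMost_atLeast0 sum.atLeast_Suc_atMost D_0)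
  then have "fps_nth (T u) n = fps_nth v n" for n using rec[of n] by simp
  then have "T u = v" by (simp add: fps_eq_iff)
  with u that show ?thesis by blast
qed

section \<open>Invariance and transport of the quantum moment map\<close>

text \<open>Invariance is assumed for \<open>T\<close> as a whole; testing it on constant series and
  comparing orders gives the invariance of each operator.\<close>

lemma D_translate:
  assumes f: "smooth_fun AM f"
  shows "D n (\<lambda>p. f (act (inv\<^bsub>G\<^esub> g) p)) = (\<lambda>p. D n f (act (inv\<^bsub>G\<^esub> g) p))"
proof -
  have fc: "fps_const f \<in> formal_funs AM"
    using f by (auto simp: formal_funs_def zero_fun_def smooth_fun_const)
  have s: "smooth_fun AM (\<lambda>p. f (act (inv\<^bsub>G\<^esub> g) p))"
    using smooth_fun_slice_right[OF tG tM smooth_fun_translate[OF GM f], of g] by simp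
  have "group_translate G act g (fps_const f) = fps_const (\<lambda>p. f (act (inv\<^bsub>G\<^esub> g) p))"
    by (auto simp: group_translate_def fps_eq_iff)
  then have "fps_nth (T (fps_const (\<lambda>p. f (act (inv\<^bsub>G\<^esub> g) p)))) n = fps_nth (group_translate G act g (T (fps_const f))) n"
    using T_translate[OF fc, of g] by simp
  then show ?thesis unfolding T_const[OF s] by (simp add: group_translate_def T_const[OF f])
qed

lemma D_inf_action:
  assumes X: "X \<in> lie_algebra G AG" and f: "smooth_fun AM f"
  shows "D n (inf_action G act X f) = inf_action G act X (D n f)"
  using differential_operator_inf_action[OF GM X f D_diff D_translate[OF f]] by (cases n) (auto simp: D_0)

lemma formal_inf_action_closed:
  assumes "X \<in> lie_algebra G AG" "u \<in> formal_funs AM"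
  shows "formal_inf_action G act X u \<in> formal_funs AM"
  using assms smooth_fun_inf_action[OF GM] by (simp add: formal_inf_action_def formal_funs_def)

lemma T_formal_inf_action:
  assumes X: "X \<in> lie_algebra G AG" and u: "u \<in> formal_funs AM"
  shows "T (formal_inf_action G act X u) = formal_inf_action G act X (T u)"
proof (rule fps_ext)
  fix n
  have inf_sum: "inf_action G act X (\<Sum>i\<le>m. f i) = (\<Sum>i\<le>m. inf_action G act X (f i))"
    if "\<And>i. smooth_fun AM (f i)" for f and m :: nat
    using that by (induction m) (simp_all add: inf_action_add[OF GM X] smooth_fun_sum[OF tM])
  have "fps_nth (T (formal_inf_action G act X u)) n = (\<Sum>i\<le>n. D i (inf_action G act X (fps_nth u (n - i))))"
    by (simp add: T_nth_sum formal_inf_action_closed[OF X u]) (simp add: formal_inf_action_def)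
  also have "\<dots> = inf_action G act X (\<Sum>i\<le>n. D i (fps_nth u (n - i)))"
    by (simp add: D_inf_action[OF X] formal_funs_nth[OF u] inf_sum D_smooth)
  also have "\<dots> = fps_nth (formal_inf_action G act X (T u)) n"
    by (simp add: formal_inf_action_def T_nth_sum u)
  finally show "fps_nth (T (formal_inf_action G act X u)) n = fps_nth (formal_inf_action G act X (T u)) n" .
qed

lemma quantum_moment_map_transport:
  assumes star: "\<And>u v. u \<in> formal_funs AM \<Longrightarrow> v \<in> formal_funs AM \<Longrightarrow> star u v \<in> formal_funs AM"
    and star': "\<And>u v. u \<in> formal_funs AM \<Longrightarrow> v \<in> formal_funs AM \<Longrightarrow>
      star' u v = T (star (inv_into (formal_funs AM) T u) (inv_into (formal_funs AM) T v))"
    and \<Phi>: "quantum_moment_map G AG AM act star \<Phi>"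
  shows "quantum_moment_map G AG AM act star' (\<lambda>a. T (\<Phi> a))"
proof -
  \<comment> \<open>The formula for \<open>star'\<close> involves the inverse of \<open>T\<close>,
    which cancels on images of \<open>T\<close> because \<open>T\<close> is injective on
    \<open>formal_funs\<close>.\<close>
  have T_star: "T (star u v) = star' (T u) (T v)" if "u \<in> formal_funs AM" "v \<in> formal_funs AM" for u v
    using that by (simp add: star' T_closed inv_into_f_f[OF T_inj])
  have "T \<in> algebra_hom (star_algebra AM star) (star_algebra AM star')"
    by (auto simp: algebra_hom_def ring_hom_def star_algebra_def T_closed T_star T_add T_one T_scale)
  moreover have \<Phi>h: "\<Phi> \<in> algebra_hom (uea (lie_algebra G AG)) (star_algebra AM star)"
    using \<Phi> by (simp add: quantum_moment_map_def)
  ultimately have hom: "(\<lambda>a. T (\<Phi> a)) \<in> algebra_hom (uea (lie_algebra G AG)) (star_algebra AM star')"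
    using algebra_hom_compose by blast
  have "star' (T x) v - star' v (T x) = formal_scale fps_X (formal_inf_action G act X v)"
    if X: "X \<in> lie_algebra G AG" and v: "v \<in> formal_funs AM"
      and x: "x = \<Phi> (uea_incl (lie_algebra G AG) X)" for X v x
  proof -
    \<comment> \<open>Every test function \<open>v\<close> is some \<open>T u\<close>, so the
      condition at \<open>v\<close> is the image under \<open>T\<close> of the condition for
      \<open>star\<close> at \<open>u\<close>.\<close>
    obtain u where u: "u \<in> formal_funs AM" "T u = v" using T_surj[OF v] by blast
    have xc: "x \<in> formal_funs AM"
      unfolding x uea_incl_def
      by (rule uea_hom_gen_closed[OF \<Phi>h fps_const_formal_lie[OF uea_relations_closed[OF \<Phi>h] X]])
    have "star x u - star u x = formal_scale fps_X (formal_inf_action G act X u)"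
      using \<Phi> X u(1) unfolding quantum_moment_map_def x Let_def by blast
    then have "T (star x u - star u x) = T (formal_scale fps_X (formal_inf_action G act X u))" by simp
    then show ?thesis
      by (simp add: T_diff T_star T_scale star xc u formal_inf_action_closed X T_formal_inf_action)
  qed
  with hom show ?thesis by (simp add: quantum_moment_map_def Let_def)
qed

end

text \<open>Homomorphisms are total functions with arbitrary values off the carrier, so the equality
  of maps is stated on the carrier of the enveloping algebra.\<close>

theorem corollary1:
  fixes G :: "'g::{t2_space,second_countable_topology} monoid"
    and AG :: "('g, 'd::real_normed_vector) chart set"
    and AM :: "('m::{t2_space,second_countable_topology}, 'e::real_normed_vector) chart set"
    and \<omega> :: "'m \<Rightarrow> ('m cfun \<Rightarrow> complex) \<Rightarrow> ('m cfun \<Rightarrow> complex) \<Rightarrow> real"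
    and act :: "'g \<Rightarrow> 'm \<Rightarrow> 'm"
    and star star' :: "'m cfun fps \<Rightarrow> 'm cfun fps \<Rightarrow> 'm cfun fps"
    and \<Phi> \<Phi>' :: "(('g cfun \<Rightarrow> 'g cfun) fps list \<Rightarrow> complex fps) set \<Rightarrow> 'm cfun fps"
    and T :: "'m cfun fps \<Rightarrow> 'm cfun fps"
  assumes "lie_group G AG"
    and "hamiltonian_space G AG AM \<omega> act"
    and "H1_vanishes (lie_algebra G AG)"
    and "invariant_star_product G AM \<omega> act star"
    and "invariant_star_product G AM \<omega> act star'"
    and "quantum_moment_map G AG AM act star \<Phi>"
    and "quantum_moment_map G AG AM act star' \<Phi>'"
    and "G_equivalence G AM act star star' T"
  shows "\<forall>a\<in>carrier (uea (lie_algebra G AG)). \<Phi>' a = T (\<Phi> a)"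
proof -
  obtain D where D: "\<forall>f. D 0 f = f" "\<forall>n\<ge>1. differential_operator AM (D n) \<and> (\<forall>c. D n (\<lambda>_. c) = 0)"
    "\<forall>u\<in>formal_funs AM. \<forall>n p. fps_nth (T u) n p = (\<Sum>i\<le>n. D i (fps_nth u (n - i)) p)"
    using assms(8) unfolding G_equivalence_def by (elim conjE exE)
  have GM: "smooth_action G AG AM act"
    using assms(1,2) by (simp add: smooth_action_def hamiltonian_space_def)
  interpret invariant_formal_operator G AG AM act T D
    by unfold_locales (use GM D assms(8) in \<open>simp_all add: G_equivalence_def\<close>)
  have "quantum_moment_map G AG AM act star' (\<lambda>a. T (\<Phi> a))"
    by (rule quantum_moment_map_transport[OF _ _ assms(6)])
      (use assms(4,8) in \<open>simp_all add: invariant_star_product_def star_product_def G_equivalence_def\<close>)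
  then show ?thesis
    using quantum_moment_map_unique[OF assms(3,7)] by blast
qed

end
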